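(* Let $S$ be a smooth del Pezzo surface of degree two over $\mathbb{C}$ with a generalized Eckardt point, and let $\pi\colon S\to\mathbb{P}^2$ be a blow-up of $\mathbb{P}^2$ at seven points in general position. Then $\pi$ is one of the blow-ups (a), (b), (c) described in the context; that is, the seven blown-up points can be labelled $x_1,\dots,x_7$ so that they arise from construction (a), (b) or (c).
   Context: A generalized Eckardt point of $S$ is a point at which four $(-1)$-curves of $S$ meet. The constructions of seven points $x_1,\dots,x_7\in\mathbb{P}^2$, for choices such that the resulting seven points are distinct and in general position (i.e. their blow-up is a del Pezzo surface), are: (a) Let $t_1,t_2$ be two lines in $\mathbb{P}^2$ meeting at a point $q$; pick $x_1,x_2\in t_1$ and $x_3,x_4\in t_2$. Let $s_1$ be a conic through $q,x_1,x_3$ and $s_2$ a conic through $q,x_2,x_4$. Then $x_5,x_6,x_7$ are defined by $s_1\cap s_2=\{q,x_5,x_6,x_7\}$. (b) Let $x_1\in\mathbb{P}^2$ and let $s_1,s_2,s_3$ be conics passing through $x_1$ with the same tangent direction at $x_1$. The other points are defined by $s_1\cap s_2=\{x_1,x_2,x_3\}$, $s_1\cap s_3=\{x_1,x_4,x_5\}$, $s_2\cap s_3=\{x_1,x_6,x_7\}$. (c) Let $x_1\in\mathbb{P}^2$, $t$ a line through $x_1$, and $s$ a conic tangent to $t$ at $x_1$. Pick $x_2\in t$ and $x_3,\dots,x_6\in s$. Pick a nodal cubic containing $x_2,\dots,x_6$ and passing through $x_1$ with tangent direction $t$; $x_7$ is the node of this cubic. *)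

theory Defs
  imports
    "HOL-Analysis.Analysis"
    "HOL-Library.Poly_Mapping"
    "HOL-Computational_Algebra.Computational_Algebra"
begin

section \<open>The complex projective plane\<close>

text \<open>Points and lines of the plane are the vector subspaces of dimension 1 and 2 of
  complex 3-space (the module \<open>vec\<close> is taken over the complex numbers).\<close>

typedef ppoint = "{L :: (complex^3) set. vec.subspace L \<and> vec.dim L = 1}"
proof
  show "vec.span {axis 1 1} \<in> {L :: (complex^3) set. vec.subspace L \<and> vec.dim L = 1}"
    by (simp add: axis_eq_0_iff)
qed

typedef pline = "{L :: (complex^3) set. vec.subspace L \<and> vec.dim L = 2}"
proof
  have "vec.dim {x :: complex^3. \<forall>i. i \<notin> {1, 2} \<longrightarrow> x $ i = 0} = card {1 :: 3, 2}"
    by (rule dim_substandard_cart)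
  moreover have "vec.subspace {x :: complex^3. \<forall>i. i \<notin> {1, 2} \<longrightarrow> x $ i = 0}"
    by (auto simp: vec.subspace_def)
  ultimately show "{x :: complex^3. \<forall>i. i \<notin> {1, 2} \<longrightarrow> x $ i = 0} \<in>
      {L :: (complex^3) set. vec.subspace L \<and> vec.dim L = 2}"
    by simp
qed

definition on_line :: "ppoint \<Rightarrow> pline \<Rightarrow> bool" where
  "on_line p l \<longleftrightarrow> Rep_ppoint p \<subseteq> Rep_pline l"


section \<open>Plane curves\<close>

text \<open>Polynomials in three variables; an exponent vector has type \<open>3 \<Rightarrow>\<^sub>0 nat\<close>.\<close>

type_synonym poly3 = "(3 \<Rightarrow>\<^sub>0 nat) \<Rightarrow>\<^sub>0 complex"

definition homogeneous :: "nat \<Rightarrow> poly3 \<Rightarrow> bool" where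
  "homogeneous d F \<longleftrightarrow>
     (\<forall>e \<in> Poly_Mapping.keys F. (\<Sum>i\<in>UNIV. Poly_Mapping.lookup e i) = d)"

definition subst3 ::
  "(complex \<Rightarrow> 'r::comm_semiring_1) \<Rightarrow> (3 \<Rightarrow> 'r) \<Rightarrow> poly3 \<Rightarrow> 'r" where
  "subst3 h f F = (\<Sum>e\<in>Poly_Mapping.keys F.
     h (Poly_Mapping.lookup F e) * (\<Prod>i\<in>UNIV. f i ^ Poly_Mapping.lookup e i))"

definition eval3 :: "poly3 \<Rightarrow> complex^3 \<Rightarrow> complex" where
  "eval3 F a = subst3 (\<lambda>c. c) (\<lambda>i. a $ i) F"

text \<open>\<open>F(a + t w)\<close> as a polynomial in \<open>t\<close>.\<close>

definition along :: "poly3 \<Rightarrow> complex^3 \<Rightarrow> complex^3 \<Rightarrow> complex poly" where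
  "along F a w = subst3 (\<lambda>c. [:c:]) (\<lambda>i. [:a $ i, w $ i:]) F"

definition zeros :: "poly3 \<Rightarrow> ppoint set" where
  "zeros F = {p. \<forall>a \<in> Rep_ppoint p. eval3 F a = 0}"

definition vanishes_to_order :: "poly3 \<Rightarrow> ppoint \<Rightarrow> nat \<Rightarrow> bool" where
  "vanishes_to_order F p k \<longleftrightarrow>
     (\<forall>a \<in> Rep_ppoint p - {0}. \<forall>w. \<forall>j<k. coeff (along F a w) j = 0)"

text \<open>Multiplicity of the curve \<open>F = 0\<close> at \<open>p\<close> (meaningful for \<open>F \<noteq> 0\<close>).\<close>

definition mult_at :: "poly3 \<Rightarrow> ppoint \<Rightarrow> nat" where
  "mult_at F p = (LEAST k. \<not> vanishes_to_order F p (Suc k))"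

text \<open>The lines of the tangent cone at \<open>p\<close>: for \<open>m\<close> the multiplicity at \<open>p = [a]\<close>, the
  coefficient of \<open>t^m\<close> in \<open>F(a + t w)\<close> is the leading form of \<open>F\<close> at \<open>p\<close> in the
  direction \<open>w\<close>. It only depends on \<open>w\<close> modulo \<open>a\<close>.\<close>

definition tangent_lines :: "poly3 \<Rightarrow> ppoint \<Rightarrow> pline set" where
  "tangent_lines F p = {l. on_line p l \<and>
     (\<forall>a \<in> Rep_ppoint p - {0}. \<forall>w \<in> Rep_pline l. coeff (along F a w) (mult_at F p) = 0)}"

definition smooth_with_tangent :: "poly3 \<Rightarrow> ppoint \<Rightarrow> pline \<Rightarrow> bool" where
  "smooth_with_tangent F p l \<longleftrightarrow> mult_at F p = 1 \<and> l \<in> tangent_lines F p"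

text \<open>A node is an ordinary double point: two distinct tangent lines.\<close>

definition node :: "poly3 \<Rightarrow> ppoint \<Rightarrow> bool" where
  "node F p \<longleftrightarrow> mult_at F p = 2 \<and> card (tangent_lines F p) = 2"

definition conic :: "poly3 \<Rightarrow> bool" where
  "conic F \<longleftrightarrow> homogeneous 2 F \<and> irreducible F"

definition nodal_cubic :: "poly3 \<Rightarrow> ppoint \<Rightarrow> bool" where
  "nodal_cubic F p \<longleftrightarrow> homogeneous 3 F \<and> irreducible F \<and> node F p"


section \<open>The blow-up of the plane in a finite set of points\<close>

text \<open>The blow-up of the plane in one point \<open>x\<close> is the incidence variety of pairs
  \<open>(p, l)\<close> with \<open>p, x \<in> l\<close>; the blow-up in a finite set \<open>X\<close> of distinct points is the
  fibre product of these over the plane, and the blow-down morphism is \<open>fst\<close>.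
  A point over \<open>x \<in> X\<close> is thus given by a line \<open>l x\<close> through \<open>x\<close>, i.e. by a tangent direction
  at \<open>x\<close>; over any other \<open>p\<close> there is only one point.\<close>

type_synonym bpoint = "ppoint \<times> (ppoint \<Rightarrow> pline)"

definition blowup :: "ppoint set \<Rightarrow> bpoint set" where
  "blowup X = {(p, l). l \<in> extensional X \<and> (\<forall>x\<in>X. on_line x (l x) \<and> on_line p (l x))}"

definition exceptional_curve :: "ppoint set \<Rightarrow> ppoint \<Rightarrow> bpoint set" where
  "exceptional_curve X x = {P \<in> blowup X. fst P = x}"

text \<open>Local coordinates \<open>(u, v)\<close> of the blow-up at \<open>P\<close> are obtained from a basis \<open>a, b, c\<close>:
  \<^item> \<open>(u, v) \<mapsto> [a + u b + v c]\<close> if \<open>P\<close> lies over \<open>[a] \<notin> X\<close>;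
  \<^item> \<open>(u, v) \<mapsto> [a + u (b + v c)]\<close> if \<open>P\<close> lies over \<open>[a] \<in> X\<close> and corresponds to the line
    spanned by \<open>a\<close> and \<open>b\<close>; here \<open>u = 0\<close> is the exceptional curve.\<close>

definition frame_at :: "ppoint set \<Rightarrow> bpoint \<Rightarrow> complex^3 \<Rightarrow> complex^3 \<Rightarrow> complex^3 \<Rightarrow> bool" where
  "frame_at X P a b c \<longleftrightarrow>
     det (vector [a, b, c] :: complex^3^3) \<noteq> 0 \<and> a \<in> Rep_ppoint (fst P) \<and>
     (fst P \<in> X \<longrightarrow> b \<in> Rep_pline (snd P (fst P)))"

text \<open>The pull-back of \<open>F\<close> to these coordinates, divided by \<open>u^m\<close> if \<open>P\<close> lies over \<open>X\<close>
  (an exact division if \<open>F\<close> vanishes to order \<open>m\<close> there). It is a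
  polynomial in \<open>u\<close> whose coefficients are polynomials in \<open>v\<close>.\<close>

definition local_equation ::
  "ppoint set \<Rightarrow> nat \<Rightarrow> poly3 \<Rightarrow> bpoint \<Rightarrow> complex^3 \<Rightarrow> complex^3 \<Rightarrow> complex^3
     \<Rightarrow> complex poly poly" where
  "local_equation X m F P a b c =
     (if fst P \<in> X
      then poly_shift m
             (subst3 (\<lambda>z. [:[:z:]:]) (\<lambda>i. [:[:a $ i:], [:b $ i, c $ i:]:]) F)
      else subst3 (\<lambda>z. [:[:z:]:]) (\<lambda>i. [:[:a $ i, c $ i:], [:b $ i:]:]) F)"

abbreviation local_coeff :: "complex poly poly \<Rightarrow> nat \<Rightarrow> nat \<Rightarrow> complex" where
  "local_coeff f i j \<equiv> coeff (coeff f i) j"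

text \<open>The strict transform is the total transform with the exceptional curves removed as
  often as they occur in it.\<close>

definition strict_transform :: "ppoint set \<Rightarrow> poly3 \<Rightarrow> bpoint set" where
  "strict_transform X F = {P \<in> blowup X. \<forall>a b c. frame_at X P a b c \<longrightarrow>
     local_coeff (local_equation X (mult_at F (fst P)) F P a b c) 0 0 = 0}"


section \<open>Divisor classes, (-1)-curves and generalized Eckardt points\<close>

text \<open>The pair \<open>(d, m)\<close> stands for the class \<open>d H - (\<Sum>x\<in>X. m x E\<^sub>x)\<close>, with \<open>H\<close> the
  pull-back of a line and \<open>E\<^sub>x\<close> the exceptional curve over \<open>x\<close>. Only the values of \<open>m\<close> on
  \<open>X\<close> matter.\<close>

type_synonym divisor_class = "int \<times> (ppoint \<Rightarrow> int)"

definition intersection :: "ppoint set \<Rightarrow> divisor_class \<Rightarrow> divisor_class \<Rightarrow> int" where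
  "intersection X D D' = fst D * fst D' - (\<Sum>x\<in>X. snd D x * snd D' x)"

definition canonical_class :: divisor_class where
  "canonical_class = (-3, \<lambda>_. -1)"

text \<open>The irreducible curves on the blow-up, with their classes, are the exceptional curves and
  the strict transforms of irreducible plane curves.\<close>

definition irreducible_curve :: "ppoint set \<Rightarrow> bpoint set \<Rightarrow> divisor_class \<Rightarrow> bool" where
  "irreducible_curve X C D \<longleftrightarrow>
     (\<exists>x\<in>X. C = exceptional_curve X x \<and> D = (0, \<lambda>y. if y = x then -1 else 0)) \<or>
     (\<exists>F d. homogeneous d F \<and> irreducible F \<and> C = strict_transform X F \<and>
        D = (int d, \<lambda>x. int (mult_at F x)))"

definition minus_one_curve :: "ppoint set \<Rightarrow> bpoint set \<Rightarrow> bool" where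
  "minus_one_curve X C \<longleftrightarrow> (\<exists>D. irreducible_curve X C D \<and>
     intersection X D D = -1 \<and> intersection X D canonical_class = -1)"

definition generalized_eckardt_point :: "ppoint set \<Rightarrow> bpoint \<Rightarrow> bool" where
  "generalized_eckardt_point X P \<longleftrightarrow> P \<in> blowup X \<and>
     (\<exists>A. card A = 4 \<and> (\<forall>C\<in>A. minus_one_curve X C \<and> P \<in> C))"


section \<open>Del Pezzo surfaces\<close>

text \<open>As the anticanonical class is \<open>3 H - (\<Sum>x\<in>X. E\<^sub>x)\<close>, the global sections of its \<open>n\<close>-th
  multiple are the forms of degree \<open>3 n\<close> vanishing to order \<open>n\<close> at each \<open>x \<in> X\<close>. In a
  trivialization near \<open>P\<close> such a section is given by \<open>local_equation X n\<close>.\<close>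

definition pluri_anticanonical_sections :: "ppoint set \<Rightarrow> nat \<Rightarrow> poly3 set" where
  "pluri_anticanonical_sections X n =
     {F. homogeneous (3 * n) F \<and> (\<forall>x\<in>X. vanishes_to_order F x n)}"

definition section_vanishes_at :: "ppoint set \<Rightarrow> nat \<Rightarrow> poly3 \<Rightarrow> bpoint \<Rightarrow> bool" where
  "section_vanishes_at X n F P \<longleftrightarrow>
     (\<forall>a b c. frame_at X P a b c \<longrightarrow> local_coeff (local_equation X n F P a b c) 0 0 = 0)"

text \<open>Very ample: the sections separate points and tangent vectors
  (\<open>\<alpha> \<partial>/\<partial>u + \<beta> \<partial>/\<partial>v\<close> in local coordinates).\<close>

definition pluri_anticanonical_very_ample :: "ppoint set \<Rightarrow> nat \<Rightarrow> bool" where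
  "pluri_anticanonical_very_ample X n \<longleftrightarrow>
     (\<forall>P \<in> blowup X. \<forall>Q \<in> blowup X. P \<noteq> Q \<longrightarrow>
        (\<exists>F \<in> pluri_anticanonical_sections X n.
           section_vanishes_at X n F P \<and> \<not> section_vanishes_at X n F Q)) \<and>
     (\<forall>P \<in> blowup X. \<forall>a b c \<alpha> \<beta>. frame_at X P a b c \<longrightarrow> (\<alpha>, \<beta>) \<noteq> (0, 0) \<longrightarrow>
        (\<exists>F \<in> pluri_anticanonical_sections X n.
           section_vanishes_at X n F P \<and>
           \<alpha> * local_coeff (local_equation X n F P a b c) 1 0 +
           \<beta> * local_coeff (local_equation X n F P a b c) 0 1 \<noteq> 0))"

text \<open>The blow-up is a del Pezzo surface, i.e. its anticanonical class is ample; equivalently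
  phrased, the points of \<open>X\<close> are in general position.\<close>

definition del_pezzo_blowup :: "ppoint set \<Rightarrow> bool" where
  "del_pezzo_blowup X \<longleftrightarrow> finite X \<and> (\<exists>n>0. pluri_anticanonical_very_ample X n)"

abbreviation general_position :: "ppoint set \<Rightarrow> bool" where
  "general_position X \<equiv> del_pezzo_blowup X"

definition surface_degree :: "ppoint set \<Rightarrow> int" where
  "surface_degree X = intersection X canonical_class canonical_class"


section \<open>The three constructions\<close>

definition admissible :: "(nat \<Rightarrow> ppoint) \<Rightarrow> bool" where
  "admissible x \<longleftrightarrow> inj_on x {1..7} \<and> general_position (x ` {1..7})"

definition construction_a :: "(nat \<Rightarrow> ppoint) \<Rightarrow> bool" where
  "construction_a x \<longleftrightarrow> admissible x \<and>
     (\<exists>t\<^sub>1 t\<^sub>2 q s\<^sub>1 s\<^sub>2.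
        t\<^sub>1 \<noteq> t\<^sub>2 \<and> on_line q t\<^sub>1 \<and> on_line q t\<^sub>2 \<and>
        on_line (x 1) t\<^sub>1 \<and> on_line (x 2) t\<^sub>1 \<and> on_line (x 3) t\<^sub>2 \<and> on_line (x 4) t\<^sub>2 \<and>
        conic s\<^sub>1 \<and> {q, x 1, x 3} \<subseteq> zeros s\<^sub>1 \<and>
        conic s\<^sub>2 \<and> {q, x 2, x 4} \<subseteq> zeros s\<^sub>2 \<and>
        zeros s\<^sub>1 \<inter> zeros s\<^sub>2 = {q, x 5, x 6, x 7})"

definition construction_b :: "(nat \<Rightarrow> ppoint) \<Rightarrow> bool" where
  "construction_b x \<longleftrightarrow> admissible x \<and>
     (\<exists>t s\<^sub>1 s\<^sub>2 s\<^sub>3.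
        conic s\<^sub>1 \<and> conic s\<^sub>2 \<and> conic s\<^sub>3 \<and>
        x 1 \<in> zeros s\<^sub>1 \<and> x 1 \<in> zeros s\<^sub>2 \<and> x 1 \<in> zeros s\<^sub>3 \<and>
        smooth_with_tangent s\<^sub>1 (x 1) t \<and> smooth_with_tangent s\<^sub>2 (x 1) t \<and>
        smooth_with_tangent s\<^sub>3 (x 1) t \<and>
        zeros s\<^sub>1 \<inter> zeros s\<^sub>2 = {x 1, x 2, x 3} \<and>
        zeros s\<^sub>1 \<inter> zeros s\<^sub>3 = {x 1, x 4, x 5} \<and>
        zeros s\<^sub>2 \<inter> zeros s\<^sub>3 = {x 1, x 6, x 7})"

definition construction_c :: "(nat \<Rightarrow> ppoint) \<Rightarrow> bool" where
  "construction_c x \<longleftrightarrow> admissible x \<and>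
     (\<exists>t s g.
        on_line (x 1) t \<and>
        conic s \<and> x 1 \<in> zeros s \<and> smooth_with_tangent s (x 1) t \<and>
        on_line (x 2) t \<and> {x 3, x 4, x 5, x 6} \<subseteq> zeros s \<and>
        nodal_cubic g (x 7) \<and> {x 2, x 3, x 4, x 5, x 6} \<subseteq> zeros g \<and>
        x 1 \<in> zeros g \<and> smooth_with_tangent g (x 1) t)"

end

theory Submission
  imports Defs
begin

text \<open>Through the given point of the surface pass four (-1)-curves, any two of which therefore meet.
  The (-1)-curves are the exceptional curves \<open>E\<^sub>i\<close>, the lines \<open>L\<^sub>i\<^sub>j\<close> through two of the points, the conics
  \<open>Q\<^sub>i\<^sub>j\<close> omitting two of the points, and the cubics \<open>C\<^sub>i\<close> with a double point at \<open>x\<^sub>i\<close>; their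
  intersection numbers leave four configurations, up to labelling: \<open>L\<^sub>1\<^sub>2, L\<^sub>3\<^sub>4, Q\<^sub>2\<^sub>4, Q\<^sub>1\<^sub>3\<close> is
  (a); \<open>E\<^sub>1, Q\<^sub>6\<^sub>7, Q\<^sub>4\<^sub>5, Q\<^sub>2\<^sub>3\<close> is (b); \<open>E\<^sub>1, L\<^sub>1\<^sub>2, Q\<^sub>2\<^sub>7, C\<^sub>7\<close> is (c); and
  \<open>L\<^sub>1\<^sub>2, L\<^sub>3\<^sub>4, L\<^sub>5\<^sub>6, C\<^sub>7\<close> is turned into (b) by the Geiser involution, which exchanges \<open>E\<^sub>i\<close> with \<open>C\<^sub>i\<close>
  and \<open>L\<^sub>i\<^sub>j\<close> with \<open>Q\<^sub>i\<^sub>j\<close>.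

  The cubic \<open>C\<^sub>7\<close> in (c) may be cuspidal. Then its smooth points form an additive group in which
  the tangencies read \<open>t\<^sub>2 = -2 t\<^sub>1\<close> and \<open>t\<^sub>3 + t\<^sub>4 + t\<^sub>5 + t\<^sub>6 = -2 t\<^sub>1\<close>. The conjugate configuration
  \<open>E\<^sub>7, L\<^sub>2\<^sub>7, Q\<^sub>1\<^sub>2, C\<^sub>1\<close> is again of type (c). If \<open>C\<^sub>1\<close> is cuspidal, too, then the discriminant of its
  tangent cone vanishes; it is a product over the three ways to split \<open>{3, 4, 5, 6}\<close> into pairs,
  and the vanishing of a factor produces a configuration of type (a).\<close>

text \<open>Everything is carried out on plane forms. A point of the surface over \<open>x\<close>
  is a tangent direction at \<open>x\<close>, so passing through it means contact along that
  direction to one order more than the multiplicity. Of intersection theory one consequence is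
  proved by hand: two curves whose classes have intersection number at most 0 share a point only if
  they coincide. For lines and conics this is Bezout on a line together with the uniqueness of a
  conic under five conditions; two cubics require a resultant. Ampleness enters by restricting
  sections to a line or a conic: three collinear points or six points on a conic would give a curve
  of anticanonical degree at most 0. The Geiser involution is not constructed; a pencil of cubics
  through the seven points yields the common tangent directly. In the cuspidal case the group law
  becomes Vieta's formula: on the points \<open>(t, t^3, 1)\<close> a conic restricts to a sextic
  without a term in \<open>t^5\<close>, so its zeros sum to 0. In the same way the equations of the
  auxiliary conics and cubics are read off from prescribed zeros.\<close>

no_notation fps_nth (infixl "$" 75)

section \<open>Ternary forms\<close>

lemma poly_mapping_eq_sum_single:
  "F = (\<Sum>e\<in>Poly_Mapping.keys F. Poly_Mapping.single e (Poly_Mapping.lookup F e))"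
  by (rule poly_mapping_eqI)
    (auto simp: lookup_sum lookup_single when_def in_keys_iff sum.delta' cong: if_cong)

lemma subst3_superset:
  assumes "finite S" "Poly_Mapping.keys F \<subseteq> S" "h 0 = 0"
  shows "subst3 h f F = (\<Sum>e\<in>S. h (Poly_Mapping.lookup F e) *
    (\<Prod>i\<in>UNIV. f i ^ Poly_Mapping.lookup e i))"
  unfolding subst3_def
  by (rule sum.mono_neutral_left) (use assms in \<open>auto simp: in_keys_iff\<close>)

lemma subst3_add:
  assumes "h 0 = 0" "\<And>a b. h (a + b) = h a + h b"
  shows "subst3 h f (F + G) = subst3 h f F + subst3 h f G"
proof -
  define S where "S = Poly_Mapping.keys F \<union> Poly_Mapping.keys G"
  have "finite S" "Poly_Mapping.keys F \<subseteq> S" "Poly_Mapping.keys G \<subseteq> S"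
    "Poly_Mapping.keys (F + G) \<subseteq> S"
    unfolding S_def using keys_add[of F G] by auto
  thus ?thesis
    by (simp add: subst3_superset[where S = S] assms lookup_add distrib_right sum.distrib)
qed

lemma subst3_zero [simp]: "subst3 h f 0 = 0"
  by (simp add: subst3_def)

lemma subst3_single:
  assumes "h 0 = 0"
  shows "subst3 h f (Poly_Mapping.single e c) = h c * (\<Prod>i\<in>UNIV. f i ^ Poly_Mapping.lookup e i)"
  using assms by (subst subst3_superset[where S = "{e}"]) auto

lemma subst3_sum:
  assumes "h 0 = 0" "\<And>a b. h (a + b) = h a + h b"
  shows "subst3 h f (\<Sum>x\<in>A. F x) = (\<Sum>x\<in>A. subst3 h f (F x))"
  by (induction A rule: infinite_finite_induct) (auto simp: subst3_add[OF assms])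

lemma subst3_mult:
  assumes h: "h 0 = 0" "\<And>a b. h (a + b) = h a + h b" "\<And>a b. h (a * b) = h a * h b"
  shows "subst3 h f (F * G) = subst3 h f F * subst3 h f G"
proof -
  note [simp] = subst3_sum[where h = h, OF h(1,2)] subst3_single[where h = h, OF h(1)]
  have *: "subst3 h f (Poly_Mapping.single e c * Poly_Mapping.single e' c') =
      subst3 h f (Poly_Mapping.single e c) * subst3 h f (Poly_Mapping.single e' c')" for e e' c c'
    by (simp add: mult_single h lookup_add power_add prod.distrib mult_ac)
  have "F * G = (\<Sum>e\<in>Poly_Mapping.keys F. \<Sum>e'\<in>Poly_Mapping.keys G.
      Poly_Mapping.single e (Poly_Mapping.lookup F e) *
      Poly_Mapping.single e' (Poly_Mapping.lookup G e'))"
    by (subst (1) poly_mapping_eq_sum_single[of F], subst (1) poly_mapping_eq_sum_single[of G])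
      (simp add: sum_product)
  hence "subst3 h f (F * G) = (\<Sum>e\<in>Poly_Mapping.keys F. \<Sum>e'\<in>Poly_Mapping.keys G.
      subst3 h f (Poly_Mapping.single e (Poly_Mapping.lookup F e)) *
      subst3 h f (Poly_Mapping.single e' (Poly_Mapping.lookup G e')))"
    by (simp add: *)
  also have "\<dots> = subst3 h f (\<Sum>e\<in>Poly_Mapping.keys F. Poly_Mapping.single e (Poly_Mapping.lookup F e)) *
     subst3 h f (\<Sum>e\<in>Poly_Mapping.keys G. Poly_Mapping.single e (Poly_Mapping.lookup G e))"
    by (simp add: sum_product)
  finally show ?thesis
    by (simp flip: poly_mapping_eq_sum_single)
qed

section \<open>Constants, linear forms and evaluation\<close>

definition cst :: "complex \<Rightarrow> poly3" where
  "cst c = Poly_Mapping.single 0 c"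

definition lf :: "complex^3 \<Rightarrow> poly3" where
  "lf u = (\<Sum>i\<in>UNIV. Poly_Mapping.single (Poly_Mapping.single i 1) (u $ i))"

lemma eval3_0 [simp]: "eval3 0 v = 0"
  and eval3_add [simp]: "eval3 (F + G) v = eval3 F v + eval3 G v"
  and eval3_mult [simp]: "eval3 (F * G) v = eval3 F v * eval3 G v"
  and eval3_cst [simp]: "eval3 (cst c) v = c"
  by (simp_all add: eval3_def subst3_add subst3_mult cst_def subst3_single)

lemma eval3_1 [simp]: "eval3 1 v = 1"
  using eval3_cst[of 1 v] by (simp add: cst_def)

lemma eval3_uminus [simp]: "eval3 (- F) v = - eval3 F v"
  using eval3_add[of F "- F" v] by (simp add: eq_neg_iff_add_eq_0 add.commute)

lemma eval3_diff [simp]: "eval3 (F - G) v = eval3 F v - eval3 G v"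
  using eval3_add[of F "- G" v] by simp

lemma eval3_power [simp]: "eval3 (F ^ n) v = eval3 F v ^ n"
  by (induction n) auto

lemma eval3_sum [simp]: "eval3 (\<Sum>x\<in>A. F x) v = (\<Sum>x\<in>A. eval3 (F x) v)"
  by (induction A rule: infinite_finite_induct) auto

lemma eval3_prod [simp]: "eval3 (\<Prod>x\<in>A. F x) v = (\<Prod>x\<in>A. eval3 (F x) v)"
  by (induction A rule: infinite_finite_induct) auto

lemma prod_3: "prod f (UNIV :: 3 set) = f 1 * f 2 * f 3"
  unfolding UNIV_3 by (simp add: mult.assoc)

lemma prod_UNIV_delta:
  "(\<Prod>i\<in>UNIV. f i ^ (if i = j then Suc 0 else 0)) = (f (j::3) :: 'a::comm_semiring_1)"
proof -
  have "(\<Prod>i\<in>UNIV. f i ^ (if i = j then Suc 0 else 0)) = (\<Prod>i\<in>UNIV. if i = j then f i else 1)"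
    by (rule prod.cong) auto
  thus ?thesis by simp
qed

lemma eval3_lf: "eval3 (lf u) v = u $ 1 * v $ 1 + u $ 2 * v $ 2 + u $ 3 * v $ 3"
  by (simp add: lf_def) (simp add: eval3_def subst3_single lookup_single when_def
        prod_UNIV_delta sum_3)

lemma along_add [simp]: "along (F + G) a w = along F a w + along G a w"
  and along_mult [simp]: "along (F * G) a w = along F a w * along G a w"
  and along_cst [simp]: "along (cst c) a w = [:c:]"
  and along_0 [simp]: "along 0 a w = 0"
  by (simp_all add: along_def subst3_add subst3_mult cst_def subst3_single)

lemma along_uminus [simp]: "along (- F) a w = - along F a w"
  using along_add[of F "- F" a w] by (simp add: eq_neg_iff_add_eq_0 add.commute)

lemma along_diff [simp]: "along (F - G) a w = along F a w - along G a w"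
  using along_add[of F "- G" a w] by simp

lemma poly_along: "poly (along F a w) t = eval3 F (a + t *s w)"
  by (simp add: along_def eval3_def subst3_def poly_sum poly_prod poly_power)

lemma along_lf: "along (lf u) a w = [:eval3 (lf u) a, eval3 (lf u) w:]"
  by (rule poly_ext) (simp add: poly_along eval3_lf algebra_simps)

text \<open>By Kronecker's substitution of \<open>t\<close>, \<open>t ^ N\<close> and \<open>t ^ N\<^sup>2\<close> with large \<open>N\<close>.\<close>

lemma eval3_nonzero:
  assumes "F \<noteq> 0"
  shows "\<exists>v. eval3 F v \<noteq> 0"
proof -
  define M where "M = Max ((\<lambda>(e, i). Poly_Mapping.lookup e i) ` (Poly_Mapping.keys F \<times> UNIV))"
  define N where "N = Suc M"
  have N: "Poly_Mapping.lookup e i < N" if "e \<in> Poly_Mapping.keys F" for e i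
  proof -
    have "Poly_Mapping.lookup e i \<le> M" unfolding M_def
      by (rule Max_ge) (use that in \<open>force+\<close>)
    thus ?thesis by (simp add: N_def)
  qed
  have N0: "N > 0" by (simp add: N_def)
  define wt where "wt = (\<lambda>i::3. if i = 1 then 1 else if i = 2 then N else N\<^sup>2)"
  define ph where "ph = (\<lambda>e. Poly_Mapping.lookup e 1 + N * (Poly_Mapping.lookup e 2 + N * Poly_Mapping.lookup e (3::3)))"
  \<comment> \<open>The exponents are digits in base \<open>N\<close>, so distinct monomials receive
    distinct degrees and cannot cancel.\<close>
  have inj: "e = e'" if "e \<in> Poly_Mapping.keys F" "e' \<in> Poly_Mapping.keys F" "ph e = ph e'" for e e'
  proof -
    have d: "ph e mod N = Poly_Mapping.lookup e 1" "(ph e div N) mod N = Poly_Mapping.lookup e 2"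
      "ph e div N div N = Poly_Mapping.lookup e 3" if "e \<in> Poly_Mapping.keys F" for e
      using N[OF that] N0 by (simp_all add: ph_def)
    have "Poly_Mapping.lookup e i = Poly_Mapping.lookup e' i" for i
      using d[OF that(1)] d[OF that(2)] that(3) exhaust_3[of i] by metis
    thus ?thesis by (rule poly_mapping_eqI)
  qed
  define p where "p = (\<Sum>e\<in>Poly_Mapping.keys F. monom (Poly_Mapping.lookup F e) (ph e))"
  have ev: "poly p t = eval3 F (\<chi> i. t ^ wt i)" for t
    by (simp add: p_def eval3_def subst3_def poly_sum poly_monom prod_3 wt_def ph_def power2_eq_square
      flip: power_mult power_add) (simp add: algebra_simps)
  obtain e where e: "e \<in> Poly_Mapping.keys F" using assms by fastforce
  have "coeff p (ph e) = (\<Sum>e'\<in>Poly_Mapping.keys F. if e' = e then Poly_Mapping.lookup F e' else 0)"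
    unfolding p_def coeff_sum by (rule sum.cong) (use inj e in \<open>auto\<close>)
  also have "\<dots> = Poly_Mapping.lookup F e" using e by simp
  finally have "p \<noteq> 0" using e by (metis coeff_0 in_keys_iff)
  then obtain t where "poly p t \<noteq> 0" using poly_all_0_iff_0 by blast
  thus ?thesis using ev by metis
qed

lemma eval3_eqI: "(\<And>v. eval3 F v = eval3 G v) \<Longrightarrow> F = G"
  using eval3_nonzero[of "F - G"] by auto

text \<open>A finite product of nonzero polynomials is nonzero. This supplies auxiliary points off
  finitely many given curves.\<close>

lemma eval3_nonzero_family:
  assumes "finite A" "\<And>F. F \<in> A \<Longrightarrow> F \<noteq> (0 :: poly3)"
  shows "\<exists>v. \<forall>F\<in>A. eval3 F v \<noteq> 0"
proof -
  have "(\<Prod>F\<in>A. F) \<noteq> 0"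
    using assms by auto
  from eval3_nonzero[OF this] obtain v where "(\<Prod>F\<in>A. eval3 F v) \<noteq> 0" by auto
  with assms(1) show ?thesis by auto
qed

section \<open>Homogeneous polynomials\<close>

lemma homogeneous_0 [simp]: "homogeneous d 0"
  by (simp add: homogeneous_def)

lemma homogeneous_add: "homogeneous d F \<Longrightarrow> homogeneous d G \<Longrightarrow> homogeneous d (F + G)"
  using keys_add[of F G] by (auto simp: homogeneous_def)

lemma homogeneous_uminus: "homogeneous d F \<Longrightarrow> homogeneous d (- F)"
  by (simp add: homogeneous_def)

lemma homogeneous_diff: "homogeneous d F \<Longrightarrow> homogeneous d G \<Longrightarrow> homogeneous d (F - G)"
  using homogeneous_add[of d F "- G"] homogeneous_uminus[of d G] by simp

lemma homogeneous_mult: "homogeneous d F \<Longrightarrow> homogeneous d' G \<Longrightarrow> homogeneous (d + d') (F * G)"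
  using keys_mult[of F G] by (fastforce simp: homogeneous_def lookup_add sum.distrib)

lemma homogeneous_cst: "homogeneous 0 (cst c)"
  by (simp add: homogeneous_def cst_def)

lemma homogeneous_cst_mult: "homogeneous d F \<Longrightarrow> homogeneous d (cst c * F)"
  using homogeneous_mult[OF homogeneous_cst] by simp

lemma homogeneous_sum: "(\<And>x. x \<in> A \<Longrightarrow> homogeneous d (F x)) \<Longrightarrow> homogeneous d (\<Sum>x\<in>A. F x)"
  by (induction A rule: infinite_finite_induct) (auto intro: homogeneous_add)

lemma homogeneous_lf: "homogeneous 1 (lf u)"
  unfolding lf_def by (rule homogeneous_sum) (simp add: homogeneous_def lookup_single when_def)

lemma eval3_scale:
  assumes "homogeneous d F"
  shows "eval3 F (k *s v) = k ^ d * eval3 F v"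
proof -
  have "(\<Prod>i\<in>UNIV. (k * v $ i) ^ Poly_Mapping.lookup e i) =
     k ^ d * (\<Prod>i\<in>UNIV. v $ i ^ Poly_Mapping.lookup e i)" if "e \<in> Poly_Mapping.keys F" for e
    using assms that unfolding homogeneous_def
    by (auto simp: power_mult_distrib prod.distrib power_sum[symmetric])
  thus ?thesis
    by (simp add: eval3_def subst3_def sum_distrib_left mult.left_commute)
qed

lemma eval3_zero_vec: "homogeneous d F \<Longrightarrow> d > 0 \<Longrightarrow> eval3 F 0 = 0"
  using eval3_scale[of d F 0 0] by (simp add: power_0_left)

section \<open>Degree of a form along a parametrised curve\<close>

lemma degree_prod_power_le:
  "degree (\<Prod>i\<in>(UNIV::3 set). f i ^ n i) \<le> (\<Sum>i\<in>UNIV. degree (f i) * n i)" for f :: "3 \<Rightarrow> complex poly"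
proof -
  have "degree (\<Prod>i\<in>(UNIV::3 set). f i ^ n i) \<le> (\<Sum>i\<in>UNIV. degree (f i ^ n i))"
    using degree_prod_sum_le[of UNIV "\<lambda>i. f i ^ n i"] by (simp add: o_def)
  also have "\<dots> \<le> (\<Sum>i\<in>UNIV. degree (f i) * n i)"
    by (rule sum_mono) (rule degree_power_le)
  finally show ?thesis .
qed

definition pull_curve :: "(3 \<Rightarrow> complex poly) \<Rightarrow> poly3 \<Rightarrow> complex poly" where
  "pull_curve ph F = subst3 (\<lambda>c. [:c:]) ph F"

lemma poly_pull_curve: "poly (pull_curve ph F) t = eval3 F (\<chi> i. poly (ph i) t)"
  by (simp add: pull_curve_def eval3_def subst3_def poly_sum poly_prod poly_power)

lemma degree_pull_curve:
  assumes "homogeneous d F" "\<And>i. degree (ph i) \<le> e"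
  shows "degree (pull_curve ph F) \<le> e * d"
  unfolding pull_curve_def subst3_def
proof (rule degree_sum_le)
  fix k assume k: "k \<in> Poly_Mapping.keys F"
  have "degree ([:Poly_Mapping.lookup F k:] * (\<Prod>i\<in>UNIV. ph i ^ Poly_Mapping.lookup k i)) \<le>
     degree (\<Prod>i\<in>UNIV. ph i ^ Poly_Mapping.lookup k i)"
    by (rule order.trans[OF degree_mult_le]) simp
  also have "\<dots> \<le> (\<Sum>i\<in>UNIV. degree (ph i) * Poly_Mapping.lookup k i)"
    by (rule degree_prod_power_le)
  also have "\<dots> \<le> (\<Sum>i\<in>UNIV. e * Poly_Mapping.lookup k i)"
    by (rule sum_mono) (simp add: assms)
  also have "\<dots> = e * d"
    using assms k by (simp add: sum_distrib_left[symmetric] homogeneous_def)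
  finally show "degree ([:Poly_Mapping.lookup F k:] * (\<Prod>i\<in>UNIV. ph i ^ Poly_Mapping.lookup k i)) \<le> e * d" .
qed simp

lemma degree_along: "homogeneous d F \<Longrightarrow> degree (along F a w) \<le> d"
  using degree_pull_curve[of d F "\<lambda>i. [:a $ i, w $ i:]" 1]
  by (simp add: pull_curve_def along_def)

subsection \<open>Coordinates with respect to a basis\<close>

definition d3 :: "complex^3 \<Rightarrow> complex^3 \<Rightarrow> complex^3 \<Rightarrow> complex" where
  "d3 a b c = a$1 * b$2 * c$3 + a$2 * b$3 * c$1 + a$3 * b$1 * c$2
     - a$1 * b$3 * c$2 - a$2 * b$1 * c$3 - a$3 * b$2 * c$1"

lemma det_eq_d3: "det (vector [a, b, c] :: complex^3^3) = d3 a b c"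
  by (simp add: det_3 d3_def algebra_simps)

lemma d3_lin [simp]:
  "d3 (a + a') b c = d3 a b c + d3 a' b c" "d3 a (b + b') c = d3 a b c + d3 a b' c"
  "d3 a b (c + c') = d3 a b c + d3 a b c'"
  "d3 (k *s a) b c = k * d3 a b c" "d3 a (k *s b) c = k * d3 a b c" "d3 a b (k *s c) = k * d3 a b c"
  by (simp_all add: d3_def algebra_simps)

lemma d3_diff [simp]:
  "d3 (a - a') b c = d3 a b c - d3 a' b c" "d3 a (b - b') c = d3 a b c - d3 a b' c"
  "d3 a b (c - c') = d3 a b c - d3 a b c'"
  by (simp_all add: d3_def algebra_simps)

lemma d3_alt [simp]: "d3 a a c = 0" "d3 a b b = 0" "d3 a b a = 0"
  by (simp_all add: d3_def algebra_simps)

lemma d3_zero [simp]: "d3 0 b c = 0" "d3 a 0 c = 0" "d3 a b 0 = 0"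
  by (simp_all add: d3_def)

lemma d3_rot: "d3 a b c = d3 b c a" and d3_rot2: "d3 a b c = d3 c a b"
  and d3_swap: "d3 a b c = - d3 b a c" and d3_swap': "d3 a b c = - d3 a c b"
  by (simp_all add: d3_def algebra_simps)

lemma d3_uminus [simp]: "d3 (- a) b c = - d3 a b c" "d3 a (- b) c = - d3 a b c" "d3 a b (- c) = - d3 a b c"
  by (simp_all add: d3_def algebra_simps)

lemma d3_perm: "d3 a c b = - d3 a b c" "d3 b a c = - d3 a b c" "d3 b c a = d3 a b c"
  "d3 c a b = d3 a b c" "d3 c b a = - d3 a b c"
  by (simp_all add: d3_def algebra_simps)

lemma vec3_eq_iff: "(v :: complex^3) = w \<longleftrightarrow> v$1 = w$1 \<and> v$2 = w$2 \<and> v$3 = w$3"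
  by (simp add: vec_eq_iff forall_3)

lemma cramer3: "d3 a b c *s v = d3 v b c *s a + d3 a v c *s b + d3 a b v *s c"
  by (simp add: vec3_eq_iff d3_def algebra_simps)

lemma basis_coords:
  assumes "d3 a b c \<noteq> 0"
  shows "v = (d3 v b c / d3 a b c) *s a + (d3 a v c / d3 a b c) *s b + (d3 a b v / d3 a b c) *s c"
proof -
  have "v = (1 / d3 a b c) *s (d3 a b c *s v)" using assms by simp
  also have "d3 a b c *s v = d3 v b c *s a + d3 a v c *s b + d3 a b v *s c" by (rule cramer3)
  finally show ?thesis by (simp add: vector_add_ldistrib)
qed

lemma basis_coordsE:
  assumes "d3 a b c \<noteq> 0"
  obtains x y z where "v = x *s a + y *s b + z *s c"
  using basis_coords[OF assms] by blast

text \<open>The cross product; \<open>cr a b \<noteq> 0\<close> is the form in which linear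
  independence of two vectors is stated throughout.\<close>

definition cr :: "complex^3 \<Rightarrow> complex^3 \<Rightarrow> complex^3" where
  "cr a b = vector [a$2 * b$3 - a$3 * b$2, a$3 * b$1 - a$1 * b$3, a$1 * b$2 - a$2 * b$1]"

definition line_form :: "complex^3 \<Rightarrow> complex^3 \<Rightarrow> poly3" where
  "line_form a b = lf (cr a b)"

lemma eval3_line_form [simp]: "eval3 (line_form a b) v = d3 a b v"
  by (simp add: line_form_def eval3_lf cr_def d3_def algebra_simps)

lemma homogeneous_line_form: "homogeneous 1 (line_form a b)"
  unfolding line_form_def by (rule homogeneous_lf)

lemma along_line_form [simp]: "along (line_form a b) v w = [:d3 a b v, d3 a b w:]"
  using along_lf[of "cr a b" v w] eval3_line_form[of a b] by (simp add: line_form_def)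

subsection \<open>Points and lines\<close>

lemma cr_nonzero_iff: "cr a b \<noteq> 0 \<longleftrightarrow> (\<exists>c. d3 a b c \<noteq> 0)"
proof
  assume "cr a b \<noteq> 0"
  then obtain i where i: "cr a b $ i \<noteq> 0" by (auto simp: vec_eq_iff)
  have "d3 a b (axis i 1) = cr a b $ i"
    using exhaust_3[of i] by (auto simp: d3_def cr_def axis_def)
  with i show "\<exists>c. d3 a b c \<noteq> 0" by metis
next
  assume "\<exists>c. d3 a b c \<noteq> 0"
  then obtain c where c: "eval3 (line_form a b) c \<noteq> 0" by auto
  show "cr a b \<noteq> 0"
  proof
    assume "cr a b = 0"
    thus False using c by (simp add: line_form_def eval3_lf del: eval3_line_form)
  qed
qed

lemma cr_nonzeroI: "d3 a b c \<noteq> 0 \<Longrightarrow> cr a b \<noteq> 0"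
  using cr_nonzero_iff by blast

lemma line_form_nonzero: "cr a b \<noteq> 0 \<Longrightarrow> line_form a b \<noteq> 0"
  by (metis cr_nonzero_iff eval3_0 eval3_line_form)

lemma cr_zero_parallel:
  assumes "cr a b = 0" "a \<noteq> 0"
  obtains k where "b = k *s a"
proof -
  obtain i where i: "a $ i \<noteq> 0" using assms(2) by (auto simp: vec_eq_iff)
  have e: "a$2 * b$3 = a$3 * b$2" "a$3 * b$1 = a$1 * b$3" "a$1 * b$2 = a$2 * b$1"
    using assms(1) by (auto simp: cr_def vec3_eq_iff)
  have "b = (b $ i / a $ i) *s a"
    using i e exhaust_3[of i] by (auto simp: vec3_eq_iff field_simps)
  thus ?thesis using that by blast
qed

lemma cr_self [simp]: "cr a a = 0" "cr a (k *s a) = 0" "cr 0 a = 0" "cr a 0 = 0"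
  by (auto simp: cr_def vec3_eq_iff algebra_simps)

lemma cr_scale: "cr (k *s a) b = k *s cr a b" "cr a (k *s b) = k *s cr a b"
  by (auto simp: cr_def vec3_eq_iff algebra_simps)

lemma cr_swap: "cr b a = - cr a b"
  by (auto simp: cr_def vec3_eq_iff algebra_simps)

lemma d3_zero_spanE:
  assumes "cr a b \<noteq> 0" "d3 a b v = 0"
  obtains x y where "v = x *s a + y *s b"
proof -
  obtain c where c: "d3 a b c \<noteq> 0" using assms(1) cr_nonzero_iff by blast
  from basis_coords[OF c, of v] assms(2) that show ?thesis by simp
qed

lemma span_pair: "vec.span {a, b} = {v :: complex^3. \<exists>x y. v = x *s a + y *s b}"
proof -
  have "(\<exists>k. v - k *s a \<in> range (\<lambda>k. k *s b)) \<longleftrightarrow> (\<exists>x y. v = x *s a + y *s b)" for v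
    by (auto simp: algebra_simps image_iff)
  thus ?thesis by (auto simp: vec.span_insert[of a] vec.span_singleton)
qed

lemma span_pair_d3: "cr a b \<noteq> 0 \<Longrightarrow> vec.span {a, b} = {v. d3 a b v = 0}"
  unfolding span_pair using d3_zero_spanE[of a b] by (auto, blast)

text \<open>A fixed choice of homogeneous coordinates, which turns statements on points into
  statements on vectors.\<close>

definition rep :: "ppoint \<Rightarrow> complex^3" where
  "rep p = (SOME a. a \<in> Rep_ppoint p \<and> a \<noteq> 0)"

lemma Rep_ppoint_ex: "\<exists>a. a \<noteq> 0 \<and> Rep_ppoint p = vec.span {a}"
proof -
  have L: "vec.subspace (Rep_ppoint p)" "vec.dim (Rep_ppoint p) = 1"
    using Rep_ppoint[of p] by auto
  obtain B where B: "B \<subseteq> Rep_ppoint p" "vec.independent B" "Rep_ppoint p \<subseteq> vec.span B"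
    "card B = vec.dim (Rep_ppoint p)"
    using vec.basis_exists by blast
  from B(4) L(2) obtain a where a: "B = {a}" using card_1_singletonE by metis
  have "a \<noteq> 0" using B(2) a by (auto simp: vec.dependent_zero)
  moreover have "vec.span B = Rep_ppoint p"
    using B L(1) vec.span_subspace by blast
  ultimately show ?thesis using a by metis
qed

lemma rep_in: "rep p \<in> Rep_ppoint p" and rep_nonzero [simp]: "rep p \<noteq> 0"
proof -
  obtain a where "a \<noteq> 0" "Rep_ppoint p = vec.span {a}" using Rep_ppoint_ex by blast
  hence "\<exists>a. a \<in> Rep_ppoint p \<and> a \<noteq> 0" using vec.span_base by blast
  from someI_ex[OF this] show "rep p \<in> Rep_ppoint p" "rep p \<noteq> 0"
    by (simp_all add: rep_def)
qed

lemma Rep_ppoint_eq: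
  assumes "a \<in> Rep_ppoint p" "a \<noteq> 0" shows "Rep_ppoint p = range (\<lambda>k. k *s a)"
proof -
  obtain b where b: "b \<noteq> 0" "Rep_ppoint p = vec.span {b}" using Rep_ppoint_ex by blast
  then obtain k where k: "a = k *s b" using assms by (auto simp: vec.span_singleton)
  with assms have "k \<noteq> 0" by auto
  have "j *s b \<in> range (\<lambda>k. k *s a)" for j
    using k \<open>k \<noteq> 0\<close> by (auto simp: image_iff intro!: exI[of _ "j / k"])
  moreover have "j *s a \<in> range (\<lambda>k. k *s b)" for j using k by auto
  ultimately show ?thesis using b by (auto simp: vec.span_singleton)
qed

lemma Rep_ppoint_rep: "Rep_ppoint p = range (\<lambda>k. k *s rep p)"
  by (rule Rep_ppoint_eq) (simp_all add: rep_in)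

lemma ppoint_eqI: "a \<in> Rep_ppoint p \<Longrightarrow> a \<in> Rep_ppoint q \<Longrightarrow> a \<noteq> 0 \<Longrightarrow> p = q"
  by (metis Rep_ppoint_eq Rep_ppoint_inject)

lemma rep_indep:
  assumes "p \<noteq> q" shows "cr (rep p) (rep q) \<noteq> 0"
proof
  assume "cr (rep p) (rep q) = 0"
  then obtain k where "rep q = k *s rep p" using cr_zero_parallel rep_nonzero by blast
  hence "rep q \<in> Rep_ppoint p" by (auto simp: Rep_ppoint_rep)
  with ppoint_eqI[of "rep q" p q] assms rep_in show False by auto
qed

definition pt :: "complex^3 \<Rightarrow> ppoint" where "pt a = Abs_ppoint (vec.span {a})"

lemma Rep_pt: "a \<noteq> 0 \<Longrightarrow> Rep_ppoint (pt a) = range (\<lambda>k. k *s a)"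
  unfolding pt_def by (subst Abs_ppoint_inverse) (simp_all add: vec.span_singleton[symmetric])

lemma pt_in: "a \<noteq> 0 \<Longrightarrow> a \<in> Rep_ppoint (pt a)"
  by (auto simp: Rep_pt image_iff intro!: exI[of _ 1])

lemma rep_ptE:
  assumes "a \<noteq> 0" obtains k where "k \<noteq> 0" "rep (pt a) = k *s a"
proof -
  obtain k where "rep (pt a) = k *s a" using rep_in[of "pt a"] Rep_pt[OF assms] by auto
  with rep_nonzero[of "pt a"] that show ?thesis by (cases "k = 0") auto
qed

lemma rep_scaleE:
  assumes "a \<in> Rep_ppoint p" "a \<noteq> 0"
  obtains k where "k \<noteq> 0" "a = k *s rep p"
proof -
  obtain k where "a = k *s rep p" using assms unfolding Rep_ppoint_rep by auto
  with assms that show ?thesis by (cases "k = 0") auto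
qed

lemma pt_rep [simp]: "pt (rep p) = p"
  by (rule ppoint_eqI[of "rep p"]) (auto simp: pt_in rep_in)

lemma independent_pair: "cr a b \<noteq> 0 \<Longrightarrow> vec.independent {a, b} \<and> a \<noteq> b"
  by (auto simp: vec.independent_insert vec.span_singleton cr_scale)

lemma Rep_pline_eq:
  assumes "a \<in> Rep_pline l" "b \<in> Rep_pline l" "cr a b \<noteq> 0"
  shows "Rep_pline l = {v. d3 a b v = 0}"
proof -
  have L: "vec.subspace (Rep_pline l)" "vec.dim (Rep_pline l) = 2"
    using Rep_pline[of l] by auto
  have "vec.span {a, b} = Rep_pline l"
  proof (rule vec.subspace_dim_equal)
    show "vec.span {a, b} \<subseteq> Rep_pline l" using assms L by (simp add: vec.span_minimal)
    have "vec.dim (vec.span {a, b}) = 2"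
      using independent_pair[OF assms(3)] by (simp add: vec.dim_eq_card_independent)
    thus "vec.dim (Rep_pline l) \<le> vec.dim (vec.span {a, b})" using L by simp
  qed (use L in auto)
  with assms show ?thesis by (simp add: span_pair_d3)
qed

lemma Rep_pline_ex: "\<exists>a b. cr a b \<noteq> 0 \<and> a \<in> Rep_pline l \<and> b \<in> Rep_pline l"
proof -
  have L: "vec.subspace (Rep_pline l)" "vec.dim (Rep_pline l) = 2"
    using Rep_pline[of l] by auto
  obtain B where B: "B \<subseteq> Rep_pline l" "vec.independent B" "Rep_pline l \<subseteq> vec.span B"
    "card B = vec.dim (Rep_pline l)"
    using vec.basis_exists by blast
  from B(4) L(2) obtain a b where ab: "B = {a, b}" "a \<noteq> b" using card_2_iff by metis
  have "a \<noteq> 0" using B(2) ab by (auto simp: vec.dependent_zero)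
  have "cr a b \<noteq> 0"
  proof
    assume "cr a b = 0"
    then obtain k where "b = k *s a" using \<open>a \<noteq> 0\<close> cr_zero_parallel by blast
    moreover have "B - {b} = {a}" using ab by auto
    ultimately have "b \<in> vec.span (B - {b})" by (simp only: vec.span_singleton) blast
    moreover have "b \<in> B" using ab by simp
    ultimately show False using B(2) vec.dependent_def[of B] by blast
  qed
  thus ?thesis using B ab by blast
qed

lemma Rep_pline_scale: "a \<in> Rep_pline l \<Longrightarrow> k *s a \<in> Rep_pline l"
  using Rep_pline[of l] by (auto simp: vec.subspace_def)

lemma pline_direction:
  assumes "a \<in> Rep_pline l" "a \<noteq> 0"
  obtains b where "b \<in> Rep_pline l" "cr a b \<noteq> 0"
proof -
  obtain u v where uv: "cr u v \<noteq> 0" "u \<in> Rep_pline l" "v \<in> Rep_pline l"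
    using Rep_pline_ex by blast
  show ?thesis
  proof (cases "cr a u = 0")
    case True
    then obtain k where k: "u = k *s a" using assms cr_zero_parallel by blast
    show ?thesis
    proof (rule that[of v])
      show "cr a v \<noteq> 0" using uv k by (auto simp: cr_scale)
    qed (use uv in auto)
  qed (use that uv in auto)
qed

lemma on_line_iff: "on_line p l \<longleftrightarrow> rep p \<in> Rep_pline l"
  using rep_in[of p] by (auto simp: on_line_def Rep_ppoint_rep intro: Rep_pline_scale)

definition pl :: "complex^3 \<Rightarrow> complex^3 \<Rightarrow> pline" where "pl a b = Abs_pline (vec.span {a, b})"

lemma Rep_pl: "cr a b \<noteq> 0 \<Longrightarrow> Rep_pline (pl a b) = {v. d3 a b v = 0}"
  unfolding pl_def using independent_pair[of a b]
  by (subst Abs_pline_inverse) (auto simp: span_pair_d3 vec.dim_eq_card_independent simp flip: span_pair_d3)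

lemma pline_eqI:
  assumes "cr a b \<noteq> 0" "a \<in> Rep_pline l" "b \<in> Rep_pline l" "a \<in> Rep_pline m" "b \<in> Rep_pline m"
  shows "l = m"
  using Rep_pline_eq[of a l b] Rep_pline_eq[of a m b] assms Rep_pline_inject by metis

lemma zeros_iff:
  assumes "homogeneous d F"
  shows "p \<in> zeros F \<longleftrightarrow> eval3 F (rep p) = 0"
  using rep_in[of p] by (auto simp: zeros_def Rep_ppoint_rep eval3_scale[OF assms])

subsection \<open>Order of vanishing along a line\<close>

text \<open>The contact order at \<open>a\<close> with the line through \<open>a\<close> and
  \<open>w\<close>. Stated by divisibility, it gives every order to a form that vanishes on the
  whole line.\<close>

definition ord_ge :: "nat \<Rightarrow> poly3 \<Rightarrow> complex^3 \<Rightarrow> complex^3 \<Rightarrow> bool" where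
  "ord_ge k F a w \<longleftrightarrow> monom 1 k dvd along F a w"

lemma ord_ge_iff: "ord_ge k F a w \<longleftrightarrow> (\<forall>j<k. coeff (along F a w) j = 0)"
  unfolding ord_ge_def by (rule monom_1_dvd_iff')

lemma ord_ge_0 [simp]: "ord_ge 0 F a w" by (simp add: ord_ge_iff)

lemma coeff_along_0: "coeff (along F a w) 0 = eval3 F a"
  using poly_along[of F a w 0] by (simp add: poly_0_coeff_0)

lemma ord_ge_1 [simp]: "ord_ge (Suc 0) F a w \<longleftrightarrow> eval3 F a = 0"
  by (simp add: ord_ge_iff coeff_along_0)

lemma ord_ge_mono: "ord_ge k F a w \<Longrightarrow> j \<le> k \<Longrightarrow> ord_ge j F a w"
  by (auto simp: ord_ge_iff)

lemma ord_ge_mult: "ord_ge j F a w \<Longrightarrow> ord_ge k G a w \<Longrightarrow> ord_ge (j + k) (F * G) a w"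
  using mult_dvd_mono[of "monom 1 j" "along F a w" "monom 1 k" "along G a w"]
  by (simp add: ord_ge_def mult_monom)

lemma ord_ge_add: "ord_ge k F a w \<Longrightarrow> ord_ge k G a w \<Longrightarrow> ord_ge k (F + G) a w"
  and ord_ge_diff: "ord_ge k F a w \<Longrightarrow> ord_ge k G a w \<Longrightarrow> ord_ge k (F - G) a w"
  and ord_ge_cst_mult: "ord_ge k F a w \<Longrightarrow> ord_ge k (cst c * F) a w"
  by (auto simp: ord_ge_iff)

text \<open>Orders at 0 add up in products, so a factor of order at most \<open>j\<close> accounts
  for at most \<open>j\<close> of the vanishing.\<close>

lemma ord_ge_cancel:
  assumes "ord_ge (j + k) (F * G) a w" "\<not> ord_ge (Suc j) F a w"
  shows "ord_ge k G a w"
proof (cases "along G a w = 0")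
  case False
  from assms(2) have F: "along F a w \<noteq> 0" by (auto simp: ord_ge_iff)
  from assms(2) F have "order 0 (along F a w) \<le> j"
    using monom_1_dvd_iff[OF F, of "Suc j"] by (auto simp: ord_ge_def not_le)
  moreover have "j + k \<le> order 0 (along F a w) + order 0 (along G a w)"
    using assms(1) False F monom_1_dvd_iff[of "along F a w * along G a w" "j + k"]
    by (simp add: ord_ge_def order_mult)
  ultimately show ?thesis using False by (simp add: ord_ge_def monom_1_dvd_iff)
qed (simp add: ord_ge_def)

lemma ord_ge_joinl_cancel:
  assumes "ord_ge k (line_form a b * G) v w" "d3 a b v \<noteq> 0" shows "ord_ge k G v w"
  using ord_ge_cancel[of 0 k "line_form a b" G v w] assms by simp

lemma ord_ge_joinl_cancel':
  assumes "ord_ge (Suc k) (line_form a b * G) v w" "d3 a b w \<noteq> 0" shows "ord_ge k G v w"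
proof (rule ord_ge_cancel[of 1 k "line_form a b"])
  show "\<not> ord_ge (Suc 1) (line_form a b) v w" using assms(2)
    by (auto simp: ord_ge_iff dest!: spec[of _ 1])
qed (use assms in simp)

text \<open>On the line through \<open>a\<close> and \<open>b\<close> a form is a binary form, and
  \<open>along F a b\<close> is its dehomogenisation.\<close>

lemma eval3_binary:
  assumes "homogeneous d F"
  shows "eval3 F (x *s a + y *s b) = (\<Sum>i\<le>d. coeff (along F a b) i * x ^ (d - i) * y ^ i)"
proof -
  have *: "eval3 F (x *s a + y *s b) = (\<Sum>i\<le>d. coeff (along F a b) i * x ^ (d - i) * y ^ i)"
    if x: "x \<noteq> 0" for x
  proof -
    have "eval3 F (x *s a + y *s b) = x ^ d * eval3 F (a + (y / x) *s b)"
      using x by (simp add: eval3_scale[OF assms, symmetric] vector_add_ldistrib)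
    also have "eval3 F (a + (y / x) *s b) = (\<Sum>i\<le>d. coeff (along F a b) i * (y / x) ^ i)"
      using arg_cong[OF poly_as_sum_of_monoms'[OF degree_along[OF assms, of a b]], of "\<lambda>p. poly p (y / x)"]
      by (simp add: poly_sum poly_monom poly_along)
    also have "x ^ d * \<dots> = (\<Sum>i\<le>d. coeff (along F a b) i * x ^ (d - i) * y ^ i)"
      unfolding sum_distrib_left
    proof (rule sum.cong)
      fix i assume "i \<in> {..d}"
      hence "x ^ d = x ^ (d - i) * x ^ i" by (simp flip: power_add)
      thus "x ^ d * (coeff (along F a b) i * (y / x) ^ i) = coeff (along F a b) i * x ^ (d - i) * y ^ i"
        using x by (simp add: field_simps power_divide)
    qed simp
    finally show ?thesis .
  qed
  \<comment> \<open>Dividing by \<open>x\<close> excluded \<open>x = 0\<close>; both sides are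
    polynomials in \<open>x\<close> that agree at all other values.\<close>
  define p where "p = along F (y *s b) a - (\<Sum>i\<le>d. monom (coeff (along F a b) i * y ^ i) (d - i))"
  have "poly p x = 0" if "x \<noteq> 0" for x
    using *[OF that] by (simp add: p_def poly_along poly_sum poly_monom add.commute mult_ac)
  hence "UNIV - {0} \<subseteq> {x. poly p x = 0}" by auto
  moreover have "infinite (UNIV - {0::complex})" by (simp add: infinite_UNIV_char_0)
  ultimately have "infinite {x. poly p x = 0}" using finite_subset by blast
  hence "p = 0" using poly_roots_finite by blast
  hence "poly p x = 0" by simp
  thus ?thesis
    by (simp add: p_def poly_along poly_sum poly_monom add.commute mult_ac)
qed

text \<open>The terms of the binary form below order \<open>k\<close> vanish and the others contain
  \<open>t ^ k\<close>, so contact depends on the point and the line, not on the vectors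
  representing them.\<close>

lemma ord_ge_in_span:
  assumes "homogeneous d F" "ord_ge k F a b"
  shows "ord_ge k F (s *s a) (u *s a + v *s b)"
proof -
  have "along F (s *s a) (u *s a + v *s b) =
    (\<Sum>i\<le>d. [:coeff (along F a b) i:] * [:s, u:] ^ (d - i) * [:0, v:] ^ i)"
  proof (rule poly_ext)
    fix t
    have "s *s a + t *s (u *s a + v *s b) = (s + t * u) *s a + (t * v) *s b"
      by (simp add: vec3_eq_iff algebra_simps)
    thus "poly (along F (s *s a) (u *s a + v *s b)) t =
      poly (\<Sum>i\<le>d. [:coeff (along F a b) i:] * [:s, u:] ^ (d - i) * [:0, v:] ^ i) t"
      by (simp only: poly_along eval3_binary[OF assms(1)]) (simp add: poly_sum mult_ac)
  qed
  moreover have "monom 1 k dvd [:coeff (along F a b) i:] * [:s, u:] ^ (d - i) * [:0, v:] ^ i" for i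
  proof (cases "i < k")
    case False
    have "[:0, v:] ^ i = monom 1 k * (monom 1 (i - k) * [:v ^ i:])"
      using False by (intro poly_ext) (simp add: poly_monom power_mult_distrib flip: power_add)
    thus ?thesis by (metis dvd_mult dvd_triv_left)
  qed (use assms(2) in \<open>simp add: ord_ge_iff\<close>)
  ultimately show ?thesis unfolding ord_ge_def by (auto intro: dvd_sum)
qed

lemma ord_ge_scale: "homogeneous d F \<Longrightarrow> ord_ge k F a b \<Longrightarrow> ord_ge k F (s *s a) b"
  using ord_ge_in_span[of d F k a b s 0 1] by simp

lemma vanishes_to_order_iff:
  assumes "homogeneous d F"
  shows "vanishes_to_order F p k \<longleftrightarrow> (\<forall>w. ord_ge k F (rep p) w)"
proof -
  have "vanishes_to_order F p k \<longleftrightarrow> (\<forall>a \<in> Rep_ppoint p - {0}. \<forall>w. ord_ge k F a w)"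
    by (simp add: vanishes_to_order_def ord_ge_iff)
  also have "\<dots> \<longleftrightarrow> (\<forall>w. ord_ge k F (rep p) w)"
    using rep_in[of p] rep_nonzero[of p] by (auto 4 3 elim: rep_scaleE intro: ord_ge_scale[OF assms])
  finally show ?thesis .
qed

lemma vanishes_to_order_mono: "vanishes_to_order F p k \<Longrightarrow> j \<le> k \<Longrightarrow> vanishes_to_order F p j"
  by (auto simp: vanishes_to_order_def)

lemma vanishes_mult_at: "vanishes_to_order F p (mult_at F p)"
proof (cases "mult_at F p")
  case (Suc m)
  hence "\<not> \<not> vanishes_to_order F p (Suc m)"
    unfolding mult_at_def using not_less_Least[of m "\<lambda>k. \<not> vanishes_to_order F p (Suc k)"] by simp
  with Suc show ?thesis by simp
qed (simp add: vanishes_to_order_def)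

lemma mult_at_eqI:
  assumes "vanishes_to_order F p m" "\<not> vanishes_to_order F p (Suc m)"
  shows "mult_at F p = m"
  unfolding mult_at_def
proof (rule Least_equality)
  fix k assume "\<not> vanishes_to_order F p (Suc k)"
  thus "m \<le> k" using assms(1) vanishes_to_order_mono[of F p m "Suc k"] by (cases "m \<le> k") auto
qed (use assms in auto)

text \<open>By \<open>ord_ge_in_span\<close> a single direction in the line decides for all
  representatives and directions quantified over in the definition.\<close>

lemma tangent_lines_iff:
  assumes "homogeneous d F" "b \<in> Rep_pline l" "cr (rep p) b \<noteq> 0" "on_line p l" "mult_at F p = m"
  shows "l \<in> tangent_lines F p \<longleftrightarrow> ord_ge (Suc m) F (rep p) b"
proof
  assume "l \<in> tangent_lines F p"
  hence "coeff (along F (rep p) b) m = 0"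
    using assms rep_in[of p] by (auto simp: tangent_lines_def)
  moreover have "ord_ge m F (rep p) b"
    using vanishes_mult_at[of F p] assms by (simp add: vanishes_to_order_iff[OF assms(1)])
  ultimately show "ord_ge (Suc m) F (rep p) b" by (auto simp: ord_ge_iff less_Suc_eq)
next
  assume f: "ord_ge (Suc m) F (rep p) b"
  have "coeff (along F a w) m = 0" if aw: "a \<in> Rep_ppoint p - {0}" "w \<in> Rep_pline l" for a w
  proof -
    obtain s where s: "a = s *s rep p" using aw(1) unfolding Rep_ppoint_rep by blast
    have "d3 (rep p) b w = 0" using Rep_pline_eq[of "rep p" l b] assms aw by (auto simp: on_line_iff)
    then obtain u v where "w = u *s rep p + v *s b" using d3_zero_spanE assms(3) by blast
    hence "ord_ge (Suc m) F a w" using ord_ge_in_span[OF assms(1) f] s by simp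
    thus ?thesis by (simp add: ord_ge_iff)
  qed
  thus "l \<in> tangent_lines F p" using assms by (auto simp: tangent_lines_def)
qed

subsection \<open>Forms of degree at most three in coordinates\<close>

abbreviation lin3 :: "complex \<Rightarrow> complex \<Rightarrow> complex \<Rightarrow> complex \<Rightarrow> complex \<Rightarrow> complex \<Rightarrow> complex" where
  "lin3 p q r x y z \<equiv> p * x + q * y + r * z"

lemma homogeneous_1_lf:
  assumes "homogeneous 1 F"
  shows "F = lf (\<chi> i. eval3 F (axis i 1))"
proof (rule eval3_eqI)
  fix v
  have e: "eval3 F (x *s a + y *s b) = x * eval3 F a + y * eval3 F b" for x y a b
  proof -
    have "eval3 F (x *s a + y *s b) = x * coeff (along F a b) 0 + y * coeff (along F a b) 1" for x y
      by (simp add: eval3_binary[OF assms])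
    from this this[of 1 0] this[of 0 1] show ?thesis by simp
  qed
  have "v = 1 *s (v$1 *s axis 1 1 + v$2 *s axis 2 1) + v$3 *s (axis 3 1 :: complex^3)"
    by (simp add: vec3_eq_iff axis_def)
  hence "eval3 F v = eval3 F (1 *s (v$1 *s axis 1 1 + v$2 *s axis 2 1) + v$3 *s axis 3 1)" by simp
  thus "eval3 F v = eval3 (lf (\<chi> i. eval3 F (axis i 1))) v"
    unfolding e by (simp add: eval3_lf mult.commute)
qed

lemma homogeneous_0_cst:
  assumes "homogeneous 0 F" shows "F = cst (eval3 F 0)"
proof (rule eval3_eqI)
  fix v show "eval3 F v = eval3 (cst (eval3 F 0)) v"
    using eval3_scale[OF assms, of 0 v] by simp
qed

lemma eval3_homogeneous_1:
  assumes "homogeneous 1 F"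
  shows "eval3 F (x *s a + y *s b + z *s c) = lin3 (eval3 F a) (eval3 F b) (eval3 F c) x y z"
  by (subst (1 2 3 4) homogeneous_1_lf[OF assms]) (simp add: eval3_lf algebra_simps)

text \<open>Leaving the coefficients existential gives closure under sums and products of linear
  forms, so every form can be expanded in any basis without computing its coefficients
  there.\<close>

definition isquad :: "(complex \<Rightarrow> complex \<Rightarrow> complex \<Rightarrow> complex) \<Rightarrow> bool" where
  "isquad f \<longleftrightarrow> (\<exists>A B C D E G. \<forall>x y z. f x y z = A*x^2 + B*y^2 + C*z^2 + D*y*z + E*x*z + G*x*y)"

definition iscubic :: "(complex \<Rightarrow> complex \<Rightarrow> complex \<Rightarrow> complex) \<Rightarrow> bool" where
  "iscubic f \<longleftrightarrow> (\<exists>A B C D E G H I J K. \<forall>x y z. f x y z =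
     A*x^3 + B*y^3 + C*z^3 + D*x^2*y + E*x^2*z + G*x*y^2 + H*y^2*z + I*x*z^2 + J*y*z^2 + K*x*y*z)"

lemma isquadI:
  "(\<And>x y z. f x y z = A*x^2 + B*y^2 + C*z^2 + D*y*z + E*x*z + G*x*y) \<Longrightarrow> isquad f"
  unfolding isquad_def by blast

lemma iscubicI:
  "(\<And>x y z. f x y z = A*x^3 + B*y^3 + C*z^3 + D*x^2*y + E*x^2*z + G*x*y^2 + H*y^2*z + I*x*z^2 + J*y*z^2 + K*x*y*z)
    \<Longrightarrow> iscubic f"
  unfolding iscubic_def by blast

lemma isquad_add:
  assumes "isquad f" "isquad g" shows "isquad (\<lambda>x y z. f x y z + g x y z)"
proof -
  obtain A B C D E G where 1: "\<And>x y z. f x y z = A*x^2 + B*y^2 + C*z^2 + D*y*z + E*x*z + G*x*y"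
    using assms(1) unfolding isquad_def by blast
  obtain A' B' C' D' E' G' where 2: "\<And>x y z. g x y z = A'*x^2 + B'*y^2 + C'*z^2 + D'*y*z + E'*x*z + G'*x*y"
    using assms(2) unfolding isquad_def by blast
  show ?thesis
    by (rule isquadI[of _ "A + A'" "B + B'" "C + C'" "D + D'" "E + E'" "G + G'"])
      (simp add: 1 2 distrib_right)
qed

lemma iscubic_add:
  assumes "iscubic f" "iscubic g" shows "iscubic (\<lambda>x y z. f x y z + g x y z)"
proof -
  obtain A B C D E G H I J K where 1: "\<And>x y z. f x y z =
     A*x^3 + B*y^3 + C*z^3 + D*x^2*y + E*x^2*z + G*x*y^2 + H*y^2*z + I*x*z^2 + J*y*z^2 + K*x*y*z"
    using assms(1) unfolding iscubic_def by blast
  obtain A' B' C' D' E' G' H' I' J' K' where 2: "\<And>x y z. g x y z =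
     A'*x^3 + B'*y^3 + C'*z^3 + D'*x^2*y + E'*x^2*z + G'*x*y^2 + H'*y^2*z + I'*x*z^2 + J'*y*z^2 + K'*x*y*z"
    using assms(2) unfolding iscubic_def by blast
  show ?thesis
    by (rule iscubicI[of _ "A + A'" "B + B'" "C + C'" "D + D'" "E + E'" "G + G'" "H + H'" "I + I'" "J + J'" "K + K'"])
      (simp add: 1 2 distrib_right)
qed

lemma isquad_0: "isquad (\<lambda>x y z. 0)"
  by (rule isquadI[of _ 0 0 0 0 0 0]) simp

lemma iscubic_0: "iscubic (\<lambda>x y z. 0)"
  by (rule iscubicI[of _ 0 0 0 0 0 0 0 0 0 0]) simp

lemma isquad_mult: "isquad (\<lambda>x y z. lin3 p q r x y z * lin3 p' q' r' x y z)"
  by (rule isquadI[of _ "p * p'" "q * q'" "r * r'" "q * r' + r * q'" "p * r' + r * p'" "p * q' + q * p'"])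
    (simp add: algebra_simps power2_eq_square)

lemma iscubic_mult:
  assumes "isquad f" shows "iscubic (\<lambda>x y z. lin3 p q r x y z * f x y z)"
proof -
  obtain A B C D E G where 1: "\<And>x y z. f x y z = A*x^2 + B*y^2 + C*z^2 + D*y*z + E*x*z + G*x*y"
    using assms unfolding isquad_def by blast
  show ?thesis
    by (rule iscubicI[of _ "p * A" "q * B" "r * C" "p * G + q * A" "p * E + r * A" "p * B + q * G"
        "q * D + r * B" "p * C + r * E" "q * C + r * D" "p * D + q * E + r * G"])
     (simp add: 1 algebra_simps power2_eq_square power3_eq_cube)
qed

lemma isquad_scale: assumes "isquad f" shows "isquad (\<lambda>x y z. k * f x y z)"
proof -
  obtain A B C D E G where 1: "\<And>x y z. f x y z = A*x^2 + B*y^2 + C*z^2 + D*y*z + E*x*z + G*x*y"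
    using assms unfolding isquad_def by blast
  show ?thesis
    by (rule isquadI[of _ "k * A" "k * B" "k * C" "k * D" "k * E" "k * G"])
      (simp add: 1 distrib_left mult.assoc)
qed

lemma iscubic_scale: assumes "iscubic f" shows "iscubic (\<lambda>x y z. k * f x y z)"
proof -
  obtain A B C D E G H I J K where 1: "\<And>x y z. f x y z =
     A*x^3 + B*y^3 + C*z^3 + D*x^2*y + E*x^2*z + G*x*y^2 + H*y^2*z + I*x*z^2 + J*y*z^2 + K*x*y*z"
    using assms unfolding iscubic_def by blast
  show ?thesis
    by (rule iscubicI[of _ "k * A" "k * B" "k * C" "k * D" "k * E" "k * G" "k * H" "k * I" "k * J" "k * K"])
      (simp add: 1 distrib_left mult.assoc)
qed

lemma isquad_sum: "(\<And>e. e \<in> S \<Longrightarrow> isquad (f e)) \<Longrightarrow> isquad (\<lambda>x y z. \<Sum>e\<in>S. f e x y z)"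
  by (induction S rule: infinite_finite_induct) (auto intro: isquad_0 isquad_add)

lemma iscubic_sum: "(\<And>e. e \<in> S \<Longrightarrow> iscubic (f e)) \<Longrightarrow> iscubic (\<lambda>x y z. \<Sum>e\<in>S. f e x y z)"
  by (induction S rule: infinite_finite_induct) (auto intro: iscubic_0 iscubic_add)

lemma isquad_power:
  assumes "e1 + e2 + e3 = 2"
  shows "isquad (\<lambda>x y z. lin3 p1 q1 r1 x y z ^ e1 * lin3 p2 q2 r2 x y z ^ e2 * lin3 p3 q3 r3 x y z ^ e3)"
proof -
  consider "e1 = 2" "e2 = 0" "e3 = 0" | "e1 = 0" "e2 = 2" "e3 = 0" | "e1 = 0" "e2 = 0" "e3 = 2" |
    "e1 = 1" "e2 = 1" "e3 = 0" | "e1 = 1" "e2 = 0" "e3 = 1" | "e1 = 0" "e2 = 1" "e3 = 1"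
  proof -
    have "e3 = 2 - e1 - e2" "e1 = 0 \<or> e1 = 1 \<or> e1 = 2" "e2 = 0 \<or> e2 = 1 \<or> e2 = 2" "e1 + e2 \<le> 2"
      using assms by linarith+
    thus thesis using that by (elim disjE) simp_all
  qed
  thus ?thesis by cases (simp_all add: power2_eq_square isquad_mult)
qed

lemma iscubic_power:
  assumes "e1 + e2 + e3 = 3"
  shows "iscubic (\<lambda>x y z. lin3 p1 q1 r1 x y z ^ e1 * lin3 p2 q2 r2 x y z ^ e2 * lin3 p3 q3 r3 x y z ^ e3)"
proof -
  consider e where "e1 = Suc e" "e + e2 + e3 = 2" | e where "e2 = Suc e" "e1 + e + e3 = 2"
    | e where "e3 = Suc e" "e1 + e2 + e = 2"
    using assms by (cases e1; cases e2; cases e3) auto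
  thus ?thesis
  proof cases
    case 1 from iscubic_mult[OF isquad_power[OF 1(2)]] 1(1) show ?thesis by (simp add: mult.assoc)
  next
    case 2 from iscubic_mult[OF isquad_power[OF 2(2)]] 2(1) show ?thesis by (simp add: mult.assoc mult.left_commute)
  next
    case 3 from iscubic_mult[OF isquad_power[OF 3(2)]] 3(1) show ?thesis by (simp add: mult.assoc mult.left_commute)
  qed
qed

lemma eval3_lin3:
  "eval3 F (x *s a + y *s b + z *s c) = (\<Sum>e\<in>Poly_Mapping.keys F. Poly_Mapping.lookup F e *
    (lin3 (a$1) (b$1) (c$1) x y z ^ Poly_Mapping.lookup e 1 *
     lin3 (a$2) (b$2) (c$2) x y z ^ Poly_Mapping.lookup e 2 *
     lin3 (a$3) (b$3) (c$3) x y z ^ Poly_Mapping.lookup e 3))"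
  by (simp add: eval3_def subst3_def prod_3 mult.commute[of x] mult.commute[of y] mult.commute[of z])

lemma homogeneous_sum3: "homogeneous d F \<Longrightarrow> e \<in> Poly_Mapping.keys F \<Longrightarrow>
  Poly_Mapping.lookup e 1 + Poly_Mapping.lookup e 2 + Poly_Mapping.lookup e 3 = d"
  by (auto simp: homogeneous_def sum_3)

lemma quad_expandE:
  assumes "homogeneous 2 F"
  obtains A B C D E G where "\<And>x y z. eval3 F (x *s a + y *s b + z *s c) =
    A*x^2 + B*y^2 + C*z^2 + D*y*z + E*x*z + G*x*y"
proof -
  have "isquad (\<lambda>x y z. eval3 F (x *s a + y *s b + z *s c))"
    unfolding eval3_lin3
    by (intro isquad_sum isquad_scale isquad_power homogeneous_sum3[OF assms])
  thus ?thesis unfolding isquad_def using that by blast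
qed

lemma cubic_expandE:
  assumes "homogeneous 3 F"
  obtains A B C D E G H I J K where "\<And>x y z. eval3 F (x *s a + y *s b + z *s c) =
    A*x^3 + B*y^3 + C*z^3 + D*x^2*y + E*x^2*z + G*x*y^2 + H*y^2*z + I*x*z^2 + J*y*z^2 + K*x*y*z"
proof -
  have "iscubic (\<lambda>x y z. eval3 F (x *s a + y *s b + z *s c))"
    unfolding eval3_lin3
    by (intro iscubic_sum iscubic_scale iscubic_power homogeneous_sum3[OF assms])
  thus ?thesis unfolding iscubic_def using that by blast
qed

text \<open>The coordinate function dual to \<open>a\<close> in the basis \<open>a, b, c\<close>;
  rotating the arguments gives the other two.\<close>

definition lco :: "complex^3 \<Rightarrow> complex^3 \<Rightarrow> complex^3 \<Rightarrow> poly3" where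
  "lco a b c = cst (1 / d3 a b c) * line_form b c"

lemma homogeneous_lco: "homogeneous 1 (lco a b c)"
  unfolding lco_def by (intro homogeneous_cst_mult homogeneous_line_form)

lemma eval3_lco:
  assumes "d3 a b c \<noteq> 0"
  shows "eval3 (lco a b c) (x *s a + y *s b + z *s c) = x"
    "eval3 (lco b c a) (x *s a + y *s b + z *s c) = y"
    "eval3 (lco c a b) (x *s a + y *s b + z *s c) = z"
  using assms d3_rot[of a b c] d3_rot2[of a b c] by (simp_all add: lco_def)

lemma eval3_basis_eqI:
  assumes "d3 a b c \<noteq> 0"
    "\<And>x y z. eval3 F (x *s a + y *s b + z *s c) = eval3 G (x *s a + y *s b + z *s c)"
  shows "F = G"
  by (rule eval3_eqI) (metis assms basis_coordsE)

text \<open>In coordinates with \<open>z = 0\<close> on the line, vanishing there removes the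
  monomials free of \<open>z\<close>.\<close>

lemma quad_factor_line:
  assumes "homogeneous 2 F" "cr a b \<noteq> 0" "\<And>x y. eval3 F (x *s a + y *s b) = 0"
  obtains M where "homogeneous 1 M" "F = line_form a b * M"
proof -
  obtain c where c: "d3 a b c \<noteq> 0" using assms(2) cr_nonzero_iff by blast
  obtain A B C D E G where e: "\<And>x y z. eval3 F (x *s a + y *s b + z *s c) =
    A*x^2 + B*y^2 + C*z^2 + D*y*z + E*x*z + G*x*y"
    using quad_expandE[OF assms(1)] by metis
  have "A = 0" "B = 0" using assms(3)[of 1 0] assms(3)[of 0 1] e[of 1 0 0] e[of 0 1 0] by simp_all
  moreover from this have "G = 0" using assms(3)[of 1 1] e[of 1 1 0] by simp
  ultimately have e: "eval3 F (x *s a + y *s b + z *s c) = z * (C * z + D * y + E * x)" for x y z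
    by (simp only: e) (simp add: power2_eq_square algebra_simps)
  define M where "M = cst (1 / d3 a b c) * (cst C * lco c a b + cst D * lco b c a + cst E * lco a b c)"
  have "homogeneous 1 M" unfolding M_def
    by (intro homogeneous_cst_mult homogeneous_add homogeneous_lco)
  moreover have "F = line_form a b * M"
    by (rule eval3_basis_eqI[OF c]) (simp add: e M_def eval3_lco[OF c], use c in \<open>simp add: field_simps\<close>)
  ultimately show ?thesis using that by blast
qed

lemma cubic_factor_line:
  assumes "homogeneous 3 F" "cr a b \<noteq> 0" "\<And>x y. eval3 F (x *s a + y *s b) = 0"
  obtains M where "homogeneous 2 M" "F = line_form a b * M"
proof -
  obtain c where c: "d3 a b c \<noteq> 0" using assms(2) cr_nonzero_iff by blast
  obtain A B C D E G H I J K where e: "\<And>x y z. eval3 F (x *s a + y *s b + z *s c) =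
    A*x^3 + B*y^3 + C*z^3 + D*x^2*y + E*x^2*z + G*x*y^2 + H*y^2*z + I*x*z^2 + J*y*z^2 + K*x*y*z"
    using cubic_expandE[OF assms(1)] by metis
  have "A = 0" "B = 0" using assms(3)[of 1 0] assms(3)[of 0 1] e[of 1 0 0] e[of 0 1 0] by simp_all
  moreover from this have "D + G = 0" "G - D = 0"
    using assms(3)[of 1 1] e[of 1 1 0] assms(3)[of 1 "-1"] e[of 1 "-1" 0] by simp_all
  hence "D = 0" "G = 0" by (auto simp: algebra_simps)
  ultimately have e: "eval3 F (x *s a + y *s b + z *s c) =
      z * (E * x^2 + H * y^2 + C * z^2 + I * x * z + J * y * z + K * x * y)" for x y z
    by (simp only: e) (simp add: power2_eq_square power3_eq_cube algebra_simps)
  define M where "M = cst (1 / d3 a b c) * (cst E * (lco a b c * lco a b c) + cst H * (lco b c a * lco b c a)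
    + cst C * (lco c a b * lco c a b) + cst I * (lco a b c * lco c a b)
    + cst J * (lco b c a * lco c a b) + cst K * (lco a b c * lco b c a))"
  have "homogeneous (1 + 1) M" unfolding M_def
    by (intro homogeneous_cst_mult homogeneous_add homogeneous_mult homogeneous_lco)
  moreover have "F = line_form a b * M"
    by (rule eval3_basis_eqI[OF c])
      (simp add: e M_def eval3_lco[OF c], use c in \<open>simp add: field_simps power2_eq_square\<close>)
  ultimately show ?thesis using that by (simp add: numeral_2_eq_2)
qed

definition noline :: "poly3 \<Rightarrow> bool" where
  "noline F \<longleftrightarrow> (\<forall>a b. cr a b \<noteq> 0 \<longrightarrow> (\<exists>x y. eval3 F (x *s a + y *s b) \<noteq> 0))"

lemma linear_form_line:
  assumes "homogeneous 1 F"
  obtains a b where "cr a b \<noteq> 0" "\<And>x y. eval3 F (x *s a + y *s b) = 0"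
proof -
  define u where "u = (\<chi> i. eval3 F (axis i 1))"
  have F: "F = lf u" using homogeneous_1_lf[OF assms] by (simp add: u_def)
  have "\<exists>a b. cr a b \<noteq> 0 \<and> eval3 F a = 0 \<and> eval3 F b = 0"
  proof (cases "u $ 1 = 0 \<and> u $ 2 = 0")
    case True
    thus ?thesis unfolding F
      by (intro exI[of _ "vector [1, 0, 0]"] exI[of _ "vector [0, 1, 0]"])
        (auto simp: eval3_lf cr_def vec3_eq_iff)
  next
    case False
    then consider "u $ 1 \<noteq> 0" | "u $ 2 \<noteq> 0" by blast
    thus ?thesis
    proof cases
      case 1
      thus ?thesis unfolding F
        by (intro exI[of _ "vector [- u$2, u$1, 0]"] exI[of _ "vector [- u$3, 0, u$1]"])
          (auto simp: eval3_lf cr_def vec3_eq_iff)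
    next
      case 2
      thus ?thesis unfolding F
        by (intro exI[of _ "vector [- u$2, u$1, 0]"] exI[of _ "vector [0, - u$3, u$2]"])
          (auto simp: eval3_lf cr_def vec3_eq_iff)
    qed
  qed
  then obtain a b where "cr a b \<noteq> 0" "eval3 F a = 0" "eval3 F b = 0" by blast
  moreover have "eval3 F (x *s a + y *s b) = 0" for x y
    using eval3_homogeneous_1[OF assms, of x a y b 0 0] calculation by simp
  ultimately show ?thesis using that by blast
qed

subsection \<open>Irreducibility of conics and cubics without lines\<close>

text \<open>Order at 0 and degree are both additive and agree for the product; as the order never
  exceeds the degree, they agree for each factor.\<close>

lemma monom_factor:
  fixes p q :: "complex poly"
  assumes "p * q = monom c d" "c \<noteq> 0"
  shows "\<exists>e. p = monom e (degree p)"
proof -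
  have nz: "p \<noteq> 0" "q \<noteq> 0" using assms by auto
  have "order 0 p + order 0 q = order 0 (monom c d)"
    using assms nz by (metis mult_eq_0_iff order_mult)
  also have "order 0 (monom c d) = d"
    using assms(2) by (metis monom_eq_0_iff order_0_monom)
  also have "d = degree p + degree q"
    using assms nz by (metis degree_monom_eq degree_mult_eq)
  finally have "order 0 p = degree p"
    using order_degree[OF nz(1), of 0] order_degree[OF nz(2), of 0] by linarith
  hence "monom 1 (degree p) dvd p" using nz by (simp add: monom_1_dvd_iff)
  hence "\<forall>k<degree p. coeff p k = 0" by (simp add: monom_1_dvd_iff')
  hence "p = monom (lead_coeff p) (degree p)"
    by (intro poly_eqI) (metis coeff_monom linorder_neqE_nat le_degree leD)
  thus ?thesis by blast
qed

definition tdeg :: "(3 \<Rightarrow>\<^sub>0 nat) \<Rightarrow> nat" where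
  "tdeg e = (\<Sum>i\<in>UNIV. Poly_Mapping.lookup e i)"

definition hcomp :: "nat \<Rightarrow> poly3 \<Rightarrow> poly3" where
  "hcomp j G = (\<Sum>e\<in>Poly_Mapping.keys G. if tdeg e = j then Poly_Mapping.single e (Poly_Mapping.lookup G e) else 0)"

lemma coeff_along_zero: "coeff (along G 0 v) j = eval3 (hcomp j G) v"
proof -
  have "along G 0 v = (\<Sum>e\<in>Poly_Mapping.keys G.
      monom (Poly_Mapping.lookup G e * (\<Prod>i\<in>UNIV. v $ i ^ Poly_Mapping.lookup e i)) (tdeg e))"
    by (rule poly_ext) (simp add: along_def subst3_def poly_sum poly_prod poly_monom power_mult_distrib
        prod.distrib tdeg_def mult_ac flip: power_sum)
  moreover have "eval3 (Poly_Mapping.single e c) v = c * (\<Prod>i\<in>UNIV. v $ i ^ Poly_Mapping.lookup e i)" for e c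
    by (simp add: eval3_def subst3_single)
  ultimately show ?thesis
    by (auto simp: coeff_sum hcomp_def intro!: sum.cong)
qed

lemma hcomp_nonzero: "e \<in> Poly_Mapping.keys G \<Longrightarrow> hcomp (tdeg e) G \<noteq> 0"
proof
  assume e: "e \<in> Poly_Mapping.keys G" "hcomp (tdeg e) G = 0"
  have "Poly_Mapping.lookup (hcomp (tdeg e) G) e =
    (\<Sum>e'\<in>Poly_Mapping.keys G. if e' = e then Poly_Mapping.lookup G e else 0)"
    unfolding hcomp_def lookup_sum by (rule sum.cong) (auto simp: lookup_single when_def)
  also have "\<dots> = Poly_Mapping.lookup G e" using e by simp
  finally show False using e by (simp add: in_keys_iff)
qed

text \<open>On a line through the origin the product is a monomial in \<open>t\<close>, hence so is
  each factor. The line is chosen off the zeros of all homogeneous components of the factors, so a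
  factor with two components would contribute two terms.\<close>

lemma homogeneous_factor:
  assumes "homogeneous d (G * H)" "G * H \<noteq> 0"
  obtains k l where "homogeneous k G" "homogeneous l H" "k + l = d"
proof -
  have nz: "G \<noteq> 0" "H \<noteq> 0" using assms(2) by auto
  define A where "A = insert (G * H) ((\<lambda>e. hcomp (tdeg e) G) ` Poly_Mapping.keys G \<union>
    (\<lambda>e. hcomp (tdeg e) H) ` Poly_Mapping.keys H)"
  have "finite A" "\<And>F. F \<in> A \<Longrightarrow> F \<noteq> 0" using assms(2) hcomp_nonzero by (auto simp: A_def)
  from eval3_nonzero_family[OF this] obtain v where v: "\<forall>F\<in>A. eval3 F v \<noteq> 0" by blast
  have "along (G * H) 0 v = monom (eval3 (G * H) v) d"
    by (rule poly_ext) (simp add: poly_along poly_monom eval3_scale[OF assms(1), simplified])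
  hence eq: "along G 0 v * along H 0 v = monom (eval3 (G * H) v) d"
    "along H 0 v * along G 0 v = monom (eval3 (G * H) v) d" by (simp_all add: mult.commute)
  have ne: "eval3 (G * H) v \<noteq> 0" using v unfolding A_def by blast
  from monom_factor[OF eq(1) ne] obtain g where g: "along G 0 v = monom g (degree (along G 0 v))" by blast
  from monom_factor[OF eq(2) ne] obtain h where h: "along H 0 v = monom h (degree (along H 0 v))" by blast
  have *: "homogeneous (degree (along G 0 v)) G" if "along G 0 v = monom g (degree (along G 0 v))"
    "\<forall>e\<in>Poly_Mapping.keys G. eval3 (hcomp (tdeg e) G) v \<noteq> 0" for G g
    unfolding homogeneous_def tdeg_def[symmetric]
    using that coeff_along_zero[of G v] by (metis coeff_monom)
  have "homogeneous (degree (along G 0 v)) G" by (rule *[OF g]) (use v in \<open>auto simp: A_def\<close>)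
  moreover have "homogeneous (degree (along H 0 v)) H" by (rule *[OF h]) (use v in \<open>auto simp: A_def\<close>)
  moreover have "degree (along G 0 v) + degree (along H 0 v) = d"
    using eq(1) ne by (metis degree_monom_eq degree_mult_eq monom_eq_0_iff mult_eq_0_iff)
  ultimately show ?thesis using that by blast
qed

lemma cst_unit:
  assumes "c \<noteq> 0" shows "cst c dvd 1"
proof -
  have "1 = cst c * cst (1 / c)" by (rule eval3_eqI) (use assms in simp)
  thus ?thesis by (rule dvdI)
qed

text \<open>Factors of a form are forms, and in degree 2 or 3 one of two factors has degree 0 or 1;
  a linear factor would vanish on a line.\<close>

lemma noline_irreducible:
  assumes "homogeneous d F" "d = 2 \<or> d = 3" "noline F"
  shows "irreducible F"
proof (rule irreducibleI)
  have "cr (vector [1,0,0]) (vector [0,1,0]) \<noteq> 0" by (simp add: cr_def vec3_eq_iff)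
  thus F0: "F \<noteq> 0" using assms(3) unfolding noline_def by fastforce
  show "\<not> F dvd 1"
  proof
    assume "F dvd 1"
    then obtain G where G: "1 = F * G" by (elim dvdE)
    have "eval3 F 0 * eval3 G 0 = 1" by (simp flip: eval3_mult G)
    thus False using eval3_zero_vec[OF assms(1)] assms(2) by auto
  qed
  fix G H assume GH: "F = G * H"
  obtain k l where kl: "homogeneous k G" "homogeneous l H" "k + l = d"
    using homogeneous_factor[of d G H] assms(1) F0 GH by metis
  have unit: "G dvd 1" if G: "homogeneous 0 G" "G \<noteq> 0" for G
  proof -
    obtain c where c: "G = cst c" using homogeneous_0_cst[OF G(1)] by blast
    with G(2) have "c \<noteq> 0" by (auto simp: cst_def)
    with c show ?thesis using cst_unit by simp
  qed
  have lin: False if G: "homogeneous 1 G" "F = G * H" for G H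
  proof -
    obtain a b where ab: "cr a b \<noteq> 0" "\<And>x y. eval3 G (x *s a + y *s b) = 0"
      using linear_form_line[OF G(1)] by blast
    thus False using assms(3) G(2) unfolding noline_def by force
  qed
  consider "k = 0" | "l = 0" | "k = 1" | "l = 1" using kl(3) assms(2) by linarith
  thus "G dvd 1 \<or> H dvd 1"
  proof cases
    case 1 thus ?thesis using unit[of G] kl GH F0 by auto
  next
    case 2 thus ?thesis using unit[of H] kl GH F0 by auto
  next
    case 3 thus ?thesis using lin[of G H] kl GH by auto
  next
    case 4 thus ?thesis using lin[of H G] kl GH by (auto simp: mult.commute)
  qed
qed

subsection \<open>Forms along rational curves\<close>

text \<open>\<open>F(a + s ps(t))\<close> as a polynomial in \<open>s\<close> over the polynomials
  in \<open>t\<close>: the analogue of \<open>along\<close> for a direction moving with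
  \<open>t\<close>.\<close>

definition surf :: "(3 \<Rightarrow> complex) \<Rightarrow> (3 \<Rightarrow> complex poly) \<Rightarrow> poly3 \<Rightarrow> complex poly poly" where
  "surf a ps F = subst3 (\<lambda>z. [:[:z:]:]) (\<lambda>i. [:[:a i:], ps i:]) F"

lemma poly_map_poly_eval: "poly (map_poly (\<lambda>c. poly c t) P) s = poly (poly P [:s:]) t"
  by (induction P) (auto simp: map_poly_pCons)

lemma poly_coeff_surf:
  "poly (coeff (surf a ps F) j) t = coeff (along F (\<chi> i. a i) (\<chi> i. poly (ps i) t)) j"
proof -
  have "map_poly (\<lambda>c. poly c t) (surf a ps F) = along F (\<chi> i. a i) (\<chi> i. poly (ps i) t)"
    by (rule poly_ext) (simp add: poly_map_poly_eval surf_def along_def subst3_def poly_sum poly_prod)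
  thus ?thesis by (metis coeff_map_poly poly_0)
qed

text \<open>Write the curve as \<open>k a + (t - \<tau>) ps(t)\<close>. Then
  \<open>F(k a + s ps(t))\<close> is divisible by \<open>s ^ n\<close>, since every fixed direction
  has contact \<open>n\<close>; it remains to substitute \<open>s = t - \<tau>\<close>.\<close>

lemma root_power_dvd_pull_curve:
  assumes "\<And>w. ord_ge n F a w" "homogeneous d F" "(\<chi> i. poly (ph i) \<tau>) = k *s a"
  shows "[:- \<tau>, 1:] ^ n dvd pull_curve ph F"
proof -
  define ps where "ps = (\<lambda>i. (ph i - [:k * a $ i:]) div [:- \<tau>, 1:])"
  have ph: "ph i = [:k * a $ i:] + [:- \<tau>, 1:] * ps i" for i
  proof -
    have "poly (ph i) \<tau> = k * a $ i" using assms(3) by (simp add: vec_eq_iff)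
    moreover have "poly (ph i - [:k * a $ i:]) \<tau> = poly (ph i) \<tau> - k * a $ i"
      by (simp only: poly_diff) simp
    ultimately have "poly (ph i - [:k * a $ i:]) \<tau> = 0" by (simp only: diff_self)
    hence "[:- \<tau>, 1:] dvd ph i - [:k * a $ i:]" by (rule iffD1[OF poly_eq_0_iff_dvd])
    thus ?thesis by (simp only: ps_def dvd_mult_div_cancel) simp
  qed
  define P where "P = surf (\<lambda>i. k * a $ i) ps F"
  have "coeff P j = 0" if "j < n" for j
  proof (rule poly_ext)
    fix t
    have e: "(\<chi> i. k * a $ i) = k *s a" by (simp add: vec_eq_iff)
    show "poly (coeff P j) t = poly 0 t"
      unfolding P_def poly_coeff_surf e using ord_ge_scale[OF assms(2,1)] that by (simp add: ord_ge_iff)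
  qed
  hence "monom 1 n dvd P" by (simp add: monom_1_dvd_iff')
  then obtain Q where "P = monom 1 n * Q" by (elim dvdE)
  hence "poly P [:- \<tau>, 1:] = [:- \<tau>, 1:] ^ n * poly Q [:- \<tau>, 1:]" by (simp add: poly_monom)
  moreover have "poly P [:- \<tau>, 1:] = pull_curve ph F"
    unfolding P_def surf_def pull_curve_def subst3_def
    by (simp only: poly_sum poly_mult poly_prod poly_power) (simp add: ph mult.commute)
  ultimately show ?thesis by (metis dvd_triv_left)
qed

lemma sum_root_orders_le:
  fixes p :: "complex poly"
  assumes "p \<noteq> 0" "finite S" "\<And>t. t \<in> S \<Longrightarrow> [:- t, 1:] ^ o' t dvd p"
  shows "(\<Sum>t\<in>S. o' t) \<le> degree p"
proof -
  have "(\<Sum>t\<in>S. o' t) \<le> (\<Sum>t\<in>S. order t p)"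
    using assms by (intro sum_mono) (auto simp: order_divides)
  also have "\<dots> = (\<Sum>t\<in>S \<inter> set_mset (proots p). count (proots p) t)"
    using assms by (intro sum.mono_neutral_cong_right) (auto simp: order_root)
  also have "\<dots> \<le> (\<Sum>t\<in>set_mset (proots p). count (proots p) t)"
    by (rule sum_mono2) auto
  also have "\<dots> = degree p" by (simp add: size_multiset_overloaded_eq flip: size_proots_complex)
  finally show ?thesis .
qed

subsection \<open>The blow-up\<close>

text \<open>The origin has \<open>v = 0\<close>, so only the direction \<open>b\<close> of the point
  on the exceptional curve is seen.\<close>

lemma local_coeff_over:
  assumes "fst P \<in> X"
  shows "local_coeff (local_equation X m F P a b c) 0 0 = coeff (along F a b) m"
proof -
  have "local_equation X m F P a b c = poly_shift m (surf (\<lambda>i. a $ i) (\<lambda>i. [:b $ i, c $ i:]) F)"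
    using assms by (simp add: local_equation_def surf_def)
  hence "local_coeff (local_equation X m F P a b c) 0 0 =
    poly (coeff (surf (\<lambda>i. a $ i) (\<lambda>i. [:b $ i, c $ i:]) F) m) 0"
    by (simp add: coeff_poly_shift poly_0_coeff_0)
  also have "\<dots> = coeff (along F a b) m"
    unfolding poly_coeff_surf by (simp add: vec_lambda_eta)
  finally show ?thesis .
qed

lemma local_coeff_off:
  assumes "fst P \<notin> X"
  shows "local_coeff (local_equation X m F P a b c) 0 0 = eval3 F a"
proof -
  have "local_coeff (local_equation X m F P a b c) 0 0 =
    poly (poly (subst3 (\<lambda>z. [:[:z:]:]) (\<lambda>i. [:[:a $ i, c $ i:], [:b $ i:]:]) F) 0) 0"
    using assms by (simp add: local_equation_def poly_0_coeff_0)
  thus ?thesis by (simp add: subst3_def eval3_def poly_sum poly_prod)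
qed

lemma basis_extend:
  assumes "a \<noteq> 0" obtains b c where "d3 a b c \<noteq> 0"
proof -
  obtain i where i: "a $ i \<noteq> 0" using assms by (auto simp: vec_eq_iff)
  hence "\<exists>b. cr a b \<noteq> 0"
    using exhaust_3[of i]
    by (intro exI[of _ "if i = 1 then axis 2 1 else axis 1 1 + (if i = 2 then 0 else 0)"])
      (auto simp: cr_def vec3_eq_iff axis_def)
  then obtain b where "cr a b \<noteq> 0" by blast
  thus ?thesis using cr_nonzero_iff that by metis
qed

lemma frame_at_iff:
  "frame_at X P a b c \<longleftrightarrow> d3 a b c \<noteq> 0 \<and> a \<in> Rep_ppoint (fst P) \<and>
     (fst P \<in> X \<longrightarrow> b \<in> Rep_pline (snd P (fst P)))"
  by (simp add: frame_at_def det_eq_d3)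

lemma section_vanishes_off:
  assumes "homogeneous d F" "fst P \<notin> X"
  shows "section_vanishes_at X n F P \<longleftrightarrow> eval3 F (rep (fst P)) = 0"
proof
  assume v: "section_vanishes_at X n F P"
  obtain b c where "d3 (rep (fst P)) b c \<noteq> 0" using basis_extend rep_nonzero by blast
  hence "frame_at X P (rep (fst P)) b c" using assms by (simp add: frame_at_iff rep_in)
  thus "eval3 F (rep (fst P)) = 0" using v local_coeff_off[OF assms(2)]
    unfolding section_vanishes_at_def by metis
next
  assume "eval3 F (rep (fst P)) = 0"
  thus "section_vanishes_at X n F P"
    unfolding section_vanishes_at_def local_coeff_off[OF assms(2)] frame_at_iff Rep_ppoint_rep
    using eval3_scale[OF assms(1)] by auto
qed

lemma strict_off:
  assumes "homogeneous d F" "(p, l) \<in> strict_transform X F" "p \<notin> X"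
  shows "eval3 F (rep p) = 0"
proof -
  obtain b c where "d3 (rep p) b c \<noteq> 0" using basis_extend rep_nonzero by blast
  hence "frame_at X (p, l) (rep p) b c" using assms by (simp add: frame_at_iff rep_in)
  hence "local_coeff (local_equation X (mult_at F p) F (p, l) (rep p) b c) 0 0 = 0"
    using assms(2) by (fastforce simp: strict_transform_def)
  thus ?thesis using local_coeff_off[of "(p, l)" X] assms by simp
qed

text \<open>The local equation takes at the point the value of the leading form of \<open>F\<close>
  in the direction \<open>b\<close>; its vanishing raises the contact by one.\<close>

lemma strict_over:
  assumes "homogeneous d F" "(p, l) \<in> strict_transform X F" "p \<in> X"
    "b \<in> Rep_pline (l p)" "cr (rep p) b \<noteq> 0"
  shows "ord_ge (Suc (mult_at F p)) F (rep p) b"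
proof -
  obtain c where "d3 (rep p) b c \<noteq> 0" using cr_nonzero_iff assms(5) by blast
  hence "frame_at X (p, l) (rep p) b c" using assms by (simp add: frame_at_iff rep_in)
  hence "local_coeff (local_equation X (mult_at F p) F (p, l) (rep p) b c) 0 0 = 0"
    using assms(2) by (fastforce simp: strict_transform_def)
  hence "coeff (along F (rep p) b) (mult_at F p) = 0"
    using local_coeff_over[of "(p, l)" X] assms by simp
  moreover have "ord_ge (mult_at F p) F (rep p) b"
    using vanishes_mult_at[of F p] by (simp add: vanishes_to_order_iff[OF assms(1)])
  ultimately show ?thesis by (auto simp: ord_ge_iff less_Suc_eq)
qed

lemma mult_at_scale:
  assumes "k \<noteq> 0" shows "mult_at (cst k * F) p = mult_at F p"
proof -
  have "vanishes_to_order (cst k * F) p j \<longleftrightarrow> vanishes_to_order F p j" for j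
    using assms by (simp add: vanishes_to_order_def)
  thus ?thesis by (simp add: mult_at_def)
qed

lemma strict_transform_scale:
  assumes "k \<noteq> 0" shows "strict_transform X (cst k * F) = strict_transform X F"
proof -
  have "local_coeff (local_equation X m (cst k * F) P a b c) 0 0 = 0 \<longleftrightarrow>
    local_coeff (local_equation X m F P a b c) 0 0 = 0" for m P a b c
    using assms by (cases "fst P \<in> X") (simp_all add: local_coeff_over local_coeff_off)
  thus ?thesis by (simp add: strict_transform_def mult_at_scale[OF assms])
qed

subsection \<open>General position\<close>

definition nocol :: "ppoint set \<Rightarrow> bool" where
  "nocol S \<longleftrightarrow> (\<forall>p\<in>S. \<forall>q\<in>S. \<forall>r\<in>S. p \<noteq> q \<longrightarrow> p \<noteq> r \<longrightarrow> q \<noteq> r \<longrightarrow> d3 (rep p) (rep q) (rep r) \<noteq> 0)"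

lemma nocolD: "nocol S \<Longrightarrow> p \<in> S \<Longrightarrow> q \<in> S \<Longrightarrow> r \<in> S \<Longrightarrow> p \<noteq> q \<Longrightarrow> p \<noteq> r \<Longrightarrow> q \<noteq> r \<Longrightarrow>
  d3 (rep p) (rep q) (rep r) \<noteq> 0"
  by (simp add: nocol_def)

lemma nocol_subset: "nocol S \<Longrightarrow> T \<subseteq> S \<Longrightarrow> nocol T"
  unfolding nocol_def by blast

lemma subset3E:
  assumes "card S \<ge> 3"
  obtains p q r where "p \<in> S" "q \<in> S" "r \<in> S" "p \<noteq> q" "p \<noteq> r" "q \<noteq> r"
proof -
  obtain B where "B \<subseteq> S" "card B = 3" using assms by (meson obtain_subset_with_card_n)
  thus ?thesis using that unfolding card_3_iff by blast
qed

lemma linear_form_eq_0: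
  assumes "d3 a b c \<noteq> 0" "homogeneous 1 M" "eval3 M a = 0" "eval3 M b = 0" "eval3 M c = 0"
  shows "M = 0"
  by (rule eval3_basis_eqI[OF assms(1)]) (use assms in \<open>simp add: eval3_homogeneous_1[OF assms(2), simplified]\<close>)

lemma nocol_line_card:
  assumes "nocol S" "homogeneous 1 M" "M \<noteq> 0"
  shows "card {p\<in>S. eval3 M (rep p) = 0} \<le> 2"
proof (rule ccontr)
  assume "\<not> ?thesis"
  hence "card {p\<in>S. eval3 M (rep p) = 0} \<ge> 3" by simp
  then obtain p q r where pqr: "p \<in> {p\<in>S. eval3 M (rep p) = 0}" "q \<in> {p\<in>S. eval3 M (rep p) = 0}"
    "r \<in> {p\<in>S. eval3 M (rep p) = 0}" "p \<noteq> q" "p \<noteq> r" "q \<noteq> r" by (rule subset3E)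
  hence "d3 (rep p) (rep q) (rep r) \<noteq> 0" using nocolD[OF assms(1), of p q r] by simp
  from linear_form_eq_0[OF this assms(2)] pqr assms(3) show False by simp
qed

text \<open>A conic containing a line is a pair of lines, which covers at most \<open>2 + 2\<close>
  of the five points.\<close>

lemma conic_noline:
  assumes "nocol S" "card S = 5" "homogeneous 2 F" "F \<noteq> 0" "\<And>p. p \<in> S \<Longrightarrow> eval3 F (rep p) = 0"
  shows "noline F"
  unfolding noline_def
proof (intro allI impI)
  fix a b assume ab: "cr a b \<noteq> 0"
  show "\<exists>x y. eval3 F (x *s a + y *s b) \<noteq> 0"
  proof (rule ccontr)
    assume "\<not> ?thesis"
    then obtain M where M: "homogeneous 1 M" "F = line_form a b * M"
      using quad_factor_line[OF assms(3) ab] by metis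
    have nz: "line_form a b \<noteq> 0" "M \<noteq> 0" using M assms(4) by auto
    have "S = {p\<in>S. eval3 (line_form a b) (rep p) = 0} \<union> {p\<in>S. eval3 M (rep p) = 0}"
      using assms(5) M by auto
    hence "card S \<le> card {p\<in>S. eval3 (line_form a b) (rep p) = 0} + card {p\<in>S. eval3 M (rep p) = 0}"
      by (metis card_Un_le)
    also have "\<dots> \<le> 2 + 2"
      using nocol_line_card[OF assms(1) homogeneous_line_form nz(1)] nocol_line_card[OF assms(1) M(1) nz(2)] by linarith
    finally show False using assms(2) by simp
  qed
qed

text \<open>A section restricted to the curve has all its zeros at \<open>S\<close>, so up to a scalar there is only
  one: sections cannot separate points of the curve.\<close>

lemma very_ample_curve:
  assumes X: "finite X" and va: "pluri_anticanonical_very_ample X n"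
    and ph: "\<And>i. degree (ph i) \<le> e" and S: "S \<subseteq> X" "card S = 3 * e" "inj_on \<tau> S"
    and on: "\<And>p. p \<in> S \<Longrightarrow> \<exists>k. k \<noteq> 0 \<and> (\<chi> i. poly (ph i) (\<tau> p)) = k *s rep p"
    and W: "infinite W" "\<And>t. t \<in> W \<Longrightarrow> (\<chi> i. poly (ph i) t) \<noteq> 0"
      "inj_on (\<lambda>t. pt (\<chi> i. poly (ph i) t)) W"
  shows False
proof -
  define vec where "vec = (\<lambda>t. \<chi> i. poly (ph i) t)"
  have W: "infinite W" "\<And>t. t \<in> W \<Longrightarrow> vec t \<noteq> 0" "inj_on (\<lambda>t. pt (vec t)) W"
    using W by (simp_all add: vec_def)
  have on: "\<And>p. p \<in> S \<Longrightarrow> \<exists>k. k \<noteq> 0 \<and> vec (\<tau> p) = k *s rep p"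
    using on by (simp add: vec_def)
  have fS: "finite S" using X S finite_subset by blast
  have "infinite ((\<lambda>t. pt (vec t)) ` W)" using finite_imageD[OF _ W(3)] W(1) by blast
  hence inf: "infinite ((\<lambda>t. pt (vec t)) ` W - X)" using X by simp
  from infinite_imp_nonempty[OF inf] obtain P1 where P1: "P1 \<in> (\<lambda>t. pt (vec t)) ` W - X" by blast
  have "infinite ((\<lambda>t. pt (vec t)) ` W - X - {P1})" using inf by simp
  from infinite_imp_nonempty[OF this] obtain P2 where P2: "P2 \<in> (\<lambda>t. pt (vec t)) ` W - X - {P1}" by blast
  obtain t1 t2 where t: "t1 \<in> W" "t2 \<in> W" "P1 = pt (vec t1)" "P2 = pt (vec t2)" "P1 \<notin> X" "P2 \<notin> X" "P1 \<noteq> P2"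
    using P1 P2 by auto
  \<comment> \<open>Over a point off \<open>X\<close> there is one point of the blow-up, given by
    the lines joining it to \<open>X\<close>.\<close>
  define B where "B = (\<lambda>p. (p, \<lambda>x. if x \<in> X then pl (rep x) (rep p) else undefined))"
  have B: "B p \<in> blowup X" if "p \<notin> X" for p
  proof -
    have "on_line x (pl (rep x) (rep p)) \<and> on_line p (pl (rep x) (rep p))" if "x \<in> X" for x
    proof -
      have "x \<noteq> p" using \<open>p \<notin> X\<close> that by blast
      thus ?thesis by (simp add: on_line_iff Rep_pl rep_indep)
    qed
    thus ?thesis by (simp add: B_def blowup_def extensional_def)
  qed
  have "B P1 \<noteq> B P2" using t by (simp add: B_def)
  then obtain F where F: "F \<in> pluri_anticanonical_sections X n" "section_vanishes_at X n F (B P1)"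
    "\<not> section_vanishes_at X n F (B P2)"
    using va B t unfolding pluri_anticanonical_very_ample_def by blast
  have hom: "homogeneous (3 * n) F" and van: "\<And>x. x \<in> X \<Longrightarrow> vanishes_to_order F x n"
    using F(1) by (auto simp: pluri_anticanonical_sections_def)
  have F1: "eval3 F (rep P1) = 0" and F2: "eval3 F (rep P2) \<noteq> 0"
    using F section_vanishes_off[OF hom, of "B P1" X n] section_vanishes_off[OF hom, of "B P2" X n] t
    by (simp_all add: B_def)
  have ev: "eval3 F (rep (pt (vec t))) = 0 \<longleftrightarrow> poly (pull_curve ph F) t = 0" if "t \<in> W" for t
  proof -
    obtain k where "k \<noteq> 0" "rep (pt (vec t)) = k *s vec t" using rep_ptE W(2)[OF \<open>t \<in> W\<close>] by blast
    thus ?thesis by (simp add: eval3_scale[OF hom] poly_pull_curve vec_def)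
  qed
  have "pull_curve ph F = 0"
  proof (rule ccontr)
    assume nz: "pull_curve ph F \<noteq> 0"
    have t1: "t1 \<notin> \<tau> ` S"
    proof
      assume "t1 \<in> \<tau> ` S"
      then obtain p where p: "p \<in> S" "t1 = \<tau> p" by blast
      then obtain k where k: "k \<noteq> 0" "vec t1 = k *s rep p" using on by blast
      hence "vec t1 \<in> Rep_ppoint p" by (simp add: Rep_ppoint_rep)
      hence "P1 = p" using pt_in[of "vec t1"] W(2)[OF t(1)] t(3) ppoint_eqI[of "vec t1" P1 p] by blast
      thus False using p S t by auto
    qed
    \<comment> \<open>The degree is at most \<open>3 * n * e\<close>. The \<open>3 * e\<close>
      points of \<open>S\<close> account for all of it with \<open>n\<close> zeros each, so one more
      zero at \<open>t1\<close> is too many.\<close>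
    define o' where "o' = (\<lambda>t. if t = t1 then 1 else n)"
    have "(\<Sum>t\<in>insert t1 (\<tau> ` S). o' t) \<le> degree (pull_curve ph F)"
    proof (rule sum_root_orders_le[OF nz])
      fix t assume t': "t \<in> insert t1 (\<tau> ` S)"
      show "[:- t, 1:] ^ o' t dvd pull_curve ph F"
      proof (cases "t = t1")
        case True thus ?thesis using ev[OF t(1)] F1 t(3) by (simp add: o'_def flip: poly_eq_0_iff_dvd)
      next
        case False
        with t' obtain p where p: "p \<in> S" "t = \<tau> p" by blast
        then obtain k where k: "vec t = k *s rep p" using on by blast
        have "ord_ge n F (rep p) w" for w
          using van[of p] p S by (auto simp: vanishes_to_order_iff[OF hom])
        thus ?thesis using root_power_dvd_pull_curve[OF _ hom, of n "rep p" ph t k] k False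
          by (simp add: o'_def vec_def)
      qed
    qed (use fS in simp)
    moreover have "(\<Sum>t\<in>insert t1 (\<tau> ` S). o' t) = 1 + (\<Sum>t\<in>\<tau> ` S. n)"
    proof -
      have "(\<Sum>t\<in>\<tau> ` S. o' t) = (\<Sum>t\<in>\<tau> ` S. n)"
        using t1 by (intro sum.cong) (auto simp: o'_def)
      thus ?thesis using t1 fS by (simp add: o'_def)
    qed
    moreover have "card (\<tau> ` S) = 3 * e" using S by (simp add: card_image)
    ultimately show False using degree_pull_curve[of "3 * n" F ph e, OF hom ph] by (simp add: mult_ac)
  qed
  thus False using ev[OF t(2)] F2 t(4) by simp
qed

lemma del_pezzo_nocol:
  assumes "del_pezzo_blowup X" shows "nocol X"
proof (rule ccontr)
  assume "\<not> nocol X"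
  then obtain p q r where pqr: "p \<in> X" "q \<in> X" "r \<in> X" "p \<noteq> q" "p \<noteq> r" "q \<noteq> r"
    "d3 (rep p) (rep q) (rep r) = 0" unfolding nocol_def by blast
  obtain n where n: "pluri_anticanonical_very_ample X n" and fin: "finite X"
    using assms by (auto simp: del_pezzo_blowup_def)
  have ind: "cr (rep p) (rep q) \<noteq> 0" using rep_indep pqr by blast
  then obtain x y where r: "rep r = x *s rep p + y *s rep q" using d3_zero_spanE pqr by blast
  have "x \<noteq> 0" using rep_indep[of q r] r pqr by (auto simp: cr_scale)
  have "y \<noteq> 0" using rep_indep[of p r] r pqr by (auto simp: cr_scale)
  \<comment> \<open>Scaling absorbs \<open>x\<close> and \<open>y\<close>, so that the third point
    is \<open>a + b\<close>; on \<open>(1 - t) a + t b\<close> the three points have the parameters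
    0, 1 and 1/2.\<close>
  define a b where "a = x *s rep p" and "b = y *s rep q"
  have ab: "cr a b \<noteq> 0" using ind \<open>x \<noteq> 0\<close> \<open>y \<noteq> 0\<close> by (simp add: a_def b_def cr_scale)
  define ph where "ph = (\<lambda>i. [:a $ i, b $ i - a $ i:])"
  have vec: "(\<chi> i. poly (ph i) t) = (1 - t) *s a + t *s b" for t
    by (simp add: ph_def vec_eq_iff algebra_simps)
  have coef: "s = s' \<and> u = u'" if "s *s a + u *s b = s' *s a + u' *s b" for s u s' u'
  proof -
    obtain c where c: "d3 a b c \<noteq> 0" using ab cr_nonzero_iff by blast
    have "d3 (s *s a + u *s b) b c = d3 (s' *s a + u' *s b) b c"
      "d3 a (s *s a + u *s b) c = d3 a (s' *s a + u' *s b) c" by (simp_all only: that)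
    thus ?thesis using c by simp
  qed
  show False
  proof (rule very_ample_curve[OF fin n, of ph 1 "{p, q, r}" "\<lambda>z. if z = p then 0 else if z = q then 1 else 1 / 2" UNIV])
    show "degree (ph i) \<le> 1" for i by (simp add: ph_def)
    show "\<exists>k. k \<noteq> 0 \<and> (\<chi> i. poly (ph i) (if z = p then 0 else if z = q then 1 else 1 / 2)) = k *s rep z"
      if z: "z \<in> {p, q, r}" for z
    proof -
      consider "z = p" | "z = q" "z \<noteq> p" | "z = r" "z \<noteq> p" "z \<noteq> q" using z by blast
      thus ?thesis
      proof cases
        case 1 thus ?thesis unfolding vec using \<open>x \<noteq> 0\<close> by (intro exI[of _ x]) (simp add: a_def)
      next
        case 2 thus ?thesis unfolding vec using \<open>y \<noteq> 0\<close> by (intro exI[of _ y]) (simp add: b_def)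
      next
        case 3 thus ?thesis unfolding vec
          by (intro exI[of _ "1 / 2"]) (simp add: a_def b_def r vector_add_ldistrib)
      qed
    qed
    show ne: "(\<chi> i. poly (ph i) t) \<noteq> 0" for t
      unfolding vec using coef[of "1 - t" t 0 0] by auto
    show "inj_on (\<lambda>t. pt (\<chi> i. poly (ph i) t)) UNIV"
    proof (rule inj_onI)
      fix t s assume e: "pt (\<chi> i. poly (ph i) t) = pt (\<chi> i. poly (ph i) s)"
      have "(\<chi> i. poly (ph i) t) \<in> Rep_ppoint (pt (\<chi> i. poly (ph i) s))"
        using pt_in[OF ne[of t]] e by simp
      hence "(\<chi> i. poly (ph i) t) \<in> range (\<lambda>k. k *s (\<chi> i. poly (ph i) s))"
        unfolding Rep_pt[OF ne] .
      then obtain k where "(1 - t) *s a + t *s b = k *s ((1 - s) *s a + s *s b)"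
        unfolding vec by blast
      hence "(1 - t) *s a + t *s b = (k * (1 - s)) *s a + (k * s) *s b"
        by (simp add: vec_eq_iff algebra_simps)
      from coef[OF this] have "1 - t = k * (1 - s)" "t = k * s" by auto
      hence "k = 1" by (simp add: algebra_simps)
      thus "t = s" using \<open>t = k * s\<close> by simp
    qed
  qed (use pqr in \<open>auto simp: infinite_UNIV_char_0 inj_on_def\<close>)
qed

subsection \<open>Restriction to lines\<close>

lemma along_rev:
  assumes "homogeneous d F" "j \<le> d"
  shows "coeff (along F b a) j = coeff (along F a b) (d - j)"
proof -
  have "along F b a = (\<Sum>i\<le>d. monom (coeff (along F a b) i) (d - i))"
  proof (rule poly_ext)
    fix t
    have "b + t *s a = t *s a + 1 *s b" by (simp add: add.commute)
    thus "poly (along F b a) t = poly (\<Sum>i\<le>d. monom (coeff (along F a b) i) (d - i)) t"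
      by (simp only: poly_along eval3_binary[OF assms(1)]) (simp add: poly_sum poly_monom)
  qed
  hence "coeff (along F b a) j = (\<Sum>i\<le>d. if d - i = j then coeff (along F a b) i else 0)"
    by (simp add: coeff_sum)
  also have "\<dots> = (\<Sum>i\<le>d. if i = d - j then coeff (along F a b) i else 0)"
    by (rule sum.cong) (use assms(2) in auto)
  finally show ?thesis by simp
qed

text \<open>The binary form of degree \<open>d\<close> is divisible by the \<open>k\<close>-th power
  of one coordinate and the \<open>l\<close>-th power of the other, which exceeds its
  degree.\<close>

lemma line_bezout:
  assumes "homogeneous d F" "ord_ge k F a b" "ord_ge l F b a" "k + l > d"
  shows "eval3 F (x *s a + y *s b) = 0"
proof -
  have "coeff (along F a b) i = 0" if "i \<le> d" for i
  proof (cases "i < k")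
    case False
    hence "d - i < l" using assms(4) that by linarith
    hence "coeff (along F b a) (d - i) = 0" using assms(3) by (simp add: ord_ge_iff)
    thus ?thesis using along_rev[OF assms(1), of "d - i" b a] that by simp
  qed (use assms(2) in \<open>simp add: ord_ge_iff\<close>)
  thus ?thesis by (simp add: eval3_binary[OF assms(1)])
qed

lemma line_bezout_single:
  assumes "homogeneous d F" "ord_ge k F a b" "ord_ge l F b a" "k + l = d"
  shows "eval3 F (x *s a + y *s b) = coeff (along F a b) k * x ^ l * y ^ k"
proof -
  have "coeff (along F a b) i = 0" if "i \<le> d" "i \<noteq> k" for i
  proof (cases "i < k")
    case False
    hence "d - i < l" using assms(4) that by linarith
    hence "coeff (along F b a) (d - i) = 0" using assms(3) by (simp add: ord_ge_iff)
    thus ?thesis using along_rev[OF assms(1), of "d - i" b a] that by simp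
  qed (use assms(2) in \<open>simp add: ord_ge_iff\<close>)
  hence "(\<Sum>i\<le>d. coeff (along F a b) i * x ^ (d - i) * y ^ i) =
    (\<Sum>i\<le>d. if i = k then coeff (along F a b) k * x ^ (d - k) * y ^ k else 0)"
    by (intro sum.cong) auto
  also have "\<dots> = coeff (along F a b) k * x ^ l * y ^ k" using assms(4) by auto
  finally show ?thesis by (simp add: eval3_binary[OF assms(1)])
qed

lemma line_bezout3:
  assumes "homogeneous d F" "ord_ge k F a b" "ord_ge l F b a" "k + l = d"
    "eval3 F (u *s a + v *s b) = 0" "u \<noteq> 0" "v \<noteq> 0"
  shows "eval3 F (x *s a + y *s b) = 0"
  using assms(5-7) line_bezout_single[OF assms(1-4), of u v] line_bezout_single[OF assms(1-4), of x y] by simp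

lemma nolineD: "noline F \<Longrightarrow> cr a b \<noteq> 0 \<Longrightarrow> (\<And>x y. eval3 F (x *s a + y *s b) = 0) \<Longrightarrow> False"
  unfolding noline_def by blast

lemma third_point_coords:
  assumes "p \<noteq> q" "p \<noteq> r" "q \<noteq> r" "d3 (rep p) (rep q) (rep r) = 0"
  obtains u v where "rep r = u *s rep p + v *s rep q" "u \<noteq> 0" "v \<noteq> 0"
proof -
  obtain u v where uv: "rep r = u *s rep p + v *s rep q"
    using d3_zero_spanE[OF rep_indep[OF assms(1)] assms(4)] by blast
  moreover have "u \<noteq> 0" using rep_indep[OF assms(3)] uv by (auto simp: cr_scale)
  moreover have "v \<noteq> 0" using rep_indep[OF assms(2)] uv by (auto simp: cr_scale)
  ultimately show ?thesis using that by blast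
qed

lemma ord_ge_other_direction:
  assumes "homogeneous k F" "ord_ge n F a d" "cr a d \<noteq> 0" "d3 a d w = 0"
  shows "ord_ge n F a w"
  using d3_zero_spanE[OF assms(3,4)] ord_ge_in_span[OF assms(1,2), of 1] by fastforce

subsection \<open>Conics\<close>

lemma noline_conic_d3:
  assumes "homogeneous 2 F" "noline F" "p \<noteq> q" "p \<noteq> r" "q \<noteq> r"
    "eval3 F (rep p) = 0" "eval3 F (rep q) = 0" "eval3 F (rep r) = 0"
  shows "d3 (rep p) (rep q) (rep r) \<noteq> 0"
proof
  assume "d3 (rep p) (rep q) (rep r) = 0"
  then obtain u v where "rep r = u *s rep p + v *s rep q" "u \<noteq> 0" "v \<noteq> 0"
    using third_point_coords[OF assms(3-5)] by blast
  thus False using nolineD[OF assms(2) rep_indep[OF assms(3)]] assms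
      line_bezout3[OF assms(1), of 1 "rep p" "rep q" 1 u v] by simp
qed

lemma noline_conic_tangent:
  assumes "homogeneous 2 F" "noline F" "ord_ge 2 F a d" "cr a d \<noteq> 0" "cr a w \<noteq> 0" "eval3 F w = 0"
  shows "d3 a d w \<noteq> 0"
proof
  assume "d3 a d w = 0"
  hence "ord_ge 2 F a w" using ord_ge_other_direction[OF assms(1,3,4)] by blast
  thus False using nolineD[OF assms(2,5)] line_bezout[OF assms(1), of 2 a w 1] assms(6) by simp
qed

text \<open>On the line through the common points both conics restrict to multiples of
  \<open>x * y\<close>, for \<open>F\<close> a nonzero one. Cancelling by a multiple of
  \<open>F\<close> leaves a form that contains the line.\<close>

lemma conics_match_on_line:
  assumes F: "homogeneous 2 F" "noline F" and G: "homogeneous 2 G"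
    and ab: "cr a b \<noteq> 0" "eval3 F a = 0" "eval3 F b = 0" "eval3 G a = 0" "eval3 G b = 0"
  obtains k M where "homogeneous 1 M" "G - cst k * F = line_form a b * M"
proof -
  define f where "f = coeff (along F a b) 1"
  define g where "g = coeff (along G a b) 1"
  have f: "eval3 F (x *s a + y *s b) = f * x * y" for x y
    using line_bezout_single[OF F(1), of 1 a b 1] ab by (simp add: f_def)
  have g: "eval3 G (x *s a + y *s b) = g * x * y" for x y
    using line_bezout_single[OF G(1), of 1 a b 1] ab by (simp add: g_def)
  have "f \<noteq> 0" using nolineD[OF F(2) ab(1)] f by auto
  hence "eval3 (G - cst (g / f) * F) (x *s a + y *s b) = 0" for x y by (simp add: f g)
  moreover have "homogeneous 2 (G - cst (g / f) * F)"
    by (intro homogeneous_diff homogeneous_cst_mult F G)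
  ultimately show ?thesis using quad_factor_line[OF _ ab(1)] that by metis
qed

text \<open>Once the line through two of the points is split off, the linear cofactor vanishes at
  the other three, which are not collinear as \<open>F\<close> contains no line.\<close>

lemma conics_5_points:
  assumes F: "homogeneous 2 F" "noline F" and G: "homogeneous 2 G" and S: "card S = 5"
    "\<And>p. p \<in> S \<Longrightarrow> eval3 F (rep p) = 0" "\<And>p. p \<in> S \<Longrightarrow> eval3 G (rep p) = 0"
  obtains k where "G = cst k * F"
proof -
  obtain p1 S1 where 1: "S = insert p1 S1" "p1 \<notin> S1" "card S1 = 4" using S(1)
    by (metis card_eq_SucD eval_nat_numeral(3) numeral_Bit1 semiring_norm(26) semiring_norm(27) semiring_norm(28))
  obtain p2 S2 where 2: "S1 = insert p2 S2" "p2 \<notin> S2" "card S2 = 3" using 1(3)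
    by (metis card_eq_SucD eval_nat_numeral(2) semiring_norm(26) semiring_norm(27))
  obtain p3 p4 p5 where 3: "S2 = {p3, p4, p5}" "p3 \<noteq> p4" "p3 \<noteq> p5" "p4 \<noteq> p5" using 2(3) card_3_iff by metis
  have ne: "p1 \<noteq> p2" using 1 2 by auto
  obtain k M where M: "homogeneous 1 M" "G - cst k * F = line_form (rep p1) (rep p2) * M"
  proof -
    have "eval3 F (rep p1) = 0" "eval3 F (rep p2) = 0" "eval3 G (rep p1) = 0" "eval3 G (rep p2) = 0"
      using S 1 2 by auto
    from conics_match_on_line[OF F G rep_indep[OF ne] this] show thesis using that by blast
  qed
  have M0: "eval3 M (rep p) = 0" if "p \<in> S2" for p
  proof -
    have "p \<in> S" "p \<noteq> p1" "p \<noteq> p2" using that 1 2 by auto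
    hence "d3 (rep p1) (rep p2) (rep p) \<noteq> 0"
      using noline_conic_d3[OF F ne, of p] S 1 2 by auto
    moreover have "eval3 (G - cst k * F) (rep p) = 0" using S \<open>p \<in> S\<close> by simp
    ultimately show ?thesis unfolding M by simp
  qed
  have "d3 (rep p3) (rep p4) (rep p5) \<noteq> 0"
    by (rule noline_conic_d3[OF F]) (use S 1 2 3 in auto)
  hence "M = 0" using linear_form_eq_0[OF _ M(1)] M0 3 by simp
  hence "G = cst k * F" using M by simp
  thus ?thesis using that by blast
qed

text \<open>The common tangent acts as a fifth point: the linear cofactor vanishes to order two at
  \<open>p\<close> along \<open>d\<close>, hence at \<open>d\<close> itself.\<close>

lemma conics_4_points_tangent:
  assumes F: "homogeneous 2 F" "noline F" and G: "homogeneous 2 G" and S: "card S = 4"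
    "\<And>p. p \<in> S \<Longrightarrow> eval3 F (rep p) = 0" "\<And>p. p \<in> S \<Longrightarrow> eval3 G (rep p) = 0"
    and p: "p \<in> S" "cr (rep p) d \<noteq> 0" "ord_ge 2 F (rep p) d" "ord_ge 2 G (rep p) d"
  obtains k where "G = cst k * F"
proof -
  have fin: "finite S" using S(1) card.infinite by fastforce
  have "card (S - {p}) = 3" using S p fin by simp
  then obtain p1 p2 p3 where 3: "S - {p} = {p1, p2, p3}" "p1 \<noteq> p2" "p1 \<noteq> p3" "p2 \<noteq> p3" using card_3_iff by metis
  hence in': "p1 \<in> S" "p2 \<in> S" "p3 \<in> S" "p1 \<noteq> p" "p2 \<noteq> p" "p3 \<noteq> p" by auto
  obtain k M where M: "homogeneous 1 M" "G - cst k * F = line_form (rep p1) (rep p2) * M"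
  proof -
    have "eval3 F (rep p1) = 0" "eval3 F (rep p2) = 0" "eval3 G (rep p1) = 0" "eval3 G (rep p2) = 0"
      using S in' by auto
    from conics_match_on_line[OF F G rep_indep[OF 3(2)] this] show thesis using that by blast
  qed
  have nz: "d3 (rep p1) (rep p2) (rep p) \<noteq> 0" "d3 (rep p1) (rep p2) (rep p3) \<noteq> 0"
    by (rule noline_conic_d3[OF F]; use S 3 in' p in auto)+
  have "ord_ge 2 (G - cst k * F) (rep p) d" using p by (intro ord_ge_diff ord_ge_cst_mult)
  hence "ord_ge 2 M (rep p) d" unfolding M using nz ord_ge_joinl_cancel by blast
  moreover have "along M (rep p) d = [:eval3 M (rep p), eval3 M d:]"
    by (subst (1 2 3) homogeneous_1_lf[OF M(1)]) (rule along_lf)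
  ultimately have "eval3 M (rep p) = 0" "eval3 M d = 0"
    by (auto simp: ord_ge_iff less_2_cases_iff all_conj_distrib)
  moreover have "eval3 (G - cst k * F) (rep p3) = 0" using S in' by simp
  hence "eval3 M (rep p3) = 0" unfolding M using nz by simp
  moreover have "d3 (rep p) d (rep p3) \<noteq> 0"
    by (rule noline_conic_tangent[OF F p(3,2) rep_indep]) (use in' S(2) in auto)
  ultimately have "M = 0" using linear_form_eq_0[OF _ M(1), of "rep p" d "rep p3"] by simp
  hence "G = cst k * F" using M by simp
  thus ?thesis using that by blast
qed

text \<open>As \<open>F\<close> vanishes at \<open>a\<close>, there is no term in
  \<open>u^2\<close>. \<open>M\<close> is the polar form of \<open>a\<close>, the equation of the
  tangent at a smooth point; solving for \<open>u\<close> projects the conic from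
  \<open>a\<close>.\<close>

lemma conic_polar:
  assumes "homogeneous 2 F" "a \<noteq> 0" "eval3 F a = 0"
  obtains M where "homogeneous 1 M" "\<And>u v w. eval3 F (u *s a + v *s w) = v\<^sup>2 * eval3 F w + u * v * eval3 M w"
proof -
  obtain b c where bc: "d3 a b c \<noteq> 0" using basis_extend[OF assms(2)] by blast
  obtain A B C D E G where e: "\<And>x y z. eval3 F (x *s a + y *s b + z *s c) =
    A*x^2 + B*y^2 + C*z^2 + D*y*z + E*x*z + G*x*y"
    using quad_expandE[OF assms(1)] by metis
  have A: "A = 0" using e[of 1 0 0] assms by simp
  define M where "M = cst G * lco b c a + cst E * lco c a b"
  have "homogeneous 1 M" unfolding M_def by (intro homogeneous_add homogeneous_cst_mult homogeneous_lco)
  moreover have "eval3 F (u *s a + v *s w) = v\<^sup>2 * eval3 F w + u * v * eval3 M w" for u v w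
  proof -
    obtain x y z where w: "w = x *s a + y *s b + z *s c" using basis_coordsE[OF bc] by blast
    have 1: "u *s a + v *s w = (u + v * x) *s a + (v * y) *s b + (v * z) *s c"
      by (simp add: w vec3_eq_iff algebra_simps)
    have 2: "eval3 M w = G * y + E * z" unfolding w by (simp add: M_def eval3_lco[OF bc])
    have 3: "eval3 F w = B*y^2 + C*z^2 + D*y*z + E*x*z + G*x*y" unfolding w e A by simp
    show ?thesis unfolding 1 2 3 e A by (simp add: power2_eq_square algebra_simps)
  qed
  ultimately show ?thesis using that by blast
qed

text \<open>The expansion of the cubic around \<open>a\<close>: \<open>L\<close> is the equation of
  the tangent, and \<open>N\<close> that of the tangent cone at a double point, where
  \<open>L\<close> vanishes.\<close>

lemma cubic_polar:
  assumes "homogeneous 3 F" "a \<noteq> 0" "eval3 F a = 0"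
  obtains L N where "homogeneous 1 L" "homogeneous 2 N"
    "\<And>u v w. eval3 F (u *s a + v *s w) = u\<^sup>2 * v * eval3 L w + u * v\<^sup>2 * eval3 N w + v ^ 3 * eval3 F w"
proof -
  obtain b c where bc: "d3 a b c \<noteq> 0" using basis_extend[OF assms(2)] by blast
  obtain A B C D E G H I J K where e: "\<And>x y z. eval3 F (x *s a + y *s b + z *s c) =
    A*x^3 + B*y^3 + C*z^3 + D*x^2*y + E*x^2*z + G*x*y^2 + H*y^2*z + I*x*z^2 + J*y*z^2 + K*x*y*z"
    using cubic_expandE[OF assms(1)] by metis
  have A: "A = 0" using e[of 1 0 0] assms by simp
  define L where "L = cst D * lco b c a + cst E * lco c a b"
  \<comment> \<open>The summand with factor 2 comes from the coordinate \<open>x\<close> of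
    \<open>w\<close> along \<open>a\<close>: \<open>(u + v x)^2\<close> contributes
    \<open>2 u v x\<close>.\<close>
  define N where "N = cst G * (lco b c a * lco b c a) + cst I * (lco c a b * lco c a b) +
    cst K * (lco b c a * lco c a b) + cst 2 * (lco a b c * L)"
  have L: "homogeneous 1 L" unfolding L_def by (intro homogeneous_add homogeneous_cst_mult homogeneous_lco)
  have "homogeneous (1 + 1) N" unfolding N_def
    by (intro homogeneous_add homogeneous_cst_mult homogeneous_mult homogeneous_lco L)
  hence "homogeneous 2 N" by (simp add: numeral_2_eq_2)
  moreover have "eval3 F (u *s a + v *s w) = u\<^sup>2 * v * eval3 L w + u * v\<^sup>2 * eval3 N w + v ^ 3 * eval3 F w" for u v w
  proof -
    obtain x y z where w: "w = x *s a + y *s b + z *s c" using basis_coordsE[OF bc] by blast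
    have 1: "u *s a + v *s w = (u + v * x) *s a + (v * y) *s b + (v * z) *s c"
      by (simp add: w vec3_eq_iff algebra_simps)
    have L: "eval3 L w = D * y + E * z" unfolding w by (simp add: L_def eval3_lco[OF bc])
    have N: "eval3 N w = G * y\<^sup>2 + I * z\<^sup>2 + K * y * z + 2 * x * (D * y + E * z)"
      using L unfolding w by (simp add: N_def eval3_lco[OF bc] power2_eq_square)
    have 3: "eval3 F w = B*y^3 + C*z^3 + D*x^2*y + E*x^2*z + G*x*y^2 + H*y^2*z + I*x*z^2 + J*y*z^2 + K*x*y*z"
      unfolding w e A by simp
    show ?thesis unfolding 1 L N 3 e A by (simp add: power2_eq_square power3_eq_cube algebra_simps)
  qed
  ultimately show ?thesis using that L by blast
qed

lemma basis_w: assumes "d3 a b c \<noteq> 0" shows "cr a (b + t *s c) \<noteq> 0"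
  by (rule cr_nonzeroI[of _ _ c]) (use assms in simp)

lemma d3_same_direction: "d3 a (x *s a + y *s w) (x' *s a + y' *s w) = 0"
  by (simp only: d3_lin d3_alt) simp

text \<open>The lines through \<open>a\<close> are parametrised by \<open>t\<close> through their
  point \<open>b + t c\<close>; the excluded line through \<open>c\<close> corresponds to infinite
  \<open>t\<close>.\<close>

lemma affine_coordsE:
  assumes "d3 a b c \<noteq> 0" "d3 a w c \<noteq> 0"
  obtains x y t where "w = x *s a + y *s (b + t *s c)" "y \<noteq> 0"
proof -
  obtain x y z where w: "w = x *s a + y *s b + z *s c" using basis_coordsE[OF assms(1)] by blast
  have "y \<noteq> 0" using assms(2) w by auto
  moreover from this have "w = x *s a + y *s (b + (z / y) *s c)" by (simp add: w vec3_eq_iff field_simps)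
  ultimately show ?thesis using that by blast
qed

lemma del_pezzo_six_on_conic:
  assumes dp: "del_pezzo_blowup X" and T: "T \<subseteq> X" "card T = 6" and F: "homogeneous 2 F"
    and F0: "\<And>p. p \<in> T \<Longrightarrow> eval3 F (rep p) = 0"
  shows "F = 0"
proof (rule ccontr)
  assume nz: "F \<noteq> 0"
  have nc: "nocol T" using nocol_subset[OF del_pezzo_nocol[OF dp] T(1)] .
  have fX: "finite X" and fT: "finite T" using dp T finite_subset by (auto simp: del_pezzo_blowup_def)
  obtain p1 where p1: "p1 \<in> T" using T by fastforce
  define T1 where "T1 = T - {p1}"
  have T1: "card T1 = 5" "T1 \<subseteq> T" "p1 \<notin> T1" using p1 T fT by (auto simp: T1_def)
  have nol: "noline F"
    using conic_noline[OF nocol_subset[OF nc T1(2)] T1(1) F nz] F0 T1 by blast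
  define a where "a = rep p1"
  obtain M where M: "homogeneous 1 M"
    "\<And>u v w. eval3 F (u *s a + v *s w) = v\<^sup>2 * eval3 F w + u * v * eval3 M w"
    using conic_polar[OF F, of a] F0 p1 by (auto simp: a_def)
  have FM: "\<not> (eval3 F w = 0 \<and> eval3 M w = 0)" if "cr a w \<noteq> 0" for w
    using nolineD[OF nol that] M(2) by auto
  have ca: "cr a (rep s) \<noteq> 0" if "s \<in> T1" for s using rep_indep[of p1 s] that T1 by (auto simp: a_def)
  obtain s0 where s0: "s0 \<in> T1" using T1 by fastforce
  have "M \<noteq> 0" using FM[OF ca[OF s0]] F0 s0 T1 by auto
  \<comment> \<open>\<open>c\<close> is chosen so that neither the tangent at \<open>a\<close> nor a
    line from \<open>a\<close> to another of the six points has infinite parameter.\<close>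
  have "\<exists>c. \<forall>G \<in> insert M ((\<lambda>s. line_form a (rep s)) ` T1). eval3 G c \<noteq> 0"
    by (rule eval3_nonzero_family) (use \<open>M \<noteq> 0\<close> line_form_nonzero[OF ca] finite_subset[OF T1(2) fT] in \<open>auto\<close>)
  then obtain c where c: "eval3 M c \<noteq> 0" "\<And>s. s \<in> T1 \<Longrightarrow> d3 a (rep s) c \<noteq> 0" by auto
  define b where "b = rep s0"
  have bas: "d3 a b c \<noteq> 0" using c s0 by (simp add: b_def)
  have "\<exists>x y t. rep s = x *s a + y *s (b + t *s c) \<and> y \<noteq> 0" if "s \<in> T1" for s
    using affine_coordsE[OF bas c(2)[OF that]] by metis
  then obtain xx yy tt where co: "\<And>s. s \<in> T1 \<Longrightarrow> rep s = xx s *s a + yy s *s (b + tt s *s c) \<and> yy s \<noteq> 0"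
    by metis
  \<comment> \<open>The parameter of the tangent at \<open>a\<close>: there the second intersection
    point is \<open>p1\<close> itself.\<close>
  define t1 where "t1 = - eval3 M b / eval3 M c"
  have Mw: "eval3 M (b + t *s c) = eval3 M b + t * eval3 M c" for t
    using eval3_homogeneous_1[OF M(1), of 0 a 1 b t c] by simp
  have Mt1: "eval3 M (b + t1 *s c) = 0" unfolding Mw t1_def using c(1) by simp
  have Meq: "t = t1" if "eval3 M (b + t *s c) = 0" for t
    using that c(1) by (simp add: Mw t1_def field_simps)
      (metis add_eq_0_iff minus_mult_left neg_equal_iff_equal nonzero_mult_div_cancel_right)
  define tau where "tau = (\<lambda>s. if s = p1 then t1 else tt s)"
  \<comment> \<open>A parametrisation of degree 2: the line from \<open>a\<close> to
    \<open>w = b + t c\<close> meets the conic again at \<open>F(w) a - M(w) w\<close>.\<close>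
  define ph where "ph = (\<lambda>i. along F b c * [:a $ i:] - along M b c * [:b $ i, c $ i:])"
  have vec: "(\<chi> i. poly (ph i) t) = eval3 F (b + t *s c) *s a - eval3 M (b + t *s c) *s (b + t *s c)" for t
    by (simp add: ph_def vec_eq_iff poly_along algebra_simps)
  have on: "\<exists>k. k \<noteq> 0 \<and> (\<chi> i. poly (ph i) (tau p)) = k *s rep p \<and> (p \<in> T1 \<longrightarrow> eval3 M (b + tau p *s c) \<noteq> 0)" if p: "p \<in> T" for p
  proof (cases "p = p1")
    case True
    thus ?thesis using FM[OF basis_w[OF bas], of t1] Mt1 unfolding vec
      by (intro exI[of _ "eval3 F (b + t1 *s c)"]) (simp add: tau_def a_def T1(3))
  next
    case False
    hence pT: "p \<in> T1" using p by (simp add: T1_def)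
    define w where "w = b + tt p *s c"
    have r: "rep p = xx p *s a + yy p *s w" "yy p \<noteq> 0" using co[OF pT] by (auto simp: w_def)
    have "yy p * (yy p * eval3 F w + xx p * eval3 M w) = 0"
      using F0[OF p] unfolding r(1) M(2) by (simp add: power2_eq_square algebra_simps)
    hence "yy p * eval3 F w + xx p * eval3 M w = 0" using r(2) by (simp only: mult_eq_0_iff) simp
    hence Fw: "eval3 F w = - (xx p / yy p) * eval3 M w"
      using r(2) by (simp add: field_simps add_eq_0_iff2)
    hence Mw: "eval3 M w \<noteq> 0" using FM[OF basis_w[OF bas, of "tt p"]] by (auto simp: w_def)
    have "eval3 F w *s a - eval3 M w *s w = (- eval3 M w / yy p) *s rep p"
      unfolding Fw r(1) using r(2) by (simp add: vec3_eq_iff field_simps)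
    thus ?thesis using Mw r(2) False unfolding vec
      by (intro exI[of _ "- eval3 M w / yy p"]) (simp add: tau_def w_def)
  qed
  have inj: "inj_on tau T"
  proof (rule inj_onI, rule ccontr)
    fix p q assume pq: "p \<in> T" "q \<in> T" "tau p = tau q" "p \<noteq> q"
    have M1: "eval3 M (b + tau p1 *s c) = 0" using Mt1 by (simp add: tau_def)
    have "p \<in> T1" "q \<in> T1" using on[OF pq(1)] on[OF pq(2)] pq M1 by (auto simp: T1_def)
    moreover from this have "tt p = tt q" using pq T1(3) by (auto simp: tau_def split: if_splits)
    ultimately have "d3 a (rep p) (rep q) = 0" using co[of p] co[of q] d3_same_direction by metis
    thus False using nocolD[OF nc p1 pq(1,2)] pq \<open>p \<in> T1\<close> \<open>q \<in> T1\<close> T1(3) by (auto simp: a_def)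
  qed
  obtain n where n: "pluri_anticanonical_very_ample X n" using dp by (auto simp: del_pezzo_blowup_def)
  have ne: "(\<chi> i. poly (ph i) t) \<noteq> 0" for t
  proof
    assume "(\<chi> i. poly (ph i) t) = 0"
    hence e: "eval3 F (b + t *s c) *s a - eval3 M (b + t *s c) *s (b + t *s c) = 0" by (simp add: vec)
    have "d3 (eval3 F (b + t *s c) *s a - eval3 M (b + t *s c) *s (b + t *s c)) b c = 0"
      "d3 a (eval3 F (b + t *s c) *s a - eval3 M (b + t *s c) *s (b + t *s c)) c = 0"
      unfolding e by simp_all
    thus False using FM[OF basis_w[OF bas, of t]] bas by simp
  qed
  show False
  proof (rule very_ample_curve[OF fX n, of ph 2 T tau "UNIV - {t1}"])
    fix i
    have "degree (along F b c * [:a $ i:]) \<le> 2"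
      using degree_mult_le[of "along F b c" "[:a $ i:]"] degree_along[OF F, of b c] by simp
    moreover have "degree (along M b c * [:b $ i, c $ i:]) \<le> 2"
    proof -
      have "degree [:b $ i, c $ i:] \<le> 1" by simp
      thus ?thesis using degree_mult_le[of "along M b c" "[:b $ i, c $ i:]"] degree_along[OF M(1), of b c]
        by linarith
    qed
    ultimately show "degree (ph i) \<le> 2" unfolding ph_def by (rule degree_diff_le)
  next
    show "inj_on (\<lambda>t. pt (\<chi> i. poly (ph i) t)) (UNIV - {t1})"
    proof (rule inj_onI)
      fix t s assume ts: "t \<in> UNIV - {t1}" "s \<in> UNIV - {t1}"
        and e: "pt (\<chi> i. poly (ph i) t) = pt (\<chi> i. poly (ph i) s)"
      have "(\<chi> i. poly (ph i) t) \<in> Rep_ppoint (pt (\<chi> i. poly (ph i) s))"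
        using pt_in[OF ne[of t]] e by simp
      hence "(\<chi> i. poly (ph i) t) \<in> range (\<lambda>k. k *s (\<chi> i. poly (ph i) s))"
        unfolding Rep_pt[OF ne] .
      then obtain k where k: "(\<chi> i. poly (ph i) t) = k *s (\<chi> i. poly (ph i) s)" by blast
      have Mts: "eval3 M (b + t *s c) \<noteq> 0" "eval3 M (b + s *s c) \<noteq> 0" using Meq ts by auto
      from arg_cong[OF k, of "\<lambda>v. d3 a v c"] have k1: "eval3 M (b + t *s c) = k * eval3 M (b + s *s c)"
        using bas by (simp add: vec)
      from arg_cong[OF k, of "\<lambda>v. d3 a b v"] have "eval3 M (b + t *s c) * t = k * (eval3 M (b + s *s c) * s)"
        using bas by (simp add: vec)
      hence "eval3 M (b + t *s c) * t = eval3 M (b + t *s c) * s" using k1 by simp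
      thus "t = s" using Mts by simp
    qed
  next
    show "\<exists>k. k \<noteq> 0 \<and> (\<chi> i. poly (ph i) (tau p)) = k *s rep p" if "p \<in> T" for p
      using on[OF that] by blast
  qed (use T inj ne in \<open>auto simp: infinite_UNIV_char_0\<close>)
qed

subsection \<open>Curves of degree at most three through seven points in general position\<close>

definition isL :: "ppoint set \<Rightarrow> poly3 \<Rightarrow> ppoint set \<Rightarrow> bool" where
  "isL X F S \<longleftrightarrow> homogeneous 1 F \<and> F \<noteq> 0 \<and> S \<subseteq> X \<and> card S = 2 \<and> (\<forall>x\<in>S. eval3 F (rep x) = 0)"

text \<open>Conics are indexed by the two points that they omit.\<close>

definition isQ :: "ppoint set \<Rightarrow> poly3 \<Rightarrow> ppoint set \<Rightarrow> bool" where
  "isQ X F S \<longleftrightarrow> homogeneous 2 F \<and> F \<noteq> 0 \<and> S \<subseteq> X \<and> card S = 2 \<and> (\<forall>x\<in>X - S. eval3 F (rep x) = 0)"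

definition isC :: "ppoint set \<Rightarrow> poly3 \<Rightarrow> ppoint \<Rightarrow> bool" where
  "isC X F x \<longleftrightarrow> homogeneous 3 F \<and> F \<noteq> 0 \<and> x \<in> X \<and> (\<forall>w. ord_ge 2 F (rep x) w) \<and>
     (\<forall>y\<in>X - {x}. eval3 F (rep y) = 0)"

lemma six_subset:
  assumes "card T \<ge> 6" obtains T' where "T' \<subseteq> T" "card T' = 6"
  using assms by (meson obtain_subset_with_card_n)

text \<open>Classical general position of seven points, in the form extracted from
  ampleness.\<close>

locale dp2 =
  fixes X :: "ppoint set"
  assumes finX: "finite X" and cardX: "card X = 7" and nc: "nocol X"
    and six: "\<And>T F. T \<subseteq> X \<Longrightarrow> card T = 6 \<Longrightarrow> homogeneous 2 F \<Longrightarrow> (\<And>p. p \<in> T \<Longrightarrow> eval3 F (rep p) = 0) \<Longrightarrow> F = 0"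
begin

lemma finS: "S \<subseteq> X \<Longrightarrow> finite S" using finX finite_subset by blast

lemma six_le: "T \<subseteq> X \<Longrightarrow> card T \<ge> 6 \<Longrightarrow> homogeneous 2 F \<Longrightarrow> (\<And>p. p \<in> T \<Longrightarrow> eval3 F (rep p) = 0) \<Longrightarrow> F = 0"
  by (metis six six_subset subset_eq)

lemma isL_off:
  assumes "isL X F S" "x \<in> X" "x \<notin> S" shows "eval3 F (rep x) \<noteq> 0"
proof
  assume "eval3 F (rep x) = 0"
  hence "insert x S \<subseteq> {p\<in>X. eval3 F (rep p) = 0}" using assms by (auto simp: isL_def)
  hence "card (insert x S) \<le> 2"
    using nocol_line_card[OF nc, of F] assms finX card_mono[of "{p\<in>X. eval3 F (rep p) = 0}" "insert x S"]
    by (auto simp: isL_def)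
  moreover have "finite S" using assms finS by (auto simp: isL_def)
  ultimately show False using assms by (simp add: isL_def)
qed

lemma isQ_card: "isQ X F S \<Longrightarrow> card (X - S) = 5"
  using finX cardX finS by (auto simp: isQ_def card_Diff_subset)

lemma isQ_off:
  assumes "isQ X F S" "x \<in> S" shows "eval3 F (rep x) \<noteq> 0"
proof
  assume "eval3 F (rep x) = 0"
  moreover have "x \<notin> X - S" "finite (X - S)" using assms finX by auto
  hence "card (insert x (X - S)) = 6" using isQ_card[OF assms(1)] by simp
  ultimately have "F = 0" using six[of "insert x (X - S)" F] assms by (auto simp: isQ_def)
  thus False using assms by (simp add: isQ_def)
qed

lemma isQ_noline: "isQ X F S \<Longrightarrow> noline F"
  using conic_noline[of "X - S" F] isQ_card[of F S] nocol_subset[OF nc, of "X - S"]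
  by (auto simp: isQ_def)

text \<open>A line contained in the cubic covers at most two of the seven points. If
  \<open>x\<close> is on it, the residual conic still passes through \<open>x\<close> and through
  the points off the line, six in all. If not, the residual conic is a cone with vertex
  \<open>x\<close>, hence two lines, and cannot contain three further points, as no three points are
  collinear.\<close>

lemma isC_noline:
  assumes "isC X F x" shows "noline F"
  unfolding noline_def
proof (intro allI impI, rule ccontr)
  fix u v assume uv: "cr u v \<noteq> 0" and "\<not> (\<exists>x y. eval3 F (x *s u + y *s v) \<noteq> 0)"
  have F: "homogeneous 3 F" "F \<noteq> 0" "x \<in> X" "\<And>w. ord_ge 2 F (rep x) w"
    "\<And>y. y \<in> X - {x} \<Longrightarrow> eval3 F (rep y) = 0" using assms by (auto simp: isC_def)
  obtain Q where Q: "homogeneous 2 Q" "F = line_form u v * Q"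
    using cubic_factor_line[OF F(1) uv] \<open>\<not> (\<exists>x y. eval3 F (x *s u + y *s v) \<noteq> 0)\<close> by metis
  define Z where "Z = {p\<in>X. eval3 (line_form u v) (rep p) = 0}"
  have Z: "card Z \<le> 2" "Z \<subseteq> X" "finite Z" unfolding Z_def
    using nocol_line_card[OF nc homogeneous_line_form line_form_nonzero[OF uv]] finX by auto
  have Q0: "eval3 Q (rep p) = 0" if "p \<in> X - Z - {x}" for p
    using F(5)[of p] that Q by (auto simp: Z_def)
  show False
  proof (cases "x \<in> Z")
    case True
    obtain w where w: "d3 u v w \<noteq> 0" using uv cr_nonzero_iff by blast
    have "ord_ge (Suc 1) (line_form u v * Q) (rep x) w" using F(4)[of w] Q by (simp add: numeral_2_eq_2)
    hence "ord_ge 1 Q (rep x) w" using ord_ge_joinl_cancel' w by blast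
    hence Qx: "eval3 Q (rep x) = 0" by simp
    have "card (insert x (X - Z)) = Suc (card (X - Z))" using True finX by (simp add: card_insert_if)
    moreover have "card (X - Z) \<ge> 5" using Z cardX by (simp add: card_Diff_subset)
    ultimately have "card (insert x (X - Z)) \<ge> 6" by linarith
    hence "Q = 0" using six_le[of "insert x (X - Z)" Q] Q(1) Qx Q0 F(3) by auto
    thus False using F Q by simp
  next
    case False
    hence lx: "d3 u v (rep x) \<noteq> 0" using F(3) by (simp add: Z_def)
    have Q2: "ord_ge 2 Q (rep x) w" for w
      by (rule ord_ge_joinl_cancel[OF _ lx]) (use F(4) Q in simp)
    have "card (X - Z) \<ge> 5" using Z cardX by (simp add: card_Diff_subset)
    moreover have "x \<in> X - Z" using F False by simp
    ultimately have "card (X - Z - {x}) \<ge> 3" using finX by simp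
    then obtain p q r where pqr: "p \<in> X - Z - {x}" "q \<in> X - Z - {x}" "r \<in> X - Z - {x}"
      "p \<noteq> q" "p \<noteq> r" "q \<noteq> r" by (rule subset3E)
    have lin: "eval3 Q (s *s rep x + t *s rep p) = 0" if "p \<in> X - Z - {x}" for p s t
      using line_bezout[OF Q(1) Q2, of 1 "rep p" s t] Q0[OF that] by simp
    have d: "d3 (rep x) (rep p) (rep q) \<noteq> 0" "d3 (rep x) (rep p) (rep r) \<noteq> 0" "d3 (rep x) (rep q) (rep r) \<noteq> 0"
      by (rule nocolD[OF nc]; use pqr F(3) in auto)+
    obtain M where M: "homogeneous 1 M" "Q = line_form (rep x) (rep p) * M"
      using quad_factor_line[OF Q(1) cr_nonzeroI[OF d(1)] lin[OF pqr(1)]] by blast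
    have Mq: "eval3 M (rep q) = 0" and Mr: "eval3 M (rep r) = 0" using Q0 pqr M d by auto
    have "eval3 M (1 *s rep x + 1 *s rep q) = 0"
      using lin[OF pqr(2), of 1 1] d(1) unfolding M(2) by (simp add: d3_swap'[of _ _ "rep q"])
    hence "eval3 M (rep x) = 0"
      using eval3_homogeneous_1[OF M(1), of 1 "rep x" 1 "rep q" 0 0] Mq by simp
    hence "M = 0" using linear_form_eq_0[OF d(3) M(1)] Mq Mr by blast
    thus False using M Q F by simp
  qed
qed

text \<open>A second double point would give the line joining it to \<open>x\<close> four
  intersections with the cubic.\<close>

lemma isC_simple:
  assumes "isC X F x" "y \<in> X" "y \<noteq> x" shows "\<exists>w. \<not> ord_ge 2 F (rep y) w"
proof (rule ccontr)
  assume "\<not> ?thesis"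
  hence "eval3 F (s *s rep x + t *s rep y) = 0" for s t
    using assms by (intro line_bezout[of 3 F 2 "rep x" "rep y" 2]) (auto simp: isC_def)
  thus False using nolineD[OF isC_noline[OF assms(1)] rep_indep[of x y]] assms by auto
qed

lemma isC_not_triple:
  assumes "isC X F x" "y \<in> X" "y \<noteq> x" shows "\<not> ord_ge 3 F (rep x) (rep y)"
proof
  assume "ord_ge 3 F (rep x) (rep y)"
  hence "eval3 F (s *s rep x + t *s rep y) = 0" for s t
    using assms by (intro line_bezout[of 3 F 3 "rep x" "rep y" 1]) (auto simp: isC_def)
  thus False using nolineD[OF isC_noline[OF assms(1)] rep_indep[of x y]] assms by auto
qed

lemma isQ_simple:
  assumes "isQ X F S" "x \<in> X" "x \<notin> S" shows "\<exists>w. \<not> ord_ge 2 F (rep x) w"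
proof (rule ccontr)
  assume n: "\<not> ?thesis"
  have "card (X - S - {x}) \<ge> 3" using isQ_card[OF assms(1)] assms finX by simp
  then obtain y where y: "y \<in> X" "y \<notin> S" "y \<noteq> x" by (metis Diff_iff insertI1 subset3E)
  have "eval3 F (s *s rep x + t *s rep y) = 0" for s t
    using assms y n by (intro line_bezout[of 2 F 2 "rep x" "rep y" 1]) (auto simp: isQ_def)
  thus False using nolineD[OF isQ_noline[OF assms(1)] rep_indep[of x y]] y by auto
qed

lemma isL_mult:
  assumes "isL X F S" "x \<in> X" shows "mult_at F x = (if x \<in> S then 1 else 0)"
proof -
  have h: "homogeneous 1 F" using assms by (simp add: isL_def)
  show ?thesis
  proof (rule mult_at_eqI)
    show "vanishes_to_order F x (if x \<in> S then 1 else 0)"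
      using assms by (auto simp: vanishes_to_order_iff[OF h] isL_def)
    have "\<not> vanishes_to_order F x (Suc 1)"
    proof
      assume v: "vanishes_to_order F x (Suc 1)"
      have "eval3 F w = 0" for w
        using v line_bezout[OF h, of 2 "rep x" w 0 0 1] by (simp add: vanishes_to_order_iff[OF h] numeral_2_eq_2)
      thus False using eval3_nonzero[of F] assms by (auto simp: isL_def)
    qed
    thus "\<not> vanishes_to_order F x (Suc (if x \<in> S then 1 else 0))"
      using isL_off[OF assms(1,2)] by (auto simp: vanishes_to_order_iff[OF h])
  qed
qed

lemma isQ_mult:
  assumes "isQ X F S" "x \<in> X" shows "mult_at F x = (if x \<in> S then 0 else 1)"
proof -
  have h: "homogeneous 2 F" using assms by (simp add: isQ_def)
  show ?thesis
    using assms isQ_off[OF assms(1), of x] isQ_simple[OF assms, unfolded numeral_2_eq_2]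
    by (intro mult_at_eqI) (auto simp: vanishes_to_order_iff[OF h] isQ_def)
qed

lemma isC_mult:
  assumes "isC X F x" "y \<in> X" shows "mult_at F y = (if y = x then 2 else 1)"
proof -
  have h: "homogeneous 3 F" using assms by (simp add: isC_def)
  show ?thesis
  proof (cases "y = x")
    case True
    have "card (X - {x}) \<ge> 3" using assms finX cardX by (simp add: isC_def)
    then obtain z where z: "z \<in> X" "z \<noteq> x" by (metis Diff_iff insertI1 subset3E)
    show ?thesis using True assms isC_not_triple[OF assms(1) z]
      by (intro mult_at_eqI) (auto simp: vanishes_to_order_iff[OF h] isC_def eval_nat_numeral)
  next
    case False
    show ?thesis using False assms isC_simple[OF assms False, unfolded numeral_2_eq_2]
      by (intro mult_at_eqI) (auto simp: vanishes_to_order_iff[OF h] isC_def)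
  qed
qed

lemma isQ_conic: "isQ X F S \<Longrightarrow> conic F"
  using noline_irreducible[of 2 F] isQ_noline by (auto simp: conic_def isQ_def)

lemma isC_irreducible: "isC X F x \<Longrightarrow> irreducible F"
  using noline_irreducible[of 3 F] isC_noline by (auto simp: isC_def)

subsection \<open>The classes of the (-1)-curves\<close>

text \<open>The multiplicities have sum \<open>3 d - 1\<close> and sum of squares
  \<open>d^2 + 1\<close>, so the sum of \<open>m (m - 1)\<close> is \<open>(d - 1) (d - 2)\<close>:
  0 for \<open>d = 1\<close> and \<open>d = 2\<close>, and 2 for \<open>d = 3\<close>, which allows
  exactly one multiplicity 2.\<close>

lemma minus_one_numerical:
  fixes m :: "ppoint \<Rightarrow> nat"
  assumes "int d * int d - (\<Sum>x\<in>X. int (m x) * int (m x)) = -1" "3 * int d - (\<Sum>x\<in>X. int (m x)) = 1"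
  shows "d = 1 \<and> (\<exists>S\<subseteq>X. card S = 2 \<and> (\<forall>x\<in>S. m x = 1)) \<or>
    d = 2 \<and> (\<exists>S\<subseteq>X. card S = 2 \<and> (\<forall>x\<in>X - S. m x = 1)) \<or>
    d = 3 \<and> (\<exists>x\<in>X. m x = 2 \<and> (\<forall>y\<in>X - {x}. m y = 1))"
proof -
  define D where "D = int d"
  define s where "s = (\<Sum>x\<in>X. int (m x))"
  define q where "q = (\<Sum>x\<in>X. int (m x) * int (m x))"
  have s: "s = 3 * D - 1" and q: "q = D * D + 1" using assms by (simp_all add: s_def q_def D_def)
  \<comment> \<open>The Cauchy-Schwarz inequality bounds the degree by 3.\<close>
  have "0 \<le> (\<Sum>x\<in>X. (7 * int (m x) - s) * (7 * int (m x) - s))" by (intro sum_nonneg) simp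
  also have "\<dots> = (\<Sum>x\<in>X. 49 * (int (m x) * int (m x)) - 14 * s * int (m x) + s * s)"
    by (intro sum.cong) (auto simp: algebra_simps)
  also have "\<dots> = 49 * q - 14 * s * s + 7 * (s * s)"
    by (simp add: sum.distrib sum_subtractf sum_distrib_left[symmetric] q_def s_def[symmetric] cardX)
  finally have "D * D - 3 * D - 3 \<le> 0" unfolding s q by (simp add: algebra_simps)
  moreover have "D * D - 3 * D - 3 > 0" if "D \<ge> 4"
  proof -
    have "D * (D - 3) \<ge> 4 * 1" using that by (intro mult_mono) auto
    thus ?thesis by (simp add: algebra_simps)
  qed
  ultimately have "D \<le> 3" by linarith
  moreover have "0 \<le> s" unfolding s_def by (intro sum_nonneg) simp
  hence "D \<ge> 1" using s by linarith
  ultimately consider "D = 1" | "D = 2" | "D = 3" by linarith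
  moreover have qs: "(\<Sum>x\<in>X. int (m x) * (int (m x) - 1)) = q - s"
    by (simp add: q_def s_def sum_subtractf[symmetric] algebra_simps)
  have nn: "int (m x) * (int (m x) - 1) \<ge> 0" for x by (cases "m x") auto
  have small: "\<exists>T\<subseteq>X. int (card T) = s \<and> (\<forall>x\<in>T. m x = 1)" if "q = s"
  proof -
    have "\<forall>x\<in>X. int (m x) * (int (m x) - 1) = 0"
      using qs that sum_nonneg_eq_0_iff[OF finX, of "\<lambda>x. int (m x) * (int (m x) - 1)"] nn by simp
    hence m01: "\<forall>x\<in>X. m x = 0 \<or> m x = 1" by auto
    hence "s = (\<Sum>x\<in>X. if m x = 1 then 1 else 0)" unfolding s_def by (intro sum.cong) auto
    also have "\<dots> = int (card {x\<in>X. m x = 1})" using finX by (simp add: sum.If_cases Int_def)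
    finally show ?thesis by (intro exI[of _ "{x\<in>X. m x = 1}"]) auto
  qed
  ultimately show ?thesis
  proof cases
    assume D: "D = 1"
    then obtain T where "T \<subseteq> X" "int (card T) = 2" "\<forall>x\<in>T. m x = 1" using small s q by auto
    thus ?thesis using D by (intro disjI1) (auto simp: D_def)
  next
    assume D: "D = 2"
    then obtain T where T: "T \<subseteq> X" "int (card T) = 5" "\<forall>x\<in>T. m x = 1" using small s q by auto
    hence "card (X - T) = 2" using finX cardX finS by (simp add: card_Diff_subset)
    moreover have "X - (X - T) = T" using T by auto
    ultimately show ?thesis using D T by (intro disjI2 disjI1) (auto simp: D_def intro!: exI[of _ "X - T"])
  next
    assume D: "D = 3"
    hence sq: "s = 8" "q - s = 2" using s q by auto
    have "\<exists>x\<in>X. int (m x) * (int (m x) - 1) \<noteq> 0"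
      using qs sq by (metis (mono_tags, lifting) sum.neutral zero_neq_numeral)
    then obtain x where x: "x \<in> X" "int (m x) * (int (m x) - 1) \<noteq> 0" by blast
    hence mx: "m x \<ge> 2" by (cases "m x") (auto simp: Suc_le_eq)
    have "(\<Sum>y\<in>X. int (m y) * (int (m y) - 1)) =
      int (m x) * (int (m x) - 1) + (\<Sum>y\<in>X - {x}. int (m y) * (int (m y) - 1))"
      using x finX by (simp add: sum.remove)
    moreover have r: "(\<Sum>y\<in>X - {x}. int (m y) * (int (m y) - 1)) \<ge> 0" by (intro sum_nonneg) (use nn in auto)
    moreover have "int (m x) * (int (m x) - 1) \<ge> 2 * 1" using mx by (intro mult_mono) auto
    ultimately have e: "int (m x) * (int (m x) - 1) = 2" "(\<Sum>y\<in>X - {x}. int (m y) * (int (m y) - 1)) = 0"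
      using qs sq by linarith+
    have "m x < 3"
    proof (rule ccontr)
      assume "\<not> m x < 3"
      hence "int (m x) * (int (m x) - 1) \<ge> 3 * 2" by (intro mult_mono) auto
      thus False using e by simp
    qed
    hence mx2: "m x = 2" using mx by simp
    have "\<forall>y\<in>X - {x}. int (m y) * (int (m y) - 1) = 0"
      using e(2) sum_nonneg_eq_0_iff[of "X - {x}" "\<lambda>x. int (m x) * (int (m x) - 1)"] nn finX by simp
    hence le1: "\<forall>y\<in>X - {x}. m y = 0 \<or> m y = 1" by auto
    have "s = int (m x) + (\<Sum>y\<in>X - {x}. int (m y))" unfolding s_def using x finX by (simp add: sum.remove)
    hence "(\<Sum>y\<in>X - {x}. 1 - int (m y)) = 0"
      using sq mx2 x cardX finX by (simp add: sum_subtractf)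
    hence "\<forall>y\<in>X - {x}. 1 - int (m y) = 0"
    proof (subst (asm) sum_nonneg_eq_0_iff)
      fix y assume "y \<in> X - {x}"
      thus "0 \<le> 1 - int (m y)" using bspec[OF le1, of y] by auto
    qed (use finX in auto)
    hence "\<forall>y\<in>X - {x}. m y = 1" by auto
    thus ?thesis using D mx2 x by (intro disjI2) (auto simp: D_def)
  qed
qed

lemma minus_one_curve_cases:
  assumes "minus_one_curve X C"
  shows "(\<exists>x\<in>X. C = exceptional_curve X x) \<or> (\<exists>F S. isL X F S \<and> C = strict_transform X F) \<or>
    (\<exists>F S. isQ X F S \<and> C = strict_transform X F) \<or> (\<exists>F x. isC X F x \<and> C = strict_transform X F)"
proof -
  obtain D where D: "irreducible_curve X C D" "intersection X D D = -1" "intersection X D canonical_class = -1"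
    using assms by (auto simp: minus_one_curve_def)
  from D(1) consider (E) x where "x \<in> X" "C = exceptional_curve X x" |
    (F) F d where "homogeneous d F" "irreducible F" "C = strict_transform X F" "D = (int d, \<lambda>x. int (mult_at F x))"
    unfolding irreducible_curve_def by blast
  thus ?thesis
  proof cases
    case F
    have F0: "F \<noteq> 0" using F(2) by (auto simp: irreducible_def)
    have "int d * int d - (\<Sum>x\<in>X. int (mult_at F x) * int (mult_at F x)) = -1"
      "3 * int d - (\<Sum>x\<in>X. int (mult_at F x)) = 1"
      using D(2,3) by (simp_all add: F(4) intersection_def canonical_class_def sum_negf)
    note cs = minus_one_numerical[OF this]
    have van: "ord_ge (mult_at F x) F (rep x) w" for x w
      using vanishes_mult_at[of F x] by (simp add: vanishes_to_order_iff[OF F(1)])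
    have one: "eval3 F (rep x) = 0" if "mult_at F x = 1" for x using van[of x 0] that by simp
    from cs consider S where "d = 1" "S \<subseteq> X" "card S = 2" "\<forall>x\<in>S. mult_at F x = 1" |
      S where "d = 2" "S \<subseteq> X" "card S = 2" "\<forall>x\<in>X - S. mult_at F x = 1" |
      x where "d = 3" "x \<in> X" "mult_at F x = 2" "\<forall>y\<in>X - {x}. mult_at F y = 1" by blast
    thus ?thesis
    proof cases
      case (1 S) hence "isL X F S" using F F0 one by (auto simp: isL_def)
      thus ?thesis using F by blast
    next
      case (2 S) hence "isQ X F S" using F F0 one by (auto simp: isQ_def)
      thus ?thesis using F by blast
    next
      case (3 x) hence "isC X F x" using F F0 one van[of x] by (auto simp: isC_def)
      thus ?thesis using F by blast
    qed
  qed blast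
qed

end

lemma del_pezzo_dp2: "del_pezzo_blowup X \<Longrightarrow> card X = 7 \<Longrightarrow> dp2 X"
  using del_pezzo_nocol del_pezzo_six_on_conic by unfold_locales (auto simp: del_pezzo_blowup_def)

subsection \<open>Curves through a common point of the blow-up\<close>

text \<open>A point of the blow-up is a point of the plane, \<open>p\<close>, together with, for \<open>p \<in> X\<close>, a tangent
  direction \<open>d\<close> at \<open>p\<close>.\<close>

definition passes :: "ppoint set \<Rightarrow> poly3 \<Rightarrow> ppoint \<Rightarrow> complex^3 \<Rightarrow> bool" where
  "passes X F p d \<longleftrightarrow> (if p \<in> X then cr (rep p) d \<noteq> 0 \<and> ord_ge (Suc (mult_at F p)) F (rep p) d
     else eval3 F (rep p) = 0)"

lemma passes_off: "passes X F p d \<Longrightarrow> p \<notin> X \<Longrightarrow> eval3 F (rep p) = 0"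
  by (simp add: passes_def)

context dp2
begin

lemma isL_over:
  assumes "isL X F S" "passes X F p d" "p \<in> X"
  shows "p \<in> S" "eval3 F d = 0" "cr (rep p) d \<noteq> 0"
proof -
  have f: "ord_ge (Suc (if p \<in> S then 1 else 0)) F (rep p) d" and c: "cr (rep p) d \<noteq> 0"
    using assms isL_mult[OF assms(1,3)] by (auto simp: passes_def)
  show pS: "p \<in> S" using f isL_off[OF assms(1,3)] by (cases "p \<in> S") auto
  show "eval3 F d = 0"
    using f pS line_bezout[of 1 F 2 "rep p" d 0 0 1] assms by (simp add: isL_def numeral_2_eq_2)
qed (use assms in \<open>simp add: passes_def\<close>)

lemma isQ_over:
  assumes "isQ X F S" "passes X F p d" "p \<in> X"
  shows "p \<notin> S" "ord_ge 2 F (rep p) d" "cr (rep p) d \<noteq> 0"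
proof -
  have f: "ord_ge (Suc (if p \<in> S then 0 else 1)) F (rep p) d"
    using assms isQ_mult[OF assms(1,3)] by (auto simp: passes_def)
  show pS: "p \<notin> S" using f isQ_off[OF assms(1), of p] by (cases "p \<in> S") auto
  show "ord_ge 2 F (rep p) d" using f pS by (simp add: numeral_2_eq_2)
qed (use assms in \<open>simp add: passes_def\<close>)

lemma isC_over:
  assumes "isC X F x" "passes X F p d" "p \<in> X"
  shows "ord_ge (if p = x then 3 else 2) F (rep p) d" "cr (rep p) d \<noteq> 0"
  using assms isC_mult[OF assms(1,3)] by (auto simp: passes_def eval_nat_numeral)

lemma lines_eq:
  assumes "homogeneous 1 F" "F \<noteq> 0" "homogeneous 1 G" "cr a b \<noteq> 0"
    "eval3 F a = 0" "eval3 F b = 0" "eval3 G a = 0" "eval3 G b = 0"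
  obtains k where "G = cst k * F"
proof -
  obtain c where c: "d3 a b c \<noteq> 0" using assms(4) cr_nonzero_iff by blast
  have "eval3 F c \<noteq> 0" using linear_form_eq_0[OF c assms(1,5,6)] assms(2) by blast
  hence "G - cst (eval3 G c / eval3 F c) * F = 0"
    by (intro linear_form_eq_0[OF c]) (use assms in \<open>simp_all add: homogeneous_diff homogeneous_cst_mult\<close>)
  thus ?thesis using that by simp
qed

text \<open>The line is determined by the common point of \<open>X\<close> and \<open>p\<close>, or
  by \<open>p\<close> and the direction \<open>d\<close> if \<open>p\<close> belongs to
  \<open>X\<close>.\<close>

lemma isL_isL_proportional:
  assumes F: "isL X F S" and G: "isL X G T" and P: "passes X F p d" "passes X G p d" and ST: "S \<inter> T \<noteq> {}"
  obtains k where "G = cst k * F"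
proof (cases "p \<in> X")
  case True
  thus ?thesis using lines_eq[of F G "rep p" d] isL_over[OF F P(1) True] isL_over[OF G P(2) True] F G that
    by (auto simp: isL_def)
next
  case False
  from ST obtain x where x: "x \<in> S" "x \<in> T" by blast
  hence "x \<noteq> p" using False F by (auto simp: isL_def)
  thus ?thesis using lines_eq[of F G "rep x" "rep p"] rep_indep[of x p] passes_off[OF P(1) False] passes_off[OF P(2) False]
      F G that x by (auto simp: isL_def)
qed

text \<open>If the pairs are disjoint, the conic contains both points of \<open>S\<close>, and the
  common point is a third intersection with the line, a tangency if it lies over one of
  them.\<close>

lemma isL_isQ_meet:
  assumes F: "isL X F S" and G: "isQ X G T" and P: "passes X F p d" "passes X G p d"
  shows "S \<inter> T \<noteq> {}"
proof
  assume ST: "S \<inter> T = {}"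
  have hF: "homogeneous 1 F" "F \<noteq> 0" and hG: "homogeneous 2 G" and SX: "S \<subseteq> X" "card S = 2"
    using F G by (auto simp: isL_def isQ_def)
  obtain x y where xy: "S = {x, y}" "x \<noteq> y" using SX by (meson card_2_iff)
  have Gz: "eval3 G (rep s) = 0" and Fz: "eval3 F (rep s) = 0" if "s \<in> S" for s
    using that ST F G by (auto simp: isL_def isQ_def)
  note nol = isQ_noline[OF G]
  show False
  proof (cases "p \<in> X")
    case False
    have "d3 (rep x) (rep y) (rep p) \<noteq> 0"
      by (rule noline_conic_d3[OF hG nol]) (use xy False SX Gz passes_off[OF P(2) False] in auto)
    thus False using linear_form_eq_0[OF _ hF(1)] hF Fz xy passes_off[OF P(1) False] by blast
  next
    case True
    have o: "p \<in> S" "eval3 F d = 0" using isL_over[OF F P(1) True] by auto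
    define z where "z = (if p = x then y else x)"
    have z: "z \<in> S" "z \<noteq> p" using o xy by (auto simp: z_def)
    have "d3 (rep p) d (rep z) \<noteq> 0"
      using noline_conic_tangent[OF hG nol] isQ_over[OF G P(2) True] rep_indep[of p z] z Gz by blast
    thus False using linear_form_eq_0[OF _ hF(1), of "rep p" d "rep z"] hF Fz o z by blast
  qed
qed

text \<open>A line through \<open>x\<close> and a second point of \<open>X\<close> meets the cubic
  there with multiplicity \<open>2 + 1\<close>; the common point would be a fourth
  intersection.\<close>

lemma isL_isC_meet:
  assumes F: "isL X F S" and G: "isC X G x" and P: "passes X F p d" "passes X G p d"
  shows "x \<notin> S"
proof
  assume xS: "x \<in> S"
  have hF: "homogeneous 1 F" "F \<noteq> 0" and SX: "S \<subseteq> X" "card S = 2" using F by (auto simp: isL_def)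
  have hG: "homogeneous 3 G" "\<And>w. ord_ge 2 G (rep x) w" "\<And>y. y \<in> X - {x} \<Longrightarrow> eval3 G (rep y) = 0"
    using G by (auto simp: isC_def)
  obtain y where S: "S = {x, y}" "x \<noteq> y" using SX xS by (metis card_2_iff insertE insert_commute singletonD)
  have y: "y \<in> X" using S SX by auto
  have Fz: "eval3 F (rep s) = 0" if "s \<in> S" for s using that F by (auto simp: isL_def)
  have xy: "cr (rep x) (rep y) \<noteq> 0" using rep_indep S by blast
  have "eval3 G (u *s rep x + v *s rep y) = 0" for u v
  proof (cases "p \<in> X")
    case False
    have ne: "p \<noteq> x" "p \<noteq> y" using False S SX by auto
    have "d3 (rep x) (rep y) (rep p) = 0"
      using linear_form_eq_0[OF _ hF(1), of "rep x" "rep y" "rep p"] hF(2) Fz S passes_off[OF P(1) False] by auto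
    then obtain s t where st: "rep p = s *s rep x + t *s rep y" "s \<noteq> 0" "t \<noteq> 0"
      using third_point_coords S ne by metis
    show ?thesis
      by (rule line_bezout3[OF hG(1), of 2 _ _ 1 s t]) (use hG y S st passes_off[OF P(2) False] in auto)
  next
    case True
    have o: "p \<in> S" "eval3 F d = 0" "cr (rep p) d \<noteq> 0" using isL_over[OF F P(1) True] by auto
    have f: "ord_ge (if p = x then 3 else 2) G (rep p) d" using isC_over[OF G P(2) True] by blast
    have col: "d3 (rep p) d (rep z) = 0" if "z \<in> S" for z
      using linear_form_eq_0[OF _ hF(1), of "rep p" d "rep z"] hF(2) Fz o that by auto
    have col: "ord_ge (if p = x then 3 else 2) G (rep p) (rep z)" if "z \<in> S" for z
      using ord_ge_other_direction[OF hG(1) f o(3) col[OF that]] .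
    show ?thesis
    proof (cases "p = x")
      case True
      thus ?thesis using col[of y] S hG y by (intro line_bezout[OF hG(1), of 3 _ _ 1]) auto
    next
      case False
      hence "p = y" using o S by auto
      thus ?thesis using col[of x] S hG y False by (intro line_bezout[OF hG(1), of 2 _ _ 2]) auto
    qed
  qed
  thus False using nolineD[OF isC_noline[OF G] xy] by blast
qed

text \<open>Overlapping pairs contain at most three points, so the conics share four points of
  \<open>X\<close>; the common point is the fifth condition, as a point or as a tangency at one of
  the four.\<close>

lemma isQ_isQ_proportional:
  assumes F: "isQ X F S" and G: "isQ X G T" and P: "passes X F p d" "passes X G p d" and ST: "S \<inter> T \<noteq> {}"
  obtains k where "G = cst k * F"
proof -
  have hF: "homogeneous 2 F" and hG: "homogeneous 2 G" and S: "S \<subseteq> X" "card S = 2" and T: "T \<subseteq> X" "card T = 2"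
    using F G by (auto simp: isQ_def)
  have fin: "finite S" "finite T" using S T finS by auto
  have "card (S \<union> T) + card (S \<inter> T) = 4" using card_Un_Int[of S T] fin S T by simp
  moreover have "card (S \<inter> T) \<noteq> 0" using ST fin by simp
  ultimately have "card (S \<union> T) \<le> 3" by linarith
  hence c4: "card (X - (S \<union> T)) \<ge> 4" using finX cardX S T fin by (simp add: card_Diff_subset)
  have z: "eval3 F (rep s) = 0" "eval3 G (rep s) = 0" if "s \<in> X - (S \<union> T)" for s
    using that F G by (auto simp: isQ_def)
  note nol = isQ_noline[OF F]
  show ?thesis
  proof (cases "p \<in> X")
    case False
    obtain R where R: "R \<subseteq> X - (S \<union> T)" "card R = 4" using c4 by (meson obtain_subset_with_card_n)
    have pR: "card (insert p R) = 5" using R False finS by (subst card_insert_disjoint) (auto intro: finite_subset[OF _ finX])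
    show ?thesis
      by (rule conics_5_points[OF hF nol hG pR]) (use R z passes_off[OF P(1) False] passes_off[OF P(2) False] that in auto)
  next
    case True
    note o = isQ_over[OF F P(1) True] isQ_over[OF G P(2) True]
    have "card (X - (S \<union> T) - {p}) \<ge> 3" using c4 o True finX by simp
    then obtain R where R: "R \<subseteq> X - (S \<union> T) - {p}" "card R = 3" by (meson obtain_subset_with_card_n)
    have pR: "card (insert p R) = 4" using R finS by (subst card_insert_disjoint) (auto intro: finite_subset[OF _ finX])
    show ?thesis
      by (rule conics_4_points_tangent[OF hF nol hG pR, of p d]) (use R z o True that in auto)
  qed
qed

lemma isQ_proportional_eq:
  assumes F: "isQ X F S" and G: "isQ X G T" and e: "G = cst k * F"
  shows "S = T" "k \<noteq> 0"
proof -
  show k: "k \<noteq> 0" using G e by (auto simp: isQ_def cst_def)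
  have "S = {x\<in>X. eval3 F (rep x) \<noteq> 0}" "T = {x\<in>X. eval3 G (rep x) \<noteq> 0}"
    using F G isQ_off[OF F] isQ_off[OF G] by (auto simp: isQ_def)
  thus "S = T" using e k by simp
qed

text \<open>On a line through \<open>x\<close> and another common point, \<open>G\<close> agrees with \<open>F\<close> times a linear form. The
  difference is that line times a conic with enough contact with \<open>F\<close> to be a multiple of it.\<close>

lemma isQ_isC_meet:
  assumes F: "isQ X F S" and G: "isC X G x" and P: "passes X F p d" "passes X G p d"
  shows "x \<in> S"
proof (rule ccontr)
  assume xS: "x \<notin> S"
  have hF: "homogeneous 2 F" "S \<subseteq> X" "card S = 2" and hG: "homogeneous 3 G" "G \<noteq> 0" "x \<in> X" "\<And>w. ord_ge 2 G (rep x) w"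
    "\<And>y. y \<in> X - {x} \<Longrightarrow> eval3 G (rep y) = 0"
    using F G by (auto simp: isQ_def isC_def)
  have zF: "eval3 F (rep y) = 0" if "y \<in> X - S" for y using that F by (auto simp: isQ_def)
  note nol = isQ_noline[OF F]
  have "card (X - S - {x}) = 4" using isQ_card[OF F] xS hG finX by simp
  hence "card (X - S - {x} - {p}) \<ge> 3" using finX by (cases "p \<in> X - S - {x}") (auto simp: card_Diff_singleton)
  then obtain s n where sn: "s \<in> X - S - {x} - {p}" "n \<in> X - S - {x} - {p}" "s \<noteq> n" using subset3E by metis
  define a where "a = rep x" define b where "b = rep s"
  have abn: "d3 a b (rep y) \<noteq> 0" if "y \<in> X - {x, s}" for y
    unfolding a_def b_def by (rule nocolD[OF nc]) (use that sn hG in auto)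
  have ab: "cr a b \<noteq> 0" using abn[of n] sn cr_nonzeroI by blast
  \<comment> \<open>On the line \<open>a b\<close> the conic is \<open>f u v\<close> and the cubic
    \<open>g u v^2\<close>, so the linear form has to restrict to \<open>v\<close>.\<close>
  define m where "m = lco b (rep n) a"
  have m: "homogeneous 1 m" "eval3 m a = 0" "eval3 m b = 1"
    using eval3_lco(2)[of a b "rep n" 1 0 0] eval3_lco(2)[of a b "rep n" 0 1 0] abn[of n] sn
    by (auto simp: m_def homogeneous_lco simp del: One_nat_def)
  define f where "f = coeff (along F a b) 1"
  define g where "g = coeff (along G a b) 2"
  have ef: "eval3 F (u *s a + v *s b) = f * u * v" for u v
    using line_bezout_single[OF hF(1), of 1 a b 1 u v] zF[of x] zF[of s] xS hG sn by (simp add: f_def a_def b_def)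
  have eg: "eval3 G (u *s a + v *s b) = g * u * v\<^sup>2" for u v
    using line_bezout_single[OF hG(1), of 2 a b 1 u v] hG sn by (simp add: g_def a_def b_def)
  have em: "eval3 m (u *s a + v *s b) = v" for u v
    using eval3_homogeneous_1[OF m(1), of u a v b 0 0] m by simp
  have "f \<noteq> 0" using nolineD[OF nol ab] ef by auto
  define h where "h = G - cst (g / f) * (F * m)"
  have "homogeneous 3 (F * m)" using homogeneous_mult[OF hF(1) m(1)] by simp
  hence "homogeneous 3 h" unfolding h_def by (intro homogeneous_diff homogeneous_cst_mult hG)
  moreover have "eval3 h (u *s a + v *s b) = 0" for u v
    using \<open>f \<noteq> 0\<close> by (simp add: h_def ef eg em power2_eq_square)
  ultimately obtain Q where Q: "homogeneous 2 Q" "h = line_form a b * Q" using cubic_factor_line ab by metis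
  have mf: "ord_ge 1 m a w" for w using m by simp
  have "ord_ge 1 F a w" for w using zF[of x] xS hG by (simp add: a_def)
  hence Fm: "ord_ge 2 (F * m) a w" for w using ord_ge_mult[of 1 F a w 1 m] mf by (simp add: numeral_2_eq_2)
  have Qa: "eval3 Q a = 0"
  proof -
    have "ord_ge (Suc 1) (line_form a b * Q) a (rep n)"
      using hG(4)[of "rep n"] Fm[of "rep n"] unfolding Q(2)[symmetric] h_def
      by (auto simp: a_def numeral_2_eq_2 intro!: ord_ge_diff ord_ge_cst_mult)
    hence "ord_ge 1 Q a (rep n)" using ord_ge_joinl_cancel' abn[of n] sn by blast
    thus ?thesis by simp
  qed
  have Qz: "eval3 Q (rep y) = 0" if "y \<in> X - S - {x, s}" for y
  proof -
    have "eval3 h (rep y) = 0" using zF[of y] hG(5)[of y] that by (simp add: h_def)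
    thus ?thesis using Q abn[of y] that by auto
  qed
  \<comment> \<open>Four common zeros of \<open>F\<close> and \<open>Q\<close>; the fifth condition
    is the common point, as a point or as a tangency.\<close>
  define R where "R = X - S - {s}"
  have R: "card R = 4" "p \<notin> X \<Longrightarrow> p \<notin> R" "finite R" "R \<subseteq> X" using isQ_card[OF F] sn finX by (auto simp: R_def)
  have RF: "eval3 F (rep y) = 0" "eval3 Q (rep y) = 0" if "y \<in> R" for y
    using that zF Qz[of y] Qa by (auto simp: R_def a_def)
  obtain k where k: "Q = cst k * F"
  proof (cases "p \<in> X")
    case False
    have "d3 a b (rep p) \<noteq> 0" unfolding a_def b_def
      by (rule noline_conic_d3[OF hF(1) nol]) (use sn hG False zF xS passes_off[OF P(1) False] in auto)
    moreover have "eval3 h (rep p) = 0" using passes_off[OF P(1) False] passes_off[OF P(2) False] by (simp add: h_def)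
    ultimately have Qp: "eval3 Q (rep p) = 0" using Q by simp
    have "card (insert p R) = 5" using R False by simp
    thus thesis
      by (rule conics_5_points[OF hF(1) nol Q(1)]) (use RF Qp passes_off[OF P(1) False] that in auto)
  next
    case True
    note oF = isQ_over[OF F P(1) True] and oG = isC_over[OF G P(2) True]
    have pR: "p \<in> R" using oF True sn by (auto simp: R_def)
    have "ord_ge 2 Q (rep p) d"
    proof (cases "p = x")
      case True
      have "ord_ge (2 + 1) (F * m) a d" using oF True mf by (intro ord_ge_mult) (auto simp: a_def)
      hence "ord_ge (Suc 2) (line_form a b * Q) a d"
        using oG True unfolding Q(2)[symmetric] h_def by (auto simp: a_def eval_nat_numeral intro!: ord_ge_diff ord_ge_cst_mult)
      moreover have "d3 a d b \<noteq> 0"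
        using noline_conic_tangent[OF hF(1) nol oF(2,3)] rep_indep[of p s] zF[of s] sn True by (auto simp: a_def b_def)
      hence "d3 a b d \<noteq> 0" using d3_swap'[of a b d] by simp
      ultimately show ?thesis using ord_ge_joinl_cancel' True by (metis a_def)
    next
      case False
      have "ord_ge (2 + 0) (F * m) (rep p) d" using oF by (intro ord_ge_mult) auto
      hence "ord_ge 2 (line_form a b * Q) (rep p) d"
        using oG False unfolding Q(2)[symmetric] h_def by (auto intro!: ord_ge_diff ord_ge_cst_mult)
      moreover have "d3 a b (rep p) \<noteq> 0" by (rule abn) (use pR False sn True in \<open>auto simp: R_def\<close>)
      ultimately show ?thesis using ord_ge_joinl_cancel by blast
    qed
    from conics_4_points_tangent[OF hF(1) nol Q(1) R(1) _ _ pR oF(3,2) this] RF that show thesis by blast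
  qed
  \<comment> \<open>Thus the cubic would be \<open>F * M\<close>. As \<open>F\<close> vanishes at
    neither point of \<open>S\<close>, the linear form \<open>M\<close> vanishes at both and at
    \<open>x\<close>: three points not on a line.\<close>
  define M where "M = cst (g / f) * m + cst k * line_form a b"
  have "homogeneous 1 M" unfolding M_def by (intro homogeneous_add homogeneous_cst_mult m homogeneous_line_form)
  moreover have GM: "G = F * M"
  proof -
    have "G = h + cst (g / f) * (F * m)" by (simp add: h_def)
    also have "\<dots> = F * M" unfolding Q(2) k M_def by (simp add: algebra_simps)
    finally show ?thesis .
  qed
  moreover have "eval3 M a = 0" using m by (simp add: M_def)
  moreover obtain i j where ij: "S = {i, j}" "i \<noteq> j" using hF(3) by (meson card_2_iff)
  moreover have "eval3 M (rep y) = 0" if "y \<in> S" for y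
    using isQ_off[OF F that] hG(5)[of y] GM that xS hF(2) by auto
  moreover have "d3 (rep x) (rep i) (rep j) \<noteq> 0"
    by (rule nocolD[OF nc]) (use ij hF xS hG in auto)
  ultimately have "M = 0" using linear_form_eq_0[of "rep x" "rep i" "rep j" M] by (simp add: a_def)
  thus False using GM hG by simp
qed

text \<open>Scaled to agree on the line from \<open>x\<close> to another point \<open>s\<close>, two
  such cubics differ by that line times a conic, which passes through the six points other than
  \<open>s\<close>.\<close>

lemma isC_unique:
  assumes F: "isC X F x" and G: "isC X G x"
  obtains k where "G = cst k * F"
proof -
  have hF: "homogeneous 3 F" "x \<in> X" "\<And>w. ord_ge 2 F (rep x) w" "\<And>y. y \<in> X - {x} \<Longrightarrow> eval3 F (rep y) = 0"
    and hG: "homogeneous 3 G" "\<And>w. ord_ge 2 G (rep x) w" "\<And>y. y \<in> X - {x} \<Longrightarrow> eval3 G (rep y) = 0"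
    using F G by (auto simp: isC_def)
  have "card (X - {x}) \<ge> 3" using hF finX cardX by simp
  then obtain s n where sn: "s \<in> X - {x}" "n \<in> X - {x}" "s \<noteq> n" using subset3E by metis
  define a where "a = rep x" define b where "b = rep s"
  have abn: "d3 a b (rep y) \<noteq> 0" if "y \<in> X - {x, s}" for y
    unfolding a_def b_def by (rule nocolD[OF nc]) (use that sn hF in auto)
  have ab: "cr a b \<noteq> 0" using abn[of n] sn cr_nonzeroI by blast
  define f where "f = coeff (along F a b) 2"
  define g where "g = coeff (along G a b) 2"
  have ef: "eval3 F (u *s a + v *s b) = f * u * v\<^sup>2" for u v
    using line_bezout_single[OF hF(1), of 2 a b 1 u v] hF sn by (simp add: f_def a_def b_def)
  have eg: "eval3 G (u *s a + v *s b) = g * u * v\<^sup>2" for u v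
    using line_bezout_single[OF hG(1), of 2 a b 1 u v] hG sn by (simp add: g_def a_def b_def)
  have "f \<noteq> 0" using nolineD[OF isC_noline[OF F] ab] ef by auto
  define h where "h = G - cst (g / f) * F"
  have "homogeneous 3 h" unfolding h_def by (intro homogeneous_diff homogeneous_cst_mult hG hF)
  moreover have "eval3 h (u *s a + v *s b) = 0" for u v using \<open>f \<noteq> 0\<close> by (simp add: h_def ef eg)
  ultimately obtain Q where Q: "homogeneous 2 Q" "h = line_form a b * Q" using cubic_factor_line ab by metis
  have "ord_ge (Suc 1) (line_form a b * Q) a (rep n)"
    using hG(2)[of "rep n"] hF(3)[of "rep n"] unfolding Q(2)[symmetric] h_def
    by (auto simp: a_def numeral_2_eq_2 intro!: ord_ge_diff ord_ge_cst_mult)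
  hence "ord_ge 1 Q a (rep n)" using ord_ge_joinl_cancel' abn[of n] sn by blast
  hence Qa: "eval3 Q a = 0" by simp
  have Qz: "eval3 Q (rep y) = 0" if "y \<in> X - {x, s}" for y
  proof -
    have "eval3 h (rep y) = 0" using hF(4)[of y] hG(3)[of y] that by (simp add: h_def)
    thus ?thesis using Q abn[of y] that by auto
  qed
  have "card (X - {s}) = 6" using sn finX cardX by simp
  hence "Q = 0" using six[of "X - {s}" Q] Q(1) Qa Qz by (auto simp: a_def)
  hence "G = cst (g / f) * F" using Q by (simp add: h_def)
  thus ?thesis using that by blast
qed

end

section \<open>The resultant of two cubics\<close>

lemma ord_ge_shift:
  assumes "ord_ge k F q e" shows "[:- \<tau>, 1:] ^ k dvd along F (q - \<tau> *s e) e"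
proof -
  have "along F (q - \<tau> *s e) e = pcompose (along F q e) [:- \<tau>, 1:]"
    by (rule poly_ext) (simp add: poly_along poly_pcompose algebra_simps)
  moreover obtain r where "along F q e = monom 1 k * r" using assms by (auto simp: ord_ge_def)
  moreover have "pcompose (monom 1 k * r) [:- \<tau>, 1:] = [:- \<tau>, 1:] ^ k * pcompose r [:- \<tau>, 1:]"
    by (rule poly_ext) (simp add: poly_pcompose poly_monom)
  ultimately show ?thesis by simp
qed

lemma sum_order_roots:
  fixes p :: "complex poly"
  assumes "p \<noteq> 0" shows "(\<Sum>t | poly p t = 0. order t p) = degree p"
proof -
  have "degree p = (\<Sum>t\<in>set_mset (proots p). count (proots p) t)"
    by (simp add: size_multiset_overloaded_eq flip: size_proots_complex)
  thus ?thesis using assms by simp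
qed

text \<open>Two plane cubics, \<open>x H + K\<close> with a double point and \<open>x\<^sup>2 L + x N + M\<close> through that point: the
  resultant with respect to \<open>x\<close>.\<close>

definition cub_res :: "'a::comm_ring_1 \<Rightarrow> 'a \<Rightarrow> 'a \<Rightarrow> 'a \<Rightarrow> 'a \<Rightarrow> 'a" where
  "cub_res H K L N M = H * H * M - H * K * N + K * K * L"

text \<open>The resultant lies in the ideal of the two equations. As \<open>x\<close> may be any
  polynomial, it inherits the contact of both curves along a path.\<close>

lemma cub_res_ideal:
  "cub_res H K L N M = H * H * (x * x * L + x * N + M) -
     (x * H + K) * (H * (N + 2 * x * L) - (x * H + K) * L)"
  by (simp add: cub_res_def algebra_simps)

text \<open>A zero resultant makes \<open>H\<close> divide \<open>K^2 L\<close>. As \<open>H\<close>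
  has no zero in common with \<open>K\<close>, it divides \<open>L\<close>, which has smaller
  degree.\<close>

lemma cub_res_eq_0D:
  fixes H K L N M :: "complex poly"
  assumes "cub_res H K L N M = 0" "degree H = 2" "degree L \<le> 1" "\<And>t. poly H t = 0 \<Longrightarrow> poly K t \<noteq> 0"
  shows "L = 0"
proof (rule ccontr)
  assume L: "L \<noteq> 0"
  have H: "H \<noteq> 0" using assms(2) by auto
  have e: "K * K * L = H * (K * N - H * M)" using assms(1) by (simp add: cub_res_def algebra_simps)
  have "(\<Sum>t | poly H t = 0. order t H) \<le> degree L"
  proof (rule sum_root_orders_le[OF L])
    show "finite {t. poly H t = 0}" using poly_roots_finite[OF H] .
    fix t assume t: "t \<in> {t. poly H t = 0}"
    have K: "poly K t \<noteq> 0" "K \<noteq> 0" using assms(4)[of t] t by auto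
    have "[:- t, 1:] ^ order t H dvd K * K * L" unfolding e using order_1 dvd_mult2 by blast
    hence "order t H \<le> order t (K * K * L)" using K L by (simp add: order_divides)
    also have "\<dots> = order t L" using K L by (simp add: order_mult order_0I)
    finally show "[:- t, 1:] ^ order t H dvd L" by (simp add: order_divides)
  qed
  thus False using sum_order_roots[OF H] assms by simp
qed

lemma cubic_polar_along:
  assumes "\<And>u v w. eval3 F (u *s a + v *s w) = u\<^sup>2 * v * eval3 L w + u * v\<^sup>2 * eval3 N w + v ^ 3 * eval3 F w"
  shows "along F a w = [:0, eval3 L w, eval3 N w, eval3 F w:]"
  using assms[of 1] by (intro poly_ext) (simp add: poly_along power2_eq_square power3_eq_cube algebra_simps)

context dp2
begin

text \<open>Projecting from the double point \<open>x\<close> of \<open>F\<close>, the resultant of the two cubics is a binary form of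
  degree 7. It has a double zero at \<open>y\<close>, zeros at the other five points, and one more zero at
  the common point \<open>p\<close>.\<close>

lemma isC_isC_distinct:
  assumes F: "isC X F x" and G: "isC X G y" and xy: "x \<noteq> y" and P: "passes X F p d" "passes X G p d" and py: "p \<noteq> y"
  shows False
proof -
  have hF: "homogeneous 3 F" "x \<in> X" "\<And>w. ord_ge 2 F (rep x) w" "\<And>z. z \<in> X - {x} \<Longrightarrow> eval3 F (rep z) = 0"
    and hG: "homogeneous 3 G" "y \<in> X" "\<And>w. ord_ge 2 G (rep y) w" "\<And>z. z \<in> X - {y} \<Longrightarrow> eval3 G (rep z) = 0"
    using F G by (auto simp: isC_def)
  note nol = isC_noline[OF F]
  define a where "a = rep x"
  have a: "a \<noteq> 0" "eval3 F a = 0" "eval3 G a = 0"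
    using hF(3)[of 0] hG(4)[of x] xy hF(2) ord_ge_mono[of 2 F "rep x" 0 1] by (simp_all add: a_def)
  obtain L0 H where LH: "homogeneous 2 H"
    "\<And>u v w. eval3 F (u *s a + v *s w) = u\<^sup>2 * v * eval3 L0 w + u * v\<^sup>2 * eval3 H w + v ^ 3 * eval3 F w"
    using cubic_polar[OF hF(1) a(1,2)] by metis
  have alF: "along F a w = [:0, eval3 L0 w, eval3 H w, eval3 F w:]" for w by (rule cubic_polar_along[OF LH(2)])
  have L0: "eval3 L0 w = 0" for w using hF(3)[of w] alF[of w] by (simp add: ord_ge_iff a_def less_2_cases_iff)
  have eF: "eval3 F (u *s a + v *s w) = u * v\<^sup>2 * eval3 H w + v ^ 3 * eval3 F w" for u v w
    using LH(2) L0 by simp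
  obtain L N where L: "homogeneous 1 L" and N: "homogeneous 2 N" and eG:
    "\<And>u v w. eval3 G (u *s a + v *s w) = u\<^sup>2 * v * eval3 L w + u * v\<^sup>2 * eval3 N w + v ^ 3 * eval3 G w"
    using cubic_polar[OF hG(1) a(1,3)] by metis
  have alG: "along G a w = [:0, eval3 L w, eval3 N w, eval3 G w:]" for w by (rule cubic_polar_along[OF eG])
  have FH: "\<not> (eval3 F w = 0 \<and> eval3 H w = 0)" if "cr a w \<noteq> 0" for w
    using nolineD[OF nol that] eF by auto
  \<comment> \<open>\<open>ex\<close> separates the two ways in which the common point counts: as a
    further parameter, given by the direction \<open>e0\<close> from \<open>x\<close>, or, over
    another point of \<open>X\<close>, by raising the zero there to order two.\<close>
  define ex where "ex = (p \<notin> X \<or> p = x)"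
  define e0 where "e0 = (if p \<in> X then d else rep p)"
  have e0: "cr a e0 \<noteq> 0" if ex
    using that P(1) rep_indep[of x p] hF(2) by (auto simp: ex_def e0_def passes_def a_def split: if_splits)
  define W where "W = rep ` (X - {x}) \<union> (if ex then {e0} else {})"
  have W: "finite W" "\<And>w. w \<in> W \<Longrightarrow> cr a w \<noteq> 0"
  proof -
    have "cr a (rep s) \<noteq> 0" if "s \<in> X - {x}" for s using rep_indep[of x s] that by (auto simp: a_def)
    thus "cr a w \<noteq> 0" if "w \<in> W" for w using e0 that by (auto simp: W_def split: if_splits)
  qed (use finX in \<open>simp add: W_def\<close>)
  have "H \<noteq> 0" using FH[of "rep y"] hF(4)[of y] hG(2) xy rep_indep[OF xy] by (auto simp: a_def)
  \<comment> \<open>\<open>c\<close> keeps the degree of \<open>H\<close> at exactly 2 and all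
    directions in \<open>W\<close> at finite parameters.\<close>
  have "\<exists>c. \<forall>f \<in> insert H ((\<lambda>w. line_form a w) ` W). eval3 f c \<noteq> 0"
    by (rule eval3_nonzero_family) (use \<open>H \<noteq> 0\<close> line_form_nonzero[OF W(2)] W(1) in auto)
  then obtain c where c: "eval3 H c \<noteq> 0" "\<And>w. w \<in> W \<Longrightarrow> d3 a w c \<noteq> 0" by auto
  define b where "b = rep y"
  have bas: "d3 a b c \<noteq> 0" using c(2)[of "rep y"] hG(2) xy by (auto simp: b_def W_def)
  have "\<exists>u v t. w = u *s a + v *s (b + t *s c) \<and> v \<noteq> 0" if "w \<in> W" for w
    using affine_coordsE[OF bas c(2)[OF that]] by metis
  then obtain xx yy tt where co: "\<And>w. w \<in> W \<Longrightarrow> w = xx w *s a + yy w *s (b + tt w *s c) \<and> yy w \<noteq> 0" by metis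
  have ttD: "d3 a v w = 0" if "v \<in> W" "w \<in> W" "tt v = tt w" for v w
    using co[OF that(1)] co[OF that(2)] d3_same_direction that(3) by metis
  define R where "R = cub_res (along H b c) (along F b c) (along L b c) (along N b c) (along G b c)"
  \<comment> \<open>If both cubics have contact \<open>k\<close> with a line avoiding
    \<open>a\<close>, this line is a path \<open>x = X'(t)\<close> in the projection, and the
    resultant inherits a zero of order \<open>k\<close>.\<close>
  have path: "[:- t, 1:] ^ k dvd R"
    if f: "ord_ge k F (u *s a + (b + t *s c)) (u' *s a + c)" "ord_ge k G (u *s a + (b + t *s c)) (u' *s a + c)" for k u u' t
  proof -
    define X' where "X' = [:u - t * u', u':]"
    define q where "q = u *s a + (b + t *s c)"
    define e where "e = u' *s a + c"
    have v: "q - t *s e + s *s e = poly X' s *s a + 1 *s (b + s *s c)" for s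
      by (simp add: q_def e_def X'_def vec3_eq_iff algebra_simps)
    have "X' * along H b c + along F b c = along F (q - t *s e) e"
      by (rule poly_ext) (simp only: poly_along v eF, simp add: poly_along)
    hence 1: "[:- t, 1:] ^ k dvd X' * along H b c + along F b c"
      using ord_ge_shift[of k F q e t] f by (simp add: q_def e_def)
    have "X' * X' * along L b c + X' * along N b c + along G b c = along G (q - t *s e) e"
      by (rule poly_ext) (simp only: poly_along v eG, simp add: poly_along power2_eq_square)
    hence 2: "[:- t, 1:] ^ k dvd X' * X' * along L b c + X' * along N b c + along G b c"
      using ord_ge_shift[of k G q e t] f by (simp add: q_def e_def)
    show ?thesis unfolding R_def cub_res_ideal[where x = X']
      using 1 2 by (intro dvd_diff dvd_mult2[OF 1] dvd_mult[OF 2])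
  qed
  have scaled: "(1 / yy w) *s w = (xx w / yy w) *s a + (b + tt w *s c)" if "w \<in> W" for w
  proof -
    have y: "yy w \<noteq> 0" and "w = xx w *s a + yy w *s (b + tt w *s c)" using co[OF that] by auto
    from this(2) have "(1 / yy w) *s w = (1 / yy w) *s (xx w *s a + yy w *s (b + tt w *s c))" by (rule arg_cong)
    also have "\<dots> = (xx w / yy w) *s a + (b + tt w *s c)" using y by (simp add: vector_add_ldistrib)
    finally show ?thesis .
  qed
  have simple: "[:- tt w, 1:] ^ 1 dvd R" if w: "w \<in> W" "eval3 F w = 0" "eval3 G w = 0" for w
  proof (rule path[of 1 "xx w / yy w" "tt w" 0])
    show "ord_ge 1 F ((xx w / yy w) *s a + (b + tt w *s c)) (0 *s a + c)"
      unfolding scaled[OF w(1), symmetric] using w eval3_scale[OF hF(1)] by simp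
    show "ord_ge 1 G ((xx w / yy w) *s a + (b + tt w *s c)) (0 *s a + c)"
      unfolding scaled[OF w(1), symmetric] using w eval3_scale[OF hG(1)] by simp
  qed
  have yW: "rep y \<in> W" using hG(2) xy by (auto simp: W_def)
  \<comment> \<open>In the ideal identity with constant \<open>x\<close> the equation of
    \<open>G\<close>, singular at \<open>y\<close>, has a double zero. The other summand is a
    product of two factors with a zero each: \<open>F\<close>, and a cofactor that vanishes because
    \<open>F\<close> and the derivative of \<open>G\<close> towards \<open>a\<close> do.\<close>
  have double: "[:- tt (rep y), 1:] ^ 2 dvd R"
  proof -
    define t where "t = tt (rep y)"
    define u where "u = xx (rep y) / yy (rep y)"
    define q where "q = u *s a + (b + t *s c)"
    have q: "q = (1 / yy (rep y)) *s rep y" using scaled[OF yW] by (simp add: q_def u_def t_def)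
    have G2: "ord_ge 2 G q e" for e unfolding q using ord_ge_scale[OF hG(1,3)] .
    have v: "q - t *s c + s *s c = u *s a + 1 *s (b + s *s c)" for s
      by (simp add: q_def vec3_eq_iff algebra_simps)
    have "[:u:] * [:u:] * along L b c + [:u:] * along N b c + along G b c = along G (q - t *s c) c"
      by (rule poly_ext) (simp only: poly_along v eG, simp add: poly_along power2_eq_square)
    hence 1: "[:- t, 1:] ^ 2 dvd [:u:] * [:u:] * along L b c + [:u:] * along N b c + along G b c"
      using ord_ge_shift[OF G2, of t c] by simp
    have F1: "eval3 F q = 0" unfolding q using eval3_scale[OF hF(1)] hF(4)[of y] hG(2) xy by simp
    have "poly ([:u:] * along H b c + along F b c) t = eval3 F (u *s a + 1 *s (b + t *s c))"
      unfolding eF by (simp add: poly_along)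
    also have "\<dots> = 0" using F1 by (simp add: q_def)
    finally have 2: "[:- t, 1:] dvd [:u:] * along H b c + along F b c" by (rule iffD1[OF poly_eq_0_iff_dvd])
    have "along G q a = [:u * u * eval3 L (b + t *s c) + u * eval3 N (b + t *s c) + eval3 G (b + t *s c),
        2 * u * eval3 L (b + t *s c) + eval3 N (b + t *s c), eval3 L (b + t *s c):]"
    proof (rule poly_ext)
      fix s
      have v': "q + s *s a = (u + s) *s a + 1 *s (b + t *s c)" by (simp add: q_def vec3_eq_iff algebra_simps)
      show "poly (along G q a) s = poly [:u * u * eval3 L (b + t *s c) + u * eval3 N (b + t *s c) + eval3 G (b + t *s c),
        2 * u * eval3 L (b + t *s c) + eval3 N (b + t *s c), eval3 L (b + t *s c):] s"
        unfolding poly_along v' eG by (simp add: power2_eq_square algebra_simps)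
    qed
    hence "2 * u * eval3 L (b + t *s c) + eval3 N (b + t *s c) = 0"
      using G2[of a] by (simp add: ord_ge_iff less_2_cases_iff)
    hence "poly (along N b c + 2 * [:u:] * along L b c) t = 0" by (simp add: poly_along add.commute mult.assoc mult.left_commute)
    hence 3: "[:- t, 1:] dvd along N b c + 2 * [:u:] * along L b c" by (rule iffD1[OF poly_eq_0_iff_dvd])
    have 4: "[:- t, 1:] dvd along H b c * (along N b c + 2 * [:u:] * along L b c) -
        ([:u:] * along H b c + along F b c) * along L b c"
      using 2 3 by (intro dvd_diff dvd_mult[OF 3] dvd_mult2[OF 2])
    have "[:- t, 1:] ^ 2 dvd ([:u:] * along H b c + along F b c) * (along H b c * (along N b c + 2 * [:u:] * along L b c) -
        ([:u:] * along H b c + along F b c) * along L b c)"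
      unfolding power2_eq_square by (rule mult_dvd_mono[OF 2 4])
    thus ?thesis unfolding R_def cub_res_ideal[where x = "[:u:]"] t_def[symmetric]
      by (intro dvd_diff dvd_mult[OF 1])
  qed
  have inj: "inj_on (\<lambda>s. tt (rep s)) (X - {x})"
  proof (rule inj_onI, rule ccontr)
    fix s s' assume s: "s \<in> X - {x}" "s' \<in> X - {x}" "tt (rep s) = tt (rep s')" "s \<noteq> s'"
    hence "d3 a (rep s) (rep s') = 0" by (intro ttD) (auto simp: W_def)
    thus False using nocolD[OF nc hF(2), of s s'] s by (auto simp: a_def)
  qed
  have zs: "[:- tt (rep s), 1:] ^ 1 dvd R" if "s \<in> X - {x}" for s
  proof (cases "s = y")
    case True thus ?thesis using double by (metis dvd_trans le_imp_power_dvd one_le_numeral)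
  next
    case False
    show ?thesis by (rule simple) (use that False hF(4) hG(4) in \<open>auto simp: W_def\<close>)
  qed
  have exR: "[:- tt e0, 1:] ^ 1 dvd R \<and> tt e0 \<notin> (\<lambda>s. tt (rep s)) ` (X - {x})" if ex
  proof
    have eW: "e0 \<in> W" using that by (simp add: W_def)
    show "[:- tt e0, 1:] ^ 1 dvd R"
    proof (cases "p \<in> X")
      case False
      thus ?thesis using simple[OF eW] passes_off[OF P(1)] passes_off[OF P(2)] by (simp add: e0_def)
    next
      case True
      hence px: "p = x" using that by (simp add: ex_def)
      have d: "ord_ge 3 F a d" "ord_ge 2 G a d" using isC_over[OF F P(1) True] isC_over[OF G P(2) True] px xy by (simp_all add: a_def)
      define w where "w = b + tt d *s c"
      have dd: "d = xx d *s a + yy d *s w" "yy d \<noteq> 0" using co[of d] eW True by (simp_all add: w_def e0_def)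
      have w: "w = (- xx d / yy d) *s a + (1 / yy d) *s d"
        using dd by (simp add: vec3_eq_iff field_simps)
      have "ord_ge 3 F (1 *s a) w" "ord_ge 2 G (1 *s a) w"
        unfolding w by (intro ord_ge_in_span[OF hF(1) d(1)] ord_ge_in_span[OF hG(1) d(2)])+
      hence "eval3 H w = 0" "eval3 L w = 0" by (auto simp: alF alG ord_ge_iff less_Suc_eq eval_nat_numeral)
      hence "poly R (tt d) = 0" by (simp add: R_def cub_res_def poly_along w_def)
      thus ?thesis using True by (simp add: e0_def flip: poly_eq_0_iff_dvd)
    qed
    show "tt e0 \<notin> (\<lambda>s. tt (rep s)) ` (X - {x})"
    proof
      assume "tt e0 \<in> (\<lambda>s. tt (rep s)) ` (X - {x})"
      then obtain s where s: "s \<in> X - {x}" "tt e0 = tt (rep s)" by blast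
      have col: "d3 a e0 (rep s) = 0" using ttD[OF eW, of "rep s"] s by (auto simp: W_def)
      show False
      proof (cases "p \<in> X")
        case False
        have ne: "x \<noteq> p" "x \<noteq> s" "p \<noteq> s" using False s hF(2) by auto
        have "d3 (rep x) (rep s) (rep p) = 0" using col False d3_swap'[of a "rep s" "rep p"] by (simp add: e0_def a_def)
        then obtain u v where uv: "rep p = u *s rep x + v *s rep s" "u \<noteq> 0" "v \<noteq> 0"
          using third_point_coords[OF ne(2,1)] ne by metis
        have "eval3 F (u' *s rep x + v' *s rep s) = 0" for u' v'
          by (rule line_bezout3[OF hF(1), of 2 _ _ 1 u v]) (use hF s uv passes_off[OF P(1) False] in auto)
        thus False using nolineD[OF nol rep_indep[OF ne(2)]] by blast
      next
        case True
        hence px: "p = x" using that by (simp add: ex_def)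
        have "ord_ge 3 F (rep x) d" "cr (rep x) d \<noteq> 0" using isC_over[OF F P(1) True] px by auto
        hence "ord_ge 3 F (rep x) (rep s)"
          using ord_ge_other_direction[OF hF(1)] col True by (simp add: e0_def a_def)
        thus False using isC_not_triple[OF F, of s] s by auto
      qed
    qed
  qed
  have pd: "[:- tt (rep p), 1:] ^ 2 dvd R" if "\<not> ex"
  proof -
    have pX: "p \<in> X" "p \<noteq> x" using that by (auto simp: ex_def)
    have f: "ord_ge 2 F (rep p) d" "ord_ge 2 G (rep p) d" "cr (rep p) d \<noteq> 0"
      using isC_over[OF F P(1) pX(1)] isC_over[OF G P(2) pX(1)] pX(2) py by auto
    have pW: "rep p \<in> W" using pX by (auto simp: W_def)
    define q where "q = (1 / yy (rep p)) *s rep p"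
    have q: "q = (xx (rep p) / yy (rep p)) *s a + (b + tt (rep p) *s c)" using scaled[OF pW] by (simp add: q_def)
    obtain d1 d2 d3' where dc: "d = d1 *s a + d2 *s b + d3' *s c" using basis_coordsE[OF bas] by blast
    define z where "z = d3' - d2 * tt (rep p)"
    have dq: "d - d2 *s q = (d1 - d2 * (xx (rep p) / yy (rep p))) *s a + z *s c"
      by (simp add: dc q z_def vec3_eq_iff algebra_simps)
    \<comment> \<open>\<open>z\<close> measures how far the tangent direction leaves the line from
      \<open>p\<close> to \<open>x\<close>; if it vanished, that line would meet \<open>F\<close>
      four times.\<close>
    have "z \<noteq> 0"
    proof
      assume "z = 0"
      hence "d = (d2 / yy (rep p)) *s rep p + (d1 - d2 * (xx (rep p) / yy (rep p))) *s a"
        using dq by (simp add: q_def algebra_simps)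
      hence "d3 (rep p) d a = 0" by simp
      hence fa: "ord_ge 2 F (rep p) (rep x)" using ord_ge_other_direction[OF hF(1) f(1,3)] by (simp add: a_def)
      have "eval3 F (u *s rep p + v *s rep x) = 0" for u v
        by (rule line_bezout[OF hF(1) fa hF(3)]) simp
      thus False using nolineD[OF nol rep_indep[OF pX(2)]] by blast
    qed
    define u' where "u' = (d1 - d2 * (xx (rep p) / yy (rep p))) / z"
    have e: "u' *s a + c = (- d2 / (z * yy (rep p))) *s rep p + (1 / z) *s d"
    proof -
      have "u' *s a + c = (1 / z) *s (d - d2 *s q)" unfolding dq u'_def using \<open>z \<noteq> 0\<close>
        by (simp add: vec3_eq_iff field_simps)
      thus ?thesis by (simp add: q_def vec3_eq_iff algebra_simps)
    qed
    show ?thesis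
      by (rule path[of 2 "xx (rep p) / yy (rep p)" _ u'])
        (unfold q[symmetric] e, unfold q_def, (intro ord_ge_in_span[OF hF(1) f(1)] ord_ge_in_span[OF hG(1) f(2)])+)
  qed
  have "R = 0"
  proof (rule ccontr)
    assume R: "R \<noteq> 0"
    define T where "T = (\<lambda>s. tt (rep s)) ` (X - {x})"
    \<comment> \<open>Eight zeros against degree 7: the six points other than \<open>x\<close>, a
      second zero at \<open>y\<close>, and one for the common point, either at a new parameter or as
      a second zero at \<open>p\<close>.\<close>
    define o' where "o' = (\<lambda>t. if t = tt (rep y) \<or> \<not> ex \<and> t = tt (rep p) then 2 else 1 :: nat)"
    have T: "finite T" using finX by (simp add: T_def)
    have od: "[:- t, 1:] ^ o' t dvd R" if "t \<in> T \<union> (if ex then {tt e0} else {})" for t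
    proof -
      have "[:- t, 1:] ^ 1 dvd R" using that zs exR by (auto simp: T_def split: if_splits)
      thus ?thesis using double pd by (auto simp: o'_def)
    qed
    have y': "y \<in> X - {x}" using hG(2) xy by auto
    have "(\<Sum>t\<in>T. o' t) = (\<Sum>s\<in>X - {x}. o' (tt (rep s)))" unfolding T_def by (rule sum.reindex_cong[OF inj]) auto
    also have "\<dots> = (\<Sum>s\<in>X - {x}. if s = y \<or> \<not> ex \<and> s = p then 2 else 1)"
    proof (rule sum.cong)
      fix s assume s: "s \<in> X - {x}"
      have "tt (rep s) = tt (rep y) \<longleftrightarrow> s = y" using inj s y' by (auto dest: inj_onD)
      moreover have "\<not> ex \<longrightarrow> p \<in> X - {x}" by (auto simp: ex_def)
      hence "\<not> ex \<Longrightarrow> tt (rep s) = tt (rep p) \<longleftrightarrow> s = p" using inj s by (auto dest: inj_onD)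
      ultimately show "o' (tt (rep s)) = (if s = y \<or> \<not> ex \<and> s = p then 2 else 1)" by (auto simp: o'_def)
    qed simp
    also have "\<dots> = (\<Sum>s\<in>X - {x}. 1 + (if s = y then 1 else 0) + (if \<not> ex \<and> s = p then 1 else 0))"
      by (rule sum.cong) (use py in auto)
    also have "\<dots> = 6 + 1 + (if ex then 0 else 1)"
    proof -
      have "\<not> ex \<longrightarrow> p \<in> X - {x}" by (auto simp: ex_def)
      thus ?thesis using y' hF(2) finX cardX unfolding sum.distrib by (cases ex) simp_all
    qed
    finally have sT: "(\<Sum>t\<in>T. o' t) = 7 + (if ex then 0 else 1)" by simp
    have "(\<Sum>t\<in>T \<union> (if ex then {tt e0} else {}). o' t) \<ge> 8"
    proof (cases ex)
      case True
      hence "(\<Sum>t\<in>T \<union> (if ex then {tt e0} else {}). o' t) = o' (tt e0) + (\<Sum>t\<in>T. o' t)"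
        using exR T by (simp add: T_def)
      thus ?thesis using sT True by (simp add: o'_def)
    qed (use sT in simp)
    moreover have "(\<Sum>t\<in>T \<union> (if ex then {tt e0} else {}). o' t) \<le> degree R"
      by (rule sum_root_orders_le[OF R]) (use T od in auto)
    moreover have "degree R \<le> 7"
    proof -
      have dg: "degree (along H b c) \<le> 2" "degree (along F b c) \<le> 3" "degree (along L b c) \<le> 1"
        "degree (along N b c) \<le> 2" "degree (along G b c) \<le> 3"
        using degree_along LH(1) hF(1) L N hG(1) by blast+
      have m3: "degree (f * g * h) \<le> degree f + degree g + degree h" for f g h :: "complex poly"
        using degree_mult_le[of "f * g" h] degree_mult_le[of f g] by linarith
      show ?thesis unfolding R_def cub_res_def
        using dg by (intro degree_add_le degree_diff_le order.trans[OF m3]) linarith+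
    qed
    ultimately show False by linarith
  qed
  have "coeff (along H b c) 2 = eval3 H c"
    using along_rev[OF LH(1), of 2 b c] by (simp add: coeff_along_0)
  hence degH: "degree (along H b c) = 2" using c(1) degree_along[OF LH(1), of b c] le_degree[of "along H b c" 2] by simp
  \<comment> \<open>As \<open>F\<close> contains no line through \<open>x\<close>, its two
    coefficients in the projection have no common zero; hence \<open>L = 0\<close>, and
    \<open>G\<close> would be singular at \<open>x\<close>, too.\<close>
  have Lp: "along L b c = 0"
  proof (rule cub_res_eq_0D)
    show "cub_res (along H b c) (along F b c) (along L b c) (along N b c) (along G b c) = 0"
      using \<open>R = 0\<close> by (simp add: R_def)
    show "poly (along F b c) t \<noteq> 0" if "poly (along H b c) t = 0" for t
      using FH[OF basis_w[OF bas, of t]] that by (simp add: poly_along)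
  qed (use degH degree_along[OF L] in auto)
  have "eval3 L b = 0" using Lp coeff_along_0[of L b c] by simp
  moreover have "eval3 L c = 0" using Lp along_rev[OF L, of 1 b c] coeff_along_0[of L c b] by simp
  moreover have "eval3 L a = 0" using eG[of 1 1 a] eG[of 1 "-1" a] eval3_scale[OF hG(1), of 2 a] a(3) eval3_zero_vec[OF hG(1)]
  proof -
    have "eval3 L a + eval3 N a = 0" using eG[of 1 1 a] eval3_scale[OF hG(1), of 2 a] a(3)
      by (simp add: vector_sadd_rdistrib[of 1 1 a, simplified, symmetric])
    moreover have "- eval3 L a + eval3 N a = 0" using eG[of 1 "-1" a] a(3) eval3_zero_vec[OF hG(1)] by simp
    ultimately show ?thesis by (simp add: add_eq_0_iff)
  qed
  ultimately have "L = 0" using linear_form_eq_0[OF bas L] by blast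
  hence "ord_ge 2 G (rep x) w" for w using alG[of w] by (simp add: ord_ge_iff a_def less_2_cases_iff)
  thus False using isC_simple[OF G hF(2) xy] by blast
qed

text \<open>The resultant count requires that the common point is not over the double point of the
  second cubic. It lies over at most one of \<open>x\<close> and \<open>y\<close>, so the roles can
  be exchanged.\<close>

lemma isC_isC_eq:
  assumes F: "isC X F x" and G: "isC X G y" and P: "passes X F p d" "passes X G p d"
  shows "x = y"
  using isC_isC_distinct[OF F G _ P] isC_isC_distinct[OF G F _ P(2,1)] by metis

end

subsection \<open>Configurations of four pairwise meeting (-1)-classes\<close>

datatype cls = clE ppoint | clL "ppoint set" | clQ "ppoint set" | clC ppoint

fun cls_valid :: "ppoint set \<Rightarrow> cls \<Rightarrow> bool" where
  "cls_valid X (clE x) \<longleftrightarrow> x \<in> X"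
| "cls_valid X (clL S) \<longleftrightarrow> S \<subseteq> X \<and> card S = 2"
| "cls_valid X (clQ S) \<longleftrightarrow> S \<subseteq> X \<and> card S = 2"
| "cls_valid X (clC x) \<longleftrightarrow> x \<in> X"

text \<open>Two distinct classes meet if their intersection number is positive. Only pairs in the order
  E, L, Q, C are constrained; the pairs in reverse order are covered by \<open>True\<close>.\<close>

fun cls_meet :: "cls \<Rightarrow> cls \<Rightarrow> bool" where
  "cls_meet (clE x) (clE y) \<longleftrightarrow> False"
| "cls_meet (clE x) (clL S) \<longleftrightarrow> x \<in> S"
| "cls_meet (clE x) (clQ S) \<longleftrightarrow> x \<notin> S"
| "cls_meet (clL S) (clL T) \<longleftrightarrow> S \<inter> T = {}"
| "cls_meet (clL S) (clQ T) \<longleftrightarrow> S \<inter> T \<noteq> {}"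
| "cls_meet (clL S) (clC x) \<longleftrightarrow> x \<notin> S"
| "cls_meet (clQ S) (clQ T) \<longleftrightarrow> S \<inter> T = {}"
| "cls_meet (clQ S) (clC x) \<longleftrightarrow> x \<in> S"
| "cls_meet (clC x) (clC y) \<longleftrightarrow> False"
| "cls_meet _ _ \<longleftrightarrow> True"

lemma disjoint_pairs_card:
  assumes "finite X" "card X = 7" "\<And>S. S \<in> A \<Longrightarrow> S \<subseteq> X \<and> card S = 2"
    "\<And>S T. S \<in> A \<Longrightarrow> T \<in> A \<Longrightarrow> S \<noteq> T \<Longrightarrow> S \<inter> T = {}"
  shows "finite A" "card A \<le> 3"
proof -
  show "finite A" using assms(1,3) by (meson finite_Pow_iff finite_subset PowI subsetI)
  have "finite S" if "S \<in> A" for S using assms(3)[OF that] assms(1) finite_subset by blast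
  hence "card (\<Union>A) = sum card A"
    using assms(4) by (intro card_Union_disjoint) (auto simp: pairwise_def disjnt_def)
  also have "\<dots> = (\<Sum>S\<in>A. 2)" by (rule sum.cong) (use assms in auto)
  finally have "2 * card A = card (\<Union>A)" by simp
  also have "\<dots> \<le> card X" using assms by (intro card_mono) auto
  finally show "card A \<le> 3" using assms(2) by simp
qed

lemma disjoint_meeting_card:
  assumes "finite A" "\<And>S T. S \<in> A \<Longrightarrow> T \<in> A \<Longrightarrow> S \<noteq> T \<Longrightarrow> S \<inter> T = {}" "finite B" "\<And>S. S \<in> A \<Longrightarrow> S \<inter> B \<noteq> {}"
  shows "card A \<le> card B"
proof -
  have "\<forall>S\<in>A. \<exists>x. x \<in> S \<inter> B" using assms(4) by blast
  then obtain f where f: "\<And>S. S \<in> A \<Longrightarrow> f S \<in> S \<inter> B" by metis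
  have "inj_on f A" using f assms(2) by (intro inj_onI) (metis IntD1 IntI empty_iff)
  thus ?thesis using f assms(3) by (intro card_inj_on_le[of f]) auto
qed

lemma pair_through:
  assumes "card S = 2" "x \<in> S" obtains y where "S = {x, y}" "y \<noteq> x"
  using assms by (metis card_2_iff insertE insert_commute singletonD)

text \<open>At most one E and one C occur, and lines, like conics, belong to disjoint pairs, hence
  at most three of each. \<open>clE x\<close> puts \<open>x\<close> on every line, so there is at
  most one line; dually, \<open>clC x\<close> allows at most one conic. Without E and C every line
  pair meets every conic pair, which leaves two of each.\<close>

lemma four_classes:
  assumes X: "finite X" "card X = 7" and K: "card K = 4"
    and valid0: "\<forall>k\<in>K. cls_valid X k"
    and meet0: "\<forall>k\<in>K. \<forall>k'\<in>K. k \<noteq> k' \<longrightarrow> cls_meet k k'"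
  shows "(\<exists>x y z. distinct [x, y, z] \<and> {x, y, z} \<subseteq> X \<and> {clE x, clL {x, y}, clQ {y, z}, clC z} \<subseteq> K) \<or>
    (\<exists>x S T U. x \<in> X - S - T - U \<and> S \<inter> T = {} \<and> S \<inter> U = {} \<and> T \<inter> U = {} \<and> {clE x, clQ S, clQ T, clQ U} \<subseteq> K) \<or>
    (\<exists>x S T U. x \<in> X - S - T - U \<and> S \<inter> T = {} \<and> S \<inter> U = {} \<and> T \<inter> U = {} \<and> {clC x, clL S, clL T, clL U} \<subseteq> K) \<or>
    (\<exists>x y z w. distinct [x, y, z, w] \<and> {x, y, z, w} \<subseteq> X \<and> {clL {x, y}, clL {z, w}, clQ {y, w}, clQ {x, z}} \<subseteq> K)"
  (is "?A \<or> ?B \<or> ?C \<or> ?D")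
proof -
  note valid = bspec[OF valid0]
  have meet: "cls_meet k k'" if "k \<in> K" "k' \<in> K" "k \<noteq> k'" for k k' using meet0 that by blast
  define KE where "KE = {x. clE x \<in> K}"
  define KL where "KL = {S. clL S \<in> K}"
  define KQ where "KQ = {S. clQ S \<in> K}"
  define KC where "KC = {x. clC x \<in> K}"
  have vE: "x \<in> X" if "x \<in> KE" for x using valid[of "clE x"] that by (simp add: KE_def)
  have vC: "x \<in> X" if "x \<in> KC" for x using valid[of "clC x"] that by (simp add: KC_def)
  have vL: "S \<subseteq> X \<and> card S = 2" if "S \<in> KL" for S using valid[of "clL S"] that by (simp add: KL_def)
  have vQ: "S \<subseteq> X \<and> card S = 2" if "S \<in> KQ" for S using valid[of "clQ S"] that by (simp add: KQ_def)
  have mEE: "x = y" if "x \<in> KE" "y \<in> KE" for x y using meet[of "clE x" "clE y"] that by (auto simp: KE_def)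
  have mCC: "x = y" if "x \<in> KC" "y \<in> KC" for x y using meet[of "clC x" "clC y"] that by (auto simp: KC_def)
  have mEL: "x \<in> S" if "x \<in> KE" "S \<in> KL" for x S using meet[of "clE x" "clL S"] that by (auto simp: KE_def KL_def)
  have mEQ: "x \<notin> S" if "x \<in> KE" "S \<in> KQ" for x S using meet[of "clE x" "clQ S"] that by (auto simp: KE_def KQ_def)
  have mLL: "S \<inter> T = {}" if "S \<in> KL" "T \<in> KL" "S \<noteq> T" for S T using meet[of "clL S" "clL T"] that by (auto simp: KL_def)
  have mQQ: "S \<inter> T = {}" if "S \<in> KQ" "T \<in> KQ" "S \<noteq> T" for S T using meet[of "clQ S" "clQ T"] that by (auto simp: KQ_def)
  have mLQ: "S \<inter> T \<noteq> {}" if "S \<in> KL" "T \<in> KQ" for S T using meet[of "clL S" "clQ T"] that by (auto simp: KL_def KQ_def)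
  have mLC: "x \<notin> S" if "x \<in> KC" "S \<in> KL" for x S using meet[of "clL S" "clC x"] that by (auto simp: KC_def KL_def)
  have mQC: "x \<in> S" if "x \<in> KC" "S \<in> KQ" for x S using meet[of "clQ S" "clC x"] that by (auto simp: KC_def KQ_def)
  have fE: "finite KE" and fC: "finite KC" using vE vC X finite_subset by (meson subsetI)+
  note L3 = disjoint_pairs_card[of X KL, OF X vL mLL] and Q3 = disjoint_pairs_card[of X KQ, OF X vQ mQQ]
  have e1: "card KE \<le> 1" and c1: "card KC \<le> 1"
    using mEE mCC fE fC by (simp_all add: card_le_Suc0_iff_eq)
  have "K = (clE ` KE \<union> clC ` KC) \<union> (clL ` KL \<union> clQ ` KQ)"
  proof (rule set_eqI)
    fix k show "k \<in> K \<longleftrightarrow> k \<in> (clE ` KE \<union> clC ` KC) \<union> (clL ` KL \<union> clQ ` KQ)"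
      by (cases k) (auto simp: KE_def KC_def KL_def KQ_def)
  qed
  hence "card K = card ((clE ` KE \<union> clC ` KC) \<union> (clL ` KL \<union> clQ ` KQ))" by simp
  also have "\<dots> = card (clE ` KE) + card (clC ` KC) + (card (clL ` KL) + card (clQ ` KQ))"
    using fE fC L3(1) Q3(1) by (subst card_Un_disjoint; (subst card_Un_disjoint)?; (subst card_Un_disjoint)?; auto)
  also have "\<dots> = card KE + card KC + card KL + card KQ"
    by (simp add: card_image inj_on_def)
  finally have total: "card KE + card KC + card KL + card KQ = 4" using K by simp
  have Lthree: "\<exists>S T U. {S, T, U} \<subseteq> KL \<and> S \<inter> T = {} \<and> S \<inter> U = {} \<and> T \<inter> U = {}" if "card KL = 3"
    using that mLL unfolding card_3_iff by (metis insertI1 insert_commute order_refl)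
  have Qthree: "\<exists>S T U. {S, T, U} \<subseteq> KQ \<and> S \<inter> T = {} \<and> S \<inter> U = {} \<and> T \<inter> U = {}" if "card KQ = 3"
    using that mQQ unfolding card_3_iff by (metis insertI1 insert_commute order_refl)
  have EL: "card KL \<le> 1" if "x \<in> KE" for x
    using disjoint_meeting_card[OF L3(1) mLL, where B = "{x}"] mEL[OF that] by auto
  have CQ: "card KQ \<le> 1" if "x \<in> KC" for x
    using disjoint_meeting_card[OF Q3(1) mQQ, where B = "{x}"] mQC[OF that] by auto
  \<comment> \<open>The conic pairs avoid \<open>x\<close> but meet \<open>{x, y}\<close>, so all of
    them contain \<open>y\<close>; being disjoint, there is at most one. \<open>CQL\<close> is the
    same after exchanging E with C and lines with conics.\<close>
  have ELQ: "card KQ \<le> 1" if xS: "x \<in> KE" "S \<in> KL" for x S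
  proof -
    obtain y where "S = {x, y}" "y \<noteq> x" using pair_through[of S x] mEL[OF xS] vL[OF xS(2)] by metis
    thus ?thesis using disjoint_meeting_card[OF Q3(1) mQQ, where B = "{y}"] mEQ[OF xS(1)] mLQ[OF xS(2)] by auto
  qed
  have CQL: "card KL \<le> 1" if xS: "x \<in> KC" "S \<in> KQ" for x S
  proof -
    obtain y where "S = {x, y}" "y \<noteq> x" using pair_through[of S x] mQC[OF xS] vQ[OF xS(2)] by metis
    thus ?thesis using disjoint_meeting_card[OF L3(1) mLL, where B = "{y}"] mLC[OF xS(1)] mLQ[OF _ xS(2)] by auto
  qed
  have ne: "A \<noteq> {} \<Longrightarrow> \<exists>a. a \<in> A" for A :: "'a set" by blast
  consider "KE \<noteq> {}" "KC \<noteq> {}" | "KE \<noteq> {}" "KC = {}" | "KE = {}" "KC \<noteq> {}" | "KE = {}" "KC = {}" by blast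
  thus ?thesis
  proof cases
    case 1
    then obtain x z where xz: "x \<in> KE" "z \<in> KC" by blast
    have "card KL = 1" "card KQ = 1" using total e1 c1 EL[OF xz(1)] CQ[OF xz(2)] by linarith+
    then obtain S T where ST: "S \<in> KL" "T \<in> KQ" by (metis card_1_singletonE insertI1)
    obtain y where y: "S = {x, y}" "y \<noteq> x" using pair_through[of S x] mEL[OF xz(1) ST(1)] vL[OF ST(1)] by metis
    have "z \<in> T" "x \<notin> T" "z \<notin> S" using mQC[OF xz(2) ST(2)] mEQ[OF xz(1) ST(2)] mLC[OF xz(2) ST(1)] by auto
    moreover have "y \<in> T" using mLQ[OF ST] y calculation by auto
    moreover obtain z' where "T = {y, z'}" "z' \<noteq> y" using pair_through[of T y] vQ[OF ST(2)] calculation by metis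
    ultimately have Tyz: "T = {y, z}" "z \<noteq> y" using y by auto
    have B0: "distinct [x, y, z] \<and> {x, y, z} \<subseteq> X \<and> {clE x, clL {x, y}, clQ {y, z}, clC z} \<subseteq> K"
    proof -
      have "x \<in> X" "y \<in> X" "z \<in> X" using vE[OF xz(1)] vC[OF xz(2)] vL[OF ST(1)] y(1) by auto
      moreover have "z \<noteq> x" using \<open>z \<notin> S\<close> y(1) by blast
      moreover have "clE x \<in> K" "clC z \<in> K" "clL {x, y} \<in> K" "clQ {y, z} \<in> K"
        using xz ST Tyz(1) y(1) by (simp_all add: KE_def KL_def KQ_def KC_def)
      ultimately show ?thesis using y(2) Tyz(2) by simp
    qed
    have ?A by (rule exI[of _ x], rule exI[of _ y], rule exI[of _ z], rule B0)
    thus ?thesis by (rule disjI1)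
  next
    case 2
    then obtain x where x: "x \<in> KE" by blast
    have "card KL = 0"
    proof (rule ccontr)
      assume "card KL \<noteq> 0"
      then obtain S where "S \<in> KL" by fastforce
      thus False using ELQ[OF x] EL[OF x] total e1 2 by force
    qed
    hence "card KQ = 3" using total e1 Q3(2) 2 by simp
    then obtain S T U where STU0: "{S, T, U} \<subseteq> KQ" "S \<inter> T = {}" "S \<inter> U = {}" "T \<inter> U = {}" using Qthree by blast
    have B0: "x \<in> X - S - T - U \<and> S \<inter> T = {} \<and> S \<inter> U = {} \<and> T \<inter> U = {} \<and> {clE x, clQ S, clQ T, clQ U} \<subseteq> K"
    proof -
      have STU: "S \<in> KQ" "T \<in> KQ" "U \<in> KQ" using STU0(1) by simp_all
      hence "clE x \<in> K" "clQ S \<in> K" "clQ T \<in> K" "clQ U \<in> K" using x by (simp_all add: KE_def KQ_def)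
      thus ?thesis using vE[OF x] mEQ[OF x STU(1)] mEQ[OF x STU(2)] mEQ[OF x STU(3)] STU0(2-4) by blast
    qed
    have ?B by (rule exI[of _ x], rule exI[of _ S], rule exI[of _ T], rule exI[of _ U], rule B0)
    thus ?thesis by (rule disjI2[OF disjI1])
  next
    case 3
    then obtain x where x: "x \<in> KC" by blast
    have "card KQ = 0"
    proof (rule ccontr)
      assume "card KQ \<noteq> 0"
      then obtain S where "S \<in> KQ" by fastforce
      thus False using CQL[OF x] CQ[OF x] total c1 3 by force
    qed
    hence "card KL = 3" using total c1 L3(2) 3 by simp
    then obtain S T U where STU0: "{S, T, U} \<subseteq> KL" "S \<inter> T = {}" "S \<inter> U = {}" "T \<inter> U = {}" using Lthree by blast
    have B0: "x \<in> X - S - T - U \<and> S \<inter> T = {} \<and> S \<inter> U = {} \<and> T \<inter> U = {} \<and> {clC x, clL S, clL T, clL U} \<subseteq> K"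
    proof -
      have STU: "S \<in> KL" "T \<in> KL" "U \<in> KL" using STU0(1) by simp_all
      hence "clC x \<in> K" "clL S \<in> K" "clL T \<in> K" "clL U \<in> K" using x by (simp_all add: KC_def KL_def)
      thus ?thesis using vC[OF x] mLC[OF x STU(1)] mLC[OF x STU(2)] mLC[OF x STU(3)] STU0(2-4) by blast
    qed
    have ?C by (rule exI[of _ x], rule exI[of _ S], rule exI[of _ T], rule exI[of _ U], rule B0)
    thus ?thesis by (rule disjI2[OF disjI2[OF disjI1]])
  next
    case 4
    hence LQ4: "card KL + card KQ = 4" using total by simp
    have "card KL \<noteq> 0" "card KQ \<noteq> 0" using LQ4 L3(2) Q3(2) by linarith+
    then obtain S0 T0 where ST0: "S0 \<in> KL" "T0 \<in> KQ" by fastforce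
    have fin: "finite S0" "finite T0" using vL[OF ST0(1)] vQ[OF ST0(2)] X finite_subset by blast+
    have "card KL \<le> 2" using disjoint_meeting_card[OF L3(1) mLL fin(2)] mLQ[OF _ ST0(2)] vQ[OF ST0(2)] by simp
    moreover have "card KQ \<le> 2"
      using disjoint_meeting_card[OF Q3(1) mQQ fin(1)] mLQ[OF ST0(1)] vL[OF ST0(1)] by (simp add: Int_commute)
    ultimately have "card KL = 2" "card KQ = 2" using LQ4 by linarith+
    then obtain S S' T T' where ST: "S \<in> KL" "S' \<in> KL" "S \<noteq> S'" "T \<in> KQ" "T' \<in> KQ" "T \<noteq> T'"
      by (metis card_2_iff insertCI)
    obtain y w where "y \<in> S \<inter> T" "w \<in> S' \<inter> T" using mLQ ST by blast
    obtain x where S: "S = {y, x}" "x \<noteq> y" using pair_through[of S y] vL[OF ST(1)] \<open>y \<in> S \<inter> T\<close> by blast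
    obtain z where S': "S' = {w, z}" "z \<noteq> w" using pair_through[of S' w] vL[OF ST(2)] \<open>w \<in> S' \<inter> T\<close> by blast
    have disj: "S \<inter> S' = {}" "T \<inter> T' = {}" using mLL mQQ ST by blast+
    have "y \<noteq> w" using S S' disj by auto
    have T: "T = {y, w}" using pair_through[of T y] vQ[OF ST(4)] \<open>y \<in> S \<inter> T\<close> \<open>w \<in> S' \<inter> T\<close> \<open>y \<noteq> w\<close> by (metis IntD2 insertE singletonD)
    have "x \<in> T'" "z \<in> T'" using mLQ[OF ST(1,5)] mLQ[OF ST(2,5)] S S' T disj by auto
    moreover have "x \<noteq> z" using S S' disj by auto
    ultimately have T': "T' = {x, z}" using pair_through[of T' x] vQ[OF ST(5)] by (metis insertE singletonD)
    have D1: "{clL {x, y}, clL {z, w}, clQ {y, w}, clQ {x, z}} \<subseteq> K"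
      using ST S S' T T' by (auto simp: KL_def KQ_def insert_commute)
    have D2: "distinct [x, y, z, w]" using S S' disj T T' by auto
    have D3: "{x, y, z, w} \<subseteq> X" using S S' vL[OF ST(1)] vL[OF ST(2)] by simp
    have ?D by (rule exI[of _ x], rule exI[of _ y], rule exI[of _ z], rule exI[of _ w], intro conjI D1 D2 D3)
    thus ?thesis by (rule disjI2[OF disjI2[OF disjI2]])
  qed
qed

subsection \<open>Recognising the three constructions\<close>

definition labelling :: "ppoint list \<Rightarrow> nat \<Rightarrow> ppoint" where "labelling xs i = xs ! (i - 1)"

lemma labelling_simps [simp]:
  "labelling [x1, x2, x3, x4, x5, x6, x7] 1 = x1" "labelling [x1, x2, x3, x4, x5, x6, x7] 2 = x2"
  "labelling [x1, x2, x3, x4, x5, x6, x7] 3 = x3" "labelling [x1, x2, x3, x4, x5, x6, x7] 4 = x4"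
  "labelling [x1, x2, x3, x4, x5, x6, x7] 5 = x5" "labelling [x1, x2, x3, x4, x5, x6, x7] 6 = x6"
  "labelling [x1, x2, x3, x4, x5, x6, x7] 7 = x7" "labelling [x1, x2, x3, x4, x5, x6, x7] (Suc 0) = x1"
  by (simp_all add: labelling_def)

lemma labelling_bij:
  assumes "distinct xs" "length xs = 7" "set xs = X"
  shows "bij_betw (labelling xs) {1..7} X"
proof -
  have "bij_betw (\<lambda>i. i - 1) {1..7::nat} {..<7}"
    by (rule bij_betwI[of _ _ _ Suc]) auto
  moreover have "bij_betw ((!) xs) {..<7} X" using bij_betw_nth[of xs "{..<7}" X] assms by simp
  ultimately have "bij_betw ((!) xs \<circ> (\<lambda>i. i - 1)) {1..7} X" by (rule bij_betw_trans)
  thus ?thesis by (simp add: labelling_def[abs_def] comp_def)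
qed

lemma labelling_admissible:
  assumes "distinct xs" "length xs = 7" "set xs = X" "del_pezzo_blowup X"
  shows "admissible (labelling xs)"
  using labelling_bij[OF assms(1-3)] assms(4) by (simp add: admissible_def bij_betw_def)

context dp2
begin

lemma smooth_with_tangentI:
  assumes "homogeneous k F" "mult_at F x = 1" "ord_ge 2 F (rep x) d" "cr (rep x) d \<noteq> 0" "on_line x t" "d \<in> Rep_pline t"
  shows "smooth_with_tangent F x t"
  using tangent_lines_iff[OF assms(1,6,4,5,2)] assms by (simp add: smooth_with_tangent_def numeral_2_eq_2)

text \<open>A fifth common zero would make the conics proportional, but they omit different pairs of
  points.\<close>

lemma isQ_isQ_inter:
  assumes F: "isQ X F S" and G: "isQ X G T" and ST: "S \<noteq> T" and R: "card R = 4" "R \<subseteq> zeros F \<inter> zeros G"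
  shows "zeros F \<inter> zeros G = R"
proof (rule antisym[OF _ R(2)], rule subsetI, rule ccontr)
  fix r assume r: "r \<in> zeros F \<inter> zeros G" "r \<notin> R"
  have h: "homogeneous 2 F" "homogeneous 2 G" using F G by (auto simp: isQ_def)
  have "finite R" using R(1) card.infinite by fastforce
  hence c5: "card (insert r R) = 5" using R r by simp
  obtain k where "G = cst k * F"
    by (rule conics_5_points[OF h(1) isQ_noline[OF F] h(2) c5])
      (use R r in \<open>auto simp: zeros_iff[OF h(1)] zeros_iff[OF h(2)]\<close>)
  thus False using isQ_proportional_eq[OF F G] ST by blast
qed

lemma isQ_isQ_inter_tangent:
  assumes F: "isQ X F S" and G: "isQ X G T" and ST: "S \<noteq> T" and R: "card R = 3" "R \<subseteq> zeros F \<inter> zeros G"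
    and x: "x \<in> R" "cr (rep x) d \<noteq> 0" "ord_ge 2 F (rep x) d" "ord_ge 2 G (rep x) d"
  shows "zeros F \<inter> zeros G = R"
proof (rule antisym[OF _ R(2)], rule subsetI, rule ccontr)
  fix r assume r: "r \<in> zeros F \<inter> zeros G" "r \<notin> R"
  have h: "homogeneous 2 F" "homogeneous 2 G" using F G by (auto simp: isQ_def)
  have "finite R" using R(1) card.infinite by fastforce
  hence c4: "card (insert r R) = 4" using R r by simp
  obtain k where "G = cst k * F"
    by (rule conics_4_points_tangent[OF h(1) isQ_noline[OF F] h(2) c4, of x d])
      (use R r x in \<open>auto simp: zeros_iff[OF h(1)] zeros_iff[OF h(2)]\<close>)
  thus False using isQ_proportional_eq[OF F G] ST by blast
qed

lemma isQ_zeros: "isQ X F S \<Longrightarrow> x \<in> X \<Longrightarrow> x \<notin> S \<Longrightarrow> x \<in> zeros F"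
  using zeros_iff[of 2 F x] by (auto simp: isQ_def)

lemma construction_aI:
  assumes xs: "distinct [x1, x2, x3, x4, x5, x6, x7]" "X = {x1, x2, x3, x4, x5, x6, x7}" and dp: "del_pezzo_blowup X"
    and L: "isL X F1 {x1, x2}" "isL X F2 {x3, x4}" and Q: "isQ X s1 {x2, x4}" "isQ X s2 {x1, x3}"
    and q: "eval3 F1 (rep q) = 0" "eval3 F2 (rep q) = 0" "eval3 s1 (rep q) = 0" "eval3 s2 (rep q) = 0"
  shows "construction_a (labelling [x1, x2, x3, x4, x5, x6, x7])"
proof -
  \<comment> \<open>A point of \<open>X\<close> on the first line lies in \<open>{x1, x2}\<close>,
    on the second in \<open>{x3, x4}\<close>.\<close>
  have qX: "q \<notin> X" using isL_off[OF L(1), of q] isL_off[OF L(2), of q] q xs(1) by auto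
  have qL: "q \<in> zeros s1 \<inter> zeros s2" using q Q zeros_iff[of 2 s1 q] zeros_iff[of 2 s2 q] by (auto simp: isQ_def)
  have lin: "d3 (rep x) (rep y) (rep q) = 0" if "isL X F {x, y}" "eval3 F (rep q) = 0" for F x y
    using that linear_form_eq_0[of "rep x" "rep y" "rep q" F] by (auto simp: isL_def)
  define t1 where "t1 = pl (rep x1) (rep x2)"
  define t2 where "t2 = pl (rep x3) (rep x4)"
  have R1: "Rep_pline t1 = {v. d3 (rep x1) (rep x2) v = 0}" unfolding t1_def by (rule Rep_pl[OF rep_indep]) (use xs in auto)
  have R2: "Rep_pline t2 = {v. d3 (rep x3) (rep x4) v = 0}" unfolding t2_def by (rule Rep_pl[OF rep_indep]) (use xs in auto)
  have "d3 (rep x3) (rep x4) (rep x1) \<noteq> 0" by (rule nocolD[OF nc]) (use xs in auto)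
  hence "t1 \<noteq> t2" using R1 R2 by auto
  moreover have "zeros s1 \<inter> zeros s2 = {q, x5, x6, x7}"
  proof (rule isQ_isQ_inter[OF Q])
    show "{x2, x4} \<noteq> {x1, x3}" using xs(1) by auto
    show "card {q, x5, x6, x7} = 4" using xs qX by auto
    show "{q, x5, x6, x7} \<subseteq> zeros s1 \<inter> zeros s2" using qL isQ_zeros[OF Q(1)] isQ_zeros[OF Q(2)] xs by auto
  qed
  moreover have "{q, x1, x3} \<subseteq> zeros s1" "{q, x2, x4} \<subseteq> zeros s2"
    using qL isQ_zeros[OF Q(1)] isQ_zeros[OF Q(2)] xs by auto
  moreover have "admissible (labelling [x1, x2, x3, x4, x5, x6, x7])"
    by (rule labelling_admissible[OF xs(1) _ _ dp]) (use xs in auto)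
  moreover have "on_line q t1" "on_line q t2" "on_line x1 t1" "on_line x2 t1" "on_line x3 t2" "on_line x4 t2"
    using lin[OF L(1) q(1)] lin[OF L(2) q(2)] by (simp_all add: on_line_iff R1 R2)
  ultimately show ?thesis unfolding construction_a_def labelling_simps
    using isQ_conic[OF Q(1)] isQ_conic[OF Q(2)] by blast
qed

lemma construction_bI:
  assumes xs: "distinct [x1, x2, x3, x4, x5, x6, x7]" "X = {x1, x2, x3, x4, x5, x6, x7}" and dp: "del_pezzo_blowup X"
    and Q: "isQ X s1 {x6, x7}" "isQ X s2 {x4, x5}" "isQ X s3 {x2, x3}"
    and d: "cr (rep x1) d \<noteq> 0" "ord_ge 2 s1 (rep x1) d" "ord_ge 2 s2 (rep x1) d" "ord_ge 2 s3 (rep x1) d"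
  shows "construction_b (labelling [x1, x2, x3, x4, x5, x6, x7])"
proof -
  define t where "t = pl (rep x1) d"
  have t: "on_line x1 t" "d \<in> Rep_pline t" using Rep_pl[OF d(1)] by (auto simp: t_def on_line_iff)
  have "zeros s1 \<inter> zeros s2 = {x1, x2, x3}"
    by (rule isQ_isQ_inter_tangent[OF Q(1,2) _ _ _ _ d(1,2,3)])
      (use xs isQ_zeros[OF Q(1)] isQ_zeros[OF Q(2)] in auto)
  moreover have "zeros s1 \<inter> zeros s3 = {x1, x4, x5}"
    by (rule isQ_isQ_inter_tangent[OF Q(1,3) _ _ _ _ d(1,2,4)])
      (use xs isQ_zeros[OF Q(1)] isQ_zeros[OF Q(3)] in auto)
  moreover have "zeros s2 \<inter> zeros s3 = {x1, x6, x7}"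
    by (rule isQ_isQ_inter_tangent[OF Q(2,3) _ _ _ _ d(1,3,4)])
      (use xs isQ_zeros[OF Q(2)] isQ_zeros[OF Q(3)] in auto)
  moreover have "smooth_with_tangent s1 x1 t" "smooth_with_tangent s2 x1 t" "smooth_with_tangent s3 x1 t"
    using isQ_mult[OF Q(1), of x1] isQ_mult[OF Q(2), of x1] isQ_mult[OF Q(3), of x1] xs Q d t
    by (auto intro!: smooth_with_tangentI[of 2 _ _ d] simp: isQ_def)
  moreover have "admissible (labelling [x1, x2, x3, x4, x5, x6, x7])"
    by (rule labelling_admissible[OF xs(1) _ _ dp]) (use xs in auto)
  ultimately show ?thesis unfolding construction_b_def labelling_simps
    using isQ_conic[OF Q(1)] isQ_conic[OF Q(2)] isQ_conic[OF Q(3)] by blast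
qed

lemma construction_cI:
  assumes xs: "distinct [x1, x2, x3, x4, x5, x6, x7]" "X = {x1, x2, x3, x4, x5, x6, x7}" and dp: "del_pezzo_blowup X"
    and Q: "isQ X s {x2, x7}" and C: "isC X g x7"
    and d: "cr (rep x1) d \<noteq> 0" "d3 (rep x1) d (rep x2) = 0" "ord_ge 2 s (rep x1) d" "ord_ge 2 g (rep x1) d"
    and node: "card (tangent_lines g x7) = 2"
  shows "construction_c (labelling [x1, x2, x3, x4, x5, x6, x7])"
proof -
  define t where "t = pl (rep x1) d"
  have t: "on_line x1 t" "d \<in> Rep_pline t" "on_line x2 t" using Rep_pl[OF d(1)] d(2) by (auto simp: t_def on_line_iff)
  have hg: "homogeneous 3 g" "\<And>y. y \<in> X - {x7} \<Longrightarrow> y \<in> zeros g"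
    using C zeros_iff[of 3 g] by (auto simp: isC_def)
  have "smooth_with_tangent s x1 t" "smooth_with_tangent g x1 t"
    using isQ_mult[OF Q, of x1] isC_mult[OF C, of x1] xs Q C d t
    by (auto intro!: smooth_with_tangentI[of _ _ _ d] simp: isQ_def isC_def)
  moreover have "nodal_cubic g x7"
    using hg isC_irreducible[OF C] isC_mult[OF C, of x7] node xs by (auto simp: nodal_cubic_def node_def)
  moreover have "admissible (labelling [x1, x2, x3, x4, x5, x6, x7])"
    by (rule labelling_admissible[OF xs(1) _ _ dp]) (use xs in auto)
  moreover have "x1 \<in> zeros s" "{x3, x4, x5, x6} \<subseteq> zeros s" using isQ_zeros[OF Q] xs by auto
  moreover have "{x2, x3, x4, x5, x6} \<subseteq> zeros g" "x1 \<in> zeros g" using hg(2) xs by auto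
  ultimately show ?thesis unfolding construction_c_def labelling_simps
    using isQ_conic[OF Q] t by blast
qed

section \<open>Conics through five of the points; three lines and a cubic\<close>

lemma card_5E:
  assumes "card S = 5"
  obtains a b p q r where "S = {a, b, p, q, r}" "distinct [a, b, p, q, r]"
proof -
  have "finite S" using assms card.infinite by fastforce
  then obtain xs where xs: "set xs = S" "distinct xs" using finite_distinct_list by blast
  hence "length xs = 5" using assms distinct_card by fastforce
  then obtain a b p q r where "xs = [a, b, p, q, r]"
    by (auto simp: eval_nat_numeral length_Suc_conv)
  thus ?thesis using xs that by auto
qed

lemma isQ_exists:
  assumes "S \<subseteq> X" "card S = 2" shows "\<exists>F. isQ X F S"
proof -
  have "card (X - S) = 5" using assms finX cardX finS by (simp add: card_Diff_subset)
  then obtain a b p q r where XS: "X - S = {a, b, p, q, r}" and dist: "distinct [a, b, p, q, r]"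
    using card_5E by blast
  have in': "{a, b, p, q, r} \<subseteq> X" using XS by auto
  \<comment> \<open>The pencil of conics through \<open>a, b, p, q\<close> is spanned by the line
    pairs \<open>ab, pq\<close> and \<open>ap, bq\<close>; \<open>A\<close> and \<open>B\<close>
    select the member through \<open>r\<close>.\<close>
  define A where "A = d3 (rep a) (rep p) (rep r) * d3 (rep b) (rep q) (rep r)"
  define B where "B = d3 (rep a) (rep b) (rep r) * d3 (rep p) (rep q) (rep r)"
  define F where "F = cst A * (line_form (rep a) (rep b) * line_form (rep p) (rep q)) -
     cst B * (line_form (rep a) (rep p) * line_form (rep b) (rep q))"
  have "homogeneous (1 + 1) F" unfolding F_def
    by (intro homogeneous_diff homogeneous_cst_mult homogeneous_mult homogeneous_line_form)
  hence "homogeneous 2 F" by (simp add: numeral_2_eq_2)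
  moreover have "eval3 F (rep x) = 0" if "x \<in> X - S" for x
    using that unfolding XS by (auto simp: F_def A_def B_def)
  moreover have "F \<noteq> 0"
  proof
    assume "F = 0"
    \<comment> \<open>A point of the line \<open>ab\<close>, where only the second line pair
      survives.\<close>
    hence "eval3 F (rep a + rep b) = 0" by simp
    hence "B * (d3 (rep a) (rep p) (rep b) * d3 (rep b) (rep q) (rep a)) = 0" by (simp add: F_def)
    moreover have "d3 (rep a) (rep p) (rep b) \<noteq> 0" "d3 (rep b) (rep q) (rep a) \<noteq> 0"
      "d3 (rep a) (rep b) (rep r) \<noteq> 0" "d3 (rep p) (rep q) (rep r) \<noteq> 0"
      by (rule nocolD[OF nc]; use in' dist in auto)+
    ultimately show False by (simp add: B_def)
  qed
  ultimately show ?thesis using assms by (auto simp: isQ_def)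
qed

lemma isQ_tangent:
  assumes Q: "isQ X F S" "x \<in> X" "x \<notin> S"
  obtains d where "cr (rep x) d \<noteq> 0" "ord_ge 2 F (rep x) d"
proof -
  have F: "homogeneous 2 F" "eval3 F (rep x) = 0" using Q by (auto simp: isQ_def)
  obtain M where M: "homogeneous 1 M"
    "\<And>u v w. eval3 F (u *s rep x + v *s w) = v\<^sup>2 * eval3 F w + u * v * eval3 M w"
    using conic_polar[OF F(1) rep_nonzero F(2)] by blast
  have al: "along F (rep x) w = [:0, eval3 M w, eval3 F w:]" for w
    using M(2)[of 1] by (intro poly_ext) (simp add: poly_along power2_eq_square algebra_simps)
  obtain b c where bc: "d3 (rep x) b c \<noteq> 0" using basis_extend[OF rep_nonzero] by blast
  obtain d where d: "cr (rep x) d \<noteq> 0" "eval3 M d = 0"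
  proof (cases "eval3 M b = 0")
    case True thus thesis using that bc cr_nonzeroI by blast
  next
    case False
    define d where "d = (- eval3 M c / eval3 M b) *s b + 1 *s c"
    have "eval3 M d = 0" using eval3_homogeneous_1[OF M(1), of "- eval3 M c / eval3 M b" b 1 c 0 0] False
      by (simp add: d_def)
    moreover have "d3 (rep x) d b \<noteq> 0" using bc d3_swap'[of "rep x" b c] by (simp add: d_def)
    ultimately show thesis using that cr_nonzeroI by blast
  qed
  hence "ord_ge 2 F (rep x) d" by (simp add: ord_ge_iff al less_2_cases_iff)
  thus ?thesis using that d by blast
qed

text \<open>In the situation of three lines and a cubic through a point \<open>q\<close>, the reducible cubics
  \<open>F\<^sub>i s\<^sub>i\<close> and \<open>g\<close> lie in one pencil; as \<open>g\<close> is singular at \<open>x\<close>, the conics are tangent there.\<close>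

lemma conics_share_tangent:
  assumes F1: "isL X F1 S1" and F2: "isL X F2 S2" and S: "S1 \<inter> S2 = {}" "x \<notin> S1" "x \<notin> S2"
    and s1: "isQ X s1 S1" and s2: "isQ X s2 S2" and g: "isC X g x"
    and q: "q \<notin> X" "eval3 F1 (rep q) = 0" "eval3 F2 (rep q) = 0" "eval3 g (rep q) = 0"
    and d: "ord_ge 2 s1 (rep x) d"
  shows "ord_ge 2 s2 (rep x) d"
proof -
  have SX: "S1 \<subseteq> X" "card S1 = 2" and xX: "x \<in> X" using F1 g by (auto simp: isL_def isC_def)
  obtain y z where yz: "S1 = {y, z}" "y \<noteq> z" using SX by (meson card_2_iff)
  define a where "a = rep y" define b where "b = rep z"
  have ab: "cr a b \<noteq> 0" using rep_indep yz by (auto simp: a_def b_def)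
  have "d3 a b (rep q) = 0"
    using linear_form_eq_0[of a b "rep q" F1] F1 q yz by (auto simp: isL_def a_def b_def)
  moreover have "q \<noteq> y" "q \<noteq> z" using q yz SX by auto
  ultimately obtain u0 v0 where q0: "rep q = u0 *s a + v0 *s b" "u0 \<noteq> 0" "v0 \<noteq> 0"
    using third_point_coords[OF yz(2)] unfolding a_def b_def by metis
  \<comment> \<open>A line through the pair \<open>S2\<close> and a conic through the other five
    points: a reducible cubic through all seven points and \<open>q\<close>.\<close>
  define G where "G = F2 * s2"
  have G: "homogeneous 3 G"
  proof -
    have "homogeneous (1 + 2) (F2 * s2)"
      by (rule homogeneous_mult) (use F2 s2 in \<open>auto simp: isL_def isQ_def\<close>)
    moreover have "1 + 2 = (3 :: nat)" by simp
    ultimately show ?thesis by (simp only: G_def)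
  qed
  have G0: "eval3 G (rep w) = 0" if "w \<in> X" for w
    using that F2 s2 by (cases "w \<in> S2") (auto simp: G_def isL_def isQ_def)
  have hg: "homogeneous 3 g" "\<And>w. ord_ge 2 g (rep x) w" using g by (auto simp: isC_def)
  have g0: "eval3 g (rep w) = 0" if "w \<in> X" for w
    using that g hg(2)[of 0] ord_ge_mono[of 2 g "rep x" 0 1] by (cases "w = x") (auto simp: isC_def)
  \<comment> \<open>On the line through the pair \<open>S1\<close> both cubics vanish at its two
    points and at \<open>q\<close>, which fixes a binary cubic up to a scalar; so \<open>G\<close>
    is a multiple of \<open>g\<close> there.\<close>
  have bin: "eval3 F (u *s a + v *s b) = u * v * (coeff (along F a b) 1 * u + coeff (along F a b) 2 * v)"
    if F: "homogeneous 3 F" "eval3 F a = 0" "eval3 F b = 0" for F u v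
  proof -
    have "coeff (along F a b) 0 = 0" "coeff (along F a b) 3 = 0"
      using F along_rev[OF F(1), of 0 b a] by (simp_all add: coeff_along_0)
    thus ?thesis by (simp add: eval3_binary[OF F(1)] eval_nat_numeral algebra_simps)
  qed
  have yzX: "y \<in> X" "z \<in> X" using yz SX by auto
  note bg = bin[OF hg(1) g0[OF yzX(1), folded a_def] g0[OF yzX(2), folded b_def]]
  note bG = bin[OF G G0[OF yzX(1), folded a_def] G0[OF yzX(2), folded b_def]]
  have rel: "coeff (along F a b) 1 * u0 + coeff (along F a b) 2 * v0 = 0"
    if "\<And>u v. eval3 F (u *s a + v *s b) = u * v * (coeff (along F a b) 1 * u + coeff (along F a b) 2 * v)"
      "eval3 F (rep q) = 0" for F
    using that q0 by auto
  have "eval3 G (rep q) = 0" using q by (simp add: G_def)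
  note rG = rel[OF bG this] and rg = rel[OF bg q(4)]
  have "coeff (along g a b) 1 \<noteq> 0"
  proof
    assume c1: "coeff (along g a b) 1 = 0"
    hence "coeff (along g a b) 2 = 0" using rg q0 by simp
    thus False using nolineD[OF isC_noline[OF g] ab] bg c1 by simp
  qed
  define k where "k = coeff (along G a b) 1 / coeff (along g a b) 1"
  define h where "h = G - cst k * g"
  have c1: "coeff (along G a b) 1 = k * coeff (along g a b) 1" using \<open>coeff (along g a b) 1 \<noteq> 0\<close> by (simp add: k_def)
  have "v0 * coeff (along G a b) 2 = v0 * (k * coeff (along g a b) 2)"
    using rG rg c1 by (auto simp: algebra_simps add_eq_0_iff2)
  hence c2: "coeff (along G a b) 2 = k * coeff (along g a b) 2" using q0 by simp
  have "eval3 h (u *s a + v *s b) = 0" for u v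
    by (simp add: h_def bG bg c1 c2 algebra_simps del: One_nat_def)
  moreover have "homogeneous 3 h" unfolding h_def by (intro homogeneous_diff homogeneous_cst_mult G hg)
  ultimately obtain Q where Q: "homogeneous 2 Q" "h = line_form a b * Q" using cubic_factor_line ab by metis
  have Q0: "eval3 Q (rep w) = 0" if w: "w \<in> X - S1" for w
  proof -
    have "d3 a b (rep w) \<noteq> 0" unfolding a_def b_def by (rule nocolD[OF nc]) (use w yz SX in auto)
    moreover have "eval3 h (rep w) = 0" using G0[of w] g0[of w] w by (simp add: h_def)
    ultimately show ?thesis using Q by simp
  qed
  \<comment> \<open>The residual conic passes through the five points off \<open>S1\<close>. Thus
    \<open>G\<close> is a combination of \<open>g\<close>, singular at \<open>x\<close>, and of
    \<open>s1\<close> times its line, and it inherits the tangent of \<open>s1\<close> at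
    \<open>x\<close>.\<close>
  have "homogeneous 2 s1" using s1 by (simp add: isQ_def)
  then obtain j where j: "Q = cst j * s1"
    using conics_5_points[OF _ isQ_noline[OF s1] Q(1) isQ_card[OF s1]] Q0 s1 by (metis isQ_def)
  have "G = cst k * g + cst j * (line_form a b * s1)" using Q(2) j by (simp add: h_def algebra_simps)
  moreover have "ord_ge 2 (line_form a b * s1) (rep x) d" using ord_ge_mult[OF ord_ge_0 d, of "line_form a b"] by (simp only: add_0)
  ultimately have "ord_ge 2 G (rep x) d" using hg(2)[of d] by (auto intro!: ord_ge_add ord_ge_cst_mult)
  hence "ord_ge (0 + 2) (F2 * s2) (rep x) d" by (simp only: add_0 G_def)
  moreover have "\<not> ord_ge (Suc 0) F2 (rep x) d" using isL_off[OF F2 xX S(3)] by simp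
  ultimately show ?thesis using ord_ge_cancel by blast
qed

text \<open>Under the Geiser involution the four curves correspond to the exceptional curve over
  \<open>x7\<close> and the conics omitting the three pairs; the image of \<open>q\<close> is the
  common tangent direction of these conics at \<open>x7\<close>.\<close>

lemma three_lines_construction_b:
  assumes xs: "distinct [x1, x2, x3, x4, x5, x6, x7]" "X = {x1, x2, x3, x4, x5, x6, x7}" and dp: "del_pezzo_blowup X"
    and L: "isL X F1 {x1, x2}" "isL X F2 {x3, x4}" "isL X F3 {x5, x6}" and C: "isC X g x7"
    and q: "q \<notin> X" "eval3 F1 (rep q) = 0" "eval3 F2 (rep q) = 0" "eval3 F3 (rep q) = 0" "eval3 g (rep q) = 0"
  shows "construction_b (labelling [x7, x5, x6, x3, x4, x1, x2])"
proof -
  obtain s1 s2 s3 where s: "isQ X s1 {x1, x2}" "isQ X s2 {x3, x4}" "isQ X s3 {x5, x6}"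
    using isQ_exists L unfolding isL_def by metis
  obtain d where d: "cr (rep x7) d \<noteq> 0" "ord_ge 2 s1 (rep x7) d" using isQ_tangent[OF s(1), of x7] xs by auto
  have "ord_ge 2 s2 (rep x7) d"
    by (rule conics_share_tangent[OF L(1,2) _ _ _ s(1,2) C q(1-3) q(5) d(2)]) (use xs in auto)
  moreover have "ord_ge 2 s3 (rep x7) d"
    by (rule conics_share_tangent[OF L(1,3) _ _ _ s(1,3) C q(1,2,4,5) d(2)]) (use xs in auto)
  ultimately show ?thesis by (intro construction_bI[OF _ _ dp s d]) (use xs in auto)
qed

end

subsection \<open>Tangent cones and cuspidal cubics\<close>

lemma quadratic_form_root:
  fixes A B C :: complex
  obtains y z where "A * y\<^sup>2 + B * y * z + C * z\<^sup>2 = 0" "(y, z) \<noteq> (0, 0)"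
proof (cases "A = 0")
  case True thus ?thesis using that[of 1 0] by simp
next
  case False
  define r where "r = csqrt (B\<^sup>2 - 4 * A * C)"
  have r: "r\<^sup>2 = B\<^sup>2 - 4 * A * C" by (simp add: r_def)
  have "4 * A * (A * ((r - B) / (2 * A))\<^sup>2 + B * ((r - B) / (2 * A)) * 1 + C * 1\<^sup>2) = r\<^sup>2 - (B\<^sup>2 - 4 * A * C)"
    using False by (simp add: field_simps power2_eq_square)
  hence "A * ((r - B) / (2 * A))\<^sup>2 + B * ((r - B) / (2 * A)) * 1 + C * 1\<^sup>2 = 0"
    using r False by simp
  thus ?thesis by (rule that) simp
qed

context dp2
begin

text \<open>The tangent cone at the double point is a binary quadratic form: two lines or a double line.\<close>

lemma isC_tangent_cone:
  assumes "isC X g x" "card (tangent_lines g x) \<noteq> 2"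
  obtains w c f where "d3 (rep x) w c \<noteq> 0" "f \<noteq> 0"
    "\<And>u y z. eval3 g (u *s rep x + (y *s w + z *s c)) = u * (f * z\<^sup>2) + eval3 g (y *s w + z *s c)"
proof -
  define v where "v = rep x"
  have hg: "homogeneous 3 g" "x \<in> X" "\<And>w. ord_ge 2 g v w" using assms by (auto simp: isC_def v_def)
  have v: "v \<noteq> 0" "eval3 g v = 0" using hg(3)[of 0] ord_ge_mono[of 2 g v 0 1] by (simp_all add: v_def)
  obtain L H where LH: "homogeneous 2 H"
    "\<And>u t w. eval3 g (u *s v + t *s w) = u\<^sup>2 * t * eval3 L w + u * t\<^sup>2 * eval3 H w + t ^ 3 * eval3 g w"
    using cubic_polar[OF hg(1) v] by metis
  have al: "along g v w = [:0, eval3 L w, eval3 H w, eval3 g w:]" for w by (rule cubic_polar_along[OF LH(2)])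
  have L0: "eval3 L w = 0" for w using hg(3)[of w] al[of w] by (simp add: ord_ge_iff less_2_cases_iff)
  have ev: "eval3 g (u *s v + t *s w) = u * t\<^sup>2 * eval3 H w + t ^ 3 * eval3 g w" for u t w using LH(2) L0 by simp
  have f3: "ord_ge 3 g v w \<longleftrightarrow> eval3 H w = 0" for w using L0 by (auto simp: ord_ge_iff al less_Suc_eq eval_nat_numeral)
  \<comment> \<open>The tangent cone is constant along \<open>v\<close>; this follows by expanding
    \<open>g\<close> in two ways on a line in the direction \<open>v\<close>.\<close>
  have Hv: "eval3 H (y *s v + w) = eval3 H w" for y w
  proof -
    have "eval3 g (v + (y *s v + w)) = eval3 g ((1 + y) *s v + 1 *s w)"
      by (rule arg_cong[of _ _ "eval3 g"]) (simp add: vec3_eq_iff algebra_simps)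
    also have "\<dots> = (1 + y) * eval3 H w + eval3 g w" unfolding ev by simp
    finally have 1: "eval3 g (v + (y *s v + w)) = (1 + y) * eval3 H w + eval3 g w" .
    have "eval3 g (y *s v + w) = eval3 g (y *s v + 1 *s w)" by simp
    also have "\<dots> = y * eval3 H w + eval3 g w" unfolding ev by simp
    finally have 2: "eval3 g (y *s v + w) = y * eval3 H w + eval3 g w" .
    have "eval3 g (v + (y *s v + w)) = eval3 H (y *s v + w) + eval3 g (y *s v + w)"
      using ev[of 1 1 "y *s v + w"] by simp
    thus ?thesis unfolding 1 2 by (simp add: algebra_simps)
  qed
  obtain b c where bc: "d3 v b c \<noteq> 0" using basis_extend v by blast
  obtain A B C D E G where eH: "\<And>x y z. eval3 H (x *s v + y *s b + z *s c) = A*x^2 + B*y^2 + C*z^2 + D*y*z + E*x*z + G*x*y"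
    using quad_expandE[OF LH(1)] by metis
  \<comment> \<open>A zero \<open>w\<close> of the cone outside the span of \<open>v\<close> gives
    one tangent line and reduces \<open>H\<close> to \<open>z (C z + D y)\<close>.\<close>
  obtain y0 z0 where yz0: "B * y0\<^sup>2 + D * y0 * z0 + C * z0\<^sup>2 = 0" "(y0, z0) \<noteq> (0, 0)" using quadratic_form_root by blast
  define w where "w = y0 *s b + z0 *s c"
  have Hw: "eval3 H w = 0" using eH[of 0 y0 z0] yz0(1) by (simp add: w_def algebra_simps)
  have "d3 v w c = y0 * d3 v b c" "d3 v w b = - z0 * d3 v b c" using d3_swap'[of v c b] by (simp_all add: w_def)
  hence "cr v w \<noteq> 0"
    using yz0(2) bc cr_nonzeroI[of v w c] cr_nonzeroI[of v w b] by (cases "y0 = 0") auto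
  then obtain c' where c': "d3 v w c' \<noteq> 0" using cr_nonzero_iff by blast
  obtain A B C D E G where eH: "\<And>x y z. eval3 H (x *s v + y *s w + z *s c') = A*x^2 + B*y^2 + C*z^2 + D*y*z + E*x*z + G*x*y"
    using quad_expandE[OF LH(1)] by metis
  have B: "B = 0" using eH[of 0 1 0] Hw by simp
  have eH: "eval3 H (x *s v + y *s w + z *s c') = z * (C * z + D * y)" for x y z
    using Hv[of x "y *s w + z *s c'"] eH[of 0 y z] B by (simp add: add.assoc power2_eq_square algebra_simps)
  have tl: "l \<in> tangent_lines g x \<longleftrightarrow> eval3 H b = 0" if "b \<in> Rep_pline l" "cr v b \<noteq> 0" "on_line x l" for l b
    using tangent_lines_iff[OF hg(1) that(1) _ that(3), of 2] that(2) isC_mult[OF assms(1) hg(2)] f3[of b]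
    by (simp add: v_def eval_nat_numeral)
  have "D = 0"
  proof (rule ccontr)
    assume D: "D \<noteq> 0"
    \<comment> \<open>The zero of the other factor \<open>C z + D y\<close>; for
      \<open>D \<noteq> 0\<close> it gives a second tangent line, and there would be exactly
      two.\<close>
    define w2 where "w2 = C *s w + (- D) *s c'"
    have "d3 v w2 w \<noteq> 0" "d3 v w w2 \<noteq> 0" using c' D d3_swap'[of v c' w] by (simp_all add: w2_def)
    hence w12: "cr v w \<noteq> 0" "cr v w2 \<noteq> 0" "d3 v w w2 \<noteq> 0" using cr_nonzeroI by blast+
    have Hw2: "eval3 H w2 = 0" using eH[of 0 C "- D"] by (simp add: w2_def)
    have on: "on_line x (pl v u)" "u \<in> Rep_pline (pl v u)" if "cr v u \<noteq> 0" for u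
      using Rep_pl[OF that] by (simp_all add: on_line_iff v_def)
    have "tangent_lines g x = {pl v w, pl v w2}"
    proof (rule set_eqI, rule iffI)
      fix l assume "l \<in> {pl v w, pl v w2}"
      thus "l \<in> tangent_lines g x" using on w12 tl Hw Hw2 by blast
    next
      fix l assume l: "l \<in> tangent_lines g x"
      hence ol: "on_line x l" by (simp add: tangent_lines_def)
      hence vl: "v \<in> Rep_pline l" by (simp add: on_line_iff v_def)
      then obtain u where u: "u \<in> Rep_pline l" "cr v u \<noteq> 0" using pline_direction v by blast
      have Hu: "eval3 H u = 0" using tl[OF u ol] l by simp
      obtain p q r where pqr: "u = p *s v + q *s w + r *s c'" using basis_coordsE[OF c'] by blast
      have "r = 0 \<or> C * r + D * q = 0" using Hu eH pqr by simp
      thus "l \<in> {pl v w, pl v w2}"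
      proof
        assume "r = 0"
        hence "u \<in> Rep_pline (pl v w)" using Rep_pl[OF w12(1)] by (simp add: pqr)
        hence "l = pl v w" using pline_eqI[OF u(2) vl u(1) _ ] Rep_pl[OF w12(1)] by simp
        thus ?thesis by simp
      next
        assume e: "C * r + D * q = 0"
        have "d3 v w2 u = (C * r + D * q) * d3 v w c'" using d3_swap'[of v c' w] by (simp add: pqr w2_def algebra_simps)
        hence "u \<in> Rep_pline (pl v w2)" using Rep_pl[OF w12(2)] e by simp
        hence "l = pl v w2" using pline_eqI[OF u(2) vl u(1) _ ] Rep_pl[OF w12(2)] by simp
        thus ?thesis by simp
      qed
    qed
    moreover have "pl v w \<noteq> pl v w2"
    proof
      assume "pl v w = pl v w2"
      hence "w2 \<in> Rep_pline (pl v w)" using on(2)[OF w12(2)] by metis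
      thus False using w12(3) unfolding Rep_pl[OF w12(1)] by blast
    qed
    ultimately show False using assms(2) by simp
  qed
  have "C \<noteq> 0"
  proof
    assume "C = 0"
    have "eval3 H u = 0" for u
    proof -
      obtain p q r where "u = p *s v + q *s w + r *s c'" using basis_coordsE[OF c'] by blast
      thus ?thesis using eH \<open>C = 0\<close> \<open>D = 0\<close> by simp
    qed
    hence tri: "ord_ge 3 g v u" for u using f3 by blast
    have "card (X - {x}) \<ge> 3" using hg finX cardX by simp
    then obtain s where "s \<in> X - {x}" by (metis subset3E)
    thus False using isC_not_triple[OF assms(1), of s] tri by (auto simp: v_def)
  qed
  moreover have "eval3 g (u *s v + (y *s w + z *s c')) = u * (C * z\<^sup>2) + eval3 g (y *s w + z *s c')" for u y z
    using ev[of u 1 "y *s w + z *s c'"] eH[of 0 y z] \<open>D = 0\<close> by (simp add: power2_eq_square)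
  ultimately show ?thesis using that c' by (simp add: v_def)
qed

lemma cuspidal_normal_form:
  assumes "isC X g x" "card (tangent_lines g x) \<noteq> 2"
  obtains a b c k j where "d3 a b c \<noteq> 0" "k \<noteq> 0" "j \<noteq> 0" "rep x = j *s b"
    "\<And>x y z. eval3 g (x *s a + y *s b + z *s c) = k * (x ^ 3 - y * z\<^sup>2)"
proof -
  define v where "v = rep x"
  have hg: "homogeneous 3 g" "\<And>w. ord_ge 2 g v w" using assms by (auto simp: isC_def v_def)
  have gv: "eval3 g v = 0" using hg(2)[of 0] ord_ge_mono[of 2 g v 0 1] by simp
  obtain w c f where wc: "d3 v w c \<noteq> 0" "f \<noteq> 0"
    "\<And>u y z. eval3 g (u *s v + (y *s w + z *s c)) = u * (f * z\<^sup>2) + eval3 g (y *s w + z *s c)"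
    using isC_tangent_cone[OF assms] unfolding v_def by metis
  obtain A B C D E G H I J K where e: "\<And>x y z. eval3 g (x *s v + y *s w + z *s c) =
    A*x^3 + B*y^3 + C*z^3 + D*x^2*y + E*x^2*z + G*x*y^2 + H*y^2*z + I*x*z^2 + J*y*z^2 + K*x*y*z"
    using cubic_expandE[OF hg(1)] by metis
  have e2: "eval3 g (y *s w + z *s c) = B*y^3 + C*z^3 + H*y^2*z + J*y*z^2" for y z
    using e[of 0 y z] by simp
  have "B \<noteq> 0"
  proof
    assume "B = 0"
    hence "eval3 g (u *s v + y *s w) = 0" for u y using wc(3)[of u y 0] e2[of y 0] by simp
    thus False using nolineD[OF isC_noline[OF assms(1)] cr_nonzeroI[OF wc(1)]] by blast
  qed
  \<comment> \<open>\<open>m\<close> completes the cube and removes the term in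
    \<open>y^2 z\<close>. What then remains besides the cube is divisible by \<open>z^2\<close> and
    is absorbed into the coordinate along \<open>v\<close>.\<close>
  define m where "m = H / (3 * B)"
  define k2 where "k2 = J - 3 * B * m\<^sup>2"
  define a' where "a' = w - (k2 / f) *s v"
  define b' where "b' = (- B / f) *s v"
  define c' where "c' = c - m *s w + ((k2 * m - (C - B * m ^ 3)) / f) *s v"
  have H: "H = 3 * B * m" using \<open>B \<noteq> 0\<close> by (simp add: m_def)
  have J: "J = k2 + 3 * B * m\<^sup>2" by (simp add: k2_def)
  have "eval3 g (x *s a' + y *s b' + z *s c') = B * (x ^ 3 - y * z\<^sup>2)" for x y z
  proof -
    define u where "u = (- k2 * x - B * y + (k2 * m - (C - B * m ^ 3)) * z) / f"
    have "x *s a' + y *s b' + z *s c' = u *s v + ((x - m * z) *s w + z *s c)"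
      using wc(2) by (simp add: a'_def b'_def c'_def u_def vec3_eq_iff field_simps)
    hence "eval3 g (x *s a' + y *s b' + z *s c') = u * f * z\<^sup>2 + (B*(x - m * z)^3 + C*z^3 + H*(x - m * z)^2*z + J*(x - m * z)*z^2)"
      by (simp only: wc(3) e2) (simp add: mult.assoc)
    also have "u * f = - k2 * x - B * y + (k2 * m - (C - B * m ^ 3)) * z" using wc(2) by (simp add: u_def)
    finally show ?thesis unfolding H J by (simp add: power2_eq_square power3_eq_cube algebra_simps)
  qed
  moreover have "d3 a' b' c' \<noteq> 0"
  proof -
    have "d3 a' b' c' = (B / f) * d3 v w c" using d3_swap[of w v c] by (simp add: a'_def b'_def c'_def)
    thus ?thesis using wc \<open>B \<noteq> 0\<close> by simp
  qed
  moreover have "rep x = (- f / B) *s b'" using wc(2) \<open>B \<noteq> 0\<close> by (simp add: b'_def v_def)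
  ultimately show ?thesis using that[of a' b' c' B "- f / B"] \<open>B \<noteq> 0\<close> wc(2) by simp
qed

end

text \<open>The smooth points of the curve \<open>x^3 = y z^2\<close>, whose cusp is
  \<open>b\<close>. A form of degree \<open>n\<close> pulls back to a polynomial of degree at most
  \<open>3 n\<close> without a term in \<open>t^(3 n - 1)\<close>, so collinear points have
  parameter sum 0.\<close>

definition cusp_pt :: "complex^3 \<Rightarrow> complex^3 \<Rightarrow> complex^3 \<Rightarrow> complex \<Rightarrow> complex^3" where
  "cusp_pt a b c t = t *s a + t ^ 3 *s b + 1 *s c"

lemma double_root_dvd:
  fixes p :: "complex poly"
  assumes "poly p a = 0" "poly (pderiv p) a = 0" shows "[:- a, 1:] ^ 2 dvd p"
proof -
  obtain q where q: "p = [:- a, 1:] * q" using iffD1[OF poly_eq_0_iff_dvd assms(1)] by (elim dvdE)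
  have "poly q a = 0" using assms(2) unfolding q pderiv_mult by (simp add: pderiv_pCons)
  then obtain r where "q = [:- a, 1:] * r" using iffD1[OF poly_eq_0_iff_dvd] by (metis dvdE)
  hence "p = [:- a, 1:] ^ 2 * r" using q by (simp only: power2_eq_square mult.assoc)
  thus ?thesis by simp
qed

text \<open>Vieta's formula for the coefficient 0 of \<open>t^5\<close>, with \<open>t1\<close>
  counted twice. Subtracting \<open>B\<close> times the monic product of the root factors leaves
  degree at most 5 and six zeros, hence 0.\<close>

lemma sextic_root_sum:
  fixes p :: "complex poly"
  assumes p: "p = [:C, E, A, D, G, 0, B:]" and d: "distinct [t1, t3, t4, t5, t6]" and B: "B \<noteq> 0"
    and roots: "poly p t1 = 0" "poly (pderiv p) t1 = 0" "poly p t3 = 0" "poly p t4 = 0" "poly p t5 = 0" "poly p t6 = 0"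
  shows "2 * t1 + t3 + t4 + t5 + t6 = 0"
proof -
  define W where "W = [:- t1, 1:] ^ 2 * ([:- t3, 1:] * ([:- t4, 1:] * ([:- t5, 1:] * [:- t6, 1:])))"
  define R where "R = p - smult B W"
  have W6: "coeff W 6 = 1" and W5: "coeff W 5 = - (2 * t1 + t3 + t4 + t5 + t6)"
    by (simp_all add: W_def power2_eq_square eval_nat_numeral)
  have degW: "degree W \<le> 6" by (simp add: W_def power2_eq_square)
  have R5: "coeff R 5 = B * (2 * t1 + t3 + t4 + t5 + t6)" and R6: "coeff R 6 = 0"
    by (simp_all add: R_def W5 W6, simp_all add: p eval_nat_numeral algebra_simps)
  have "degree R \<le> 6" unfolding R_def using degW by (intro degree_diff_le) (simp_all add: p)
  hence "coeff R i = 0" if "5 < i" for i using that R6 coeff_eq_0[of R i] by (cases "i = 6") auto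
  hence "degree R \<le> 5" by (intro degree_le) blast
  have "R = 0"
  proof (rule ccontr)
    assume R: "R \<noteq> 0"
    have simple: "[:- t, 1:] ^ 1 dvd R" if "t \<in> {t3, t4, t5, t6}" for t
    proof -
      have "poly W t = (t - t1)\<^sup>2 * ((t - t3) * ((t - t4) * ((t - t5) * (t - t6))))"
        by (simp only: W_def poly_mult poly_power) simp
      hence "poly R t = 0" using that roots by (auto simp: R_def)
      thus ?thesis using iffD1[OF poly_eq_0_iff_dvd] by simp
    qed
    have "[:- t1, 1:] ^ 2 dvd W" unfolding W_def by (rule dvd_triv_left)
    hence dbl: "[:- t1, 1:] ^ 2 dvd R" unfolding R_def
      using double_root_dvd[OF roots(1,2)] by (intro dvd_diff dvd_smult)
    have "(\<Sum>t\<in>{t1, t3, t4, t5, t6}. if t = t1 then 2 else 1) \<le> degree R"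
      by (rule sum_root_orders_le[OF R]) (use simple dbl in auto)
    moreover have "(\<Sum>t\<in>{t1, t3, t4, t5, t6}. if t = t1 then 2 else 1) = (6 :: nat)" using d by auto
    ultimately show False using \<open>degree R \<le> 5\<close> by linarith
  qed
  thus ?thesis using R5 B by simp
qed

context dp2
begin

lemma cuspidal_parameters:
  assumes xs: "distinct [x1, x2, x3, x4, x5, x6, x7]" "X = {x1, x2, x3, x4, x5, x6, x7}"
    and Q: "isQ X s {x2, x7}" and C: "isC X g x7"
    and d: "cr (rep x1) d \<noteq> 0" "d3 (rep x1) d (rep x2) = 0" "ord_ge 2 s (rep x1) d" "ord_ge 2 g (rep x1) d"
    and cusp: "card (tangent_lines g x7) \<noteq> 2"
  obtains a b c j T where "d3 a b c \<noteq> 0" "j \<noteq> 0" "rep x7 = j *s b"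
    "\<And>y. y \<in> X - {x7} \<Longrightarrow> \<exists>m. m \<noteq> 0 \<and> rep y = m *s cusp_pt a b c (T y)"
    "T x1 = 1" "T x2 = -2" "T x3 + T x4 + T x5 + T x6 = -2"
proof -
  obtain a b c k j where bas: "d3 a b c \<noteq> 0" "k \<noteq> 0" "j \<noteq> 0" "rep x7 = j *s b"
    and g: "\<And>x y z. eval3 g (x *s a + y *s b + z *s c) = k * (x ^ 3 - y * z\<^sup>2)"
    using cuspidal_normal_form[OF C cusp] by metis
  have hs: "homogeneous 2 s" and hg: "homogeneous 3 g" using Q C by (auto simp: isQ_def isC_def)
  have "\<exists>t m. m \<noteq> 0 \<and> rep y = m *s cusp_pt a b c t" if y: "y \<in> X - {x7}" for y
  proof -
    obtain p q r where pqr: "rep y = p *s a + q *s b + r *s c" using basis_coordsE[OF bas(1)] by blast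
    have "eval3 g (rep y) = 0" using C y by (auto simp: isC_def)
    hence e: "p ^ 3 = q * r\<^sup>2" using g bas(2) pqr by simp
    have r: "r \<noteq> 0"
    proof
      assume "r = 0"
      hence "rep y = q *s b" using e pqr by simp
      thus False using rep_indep[of x7 y] y bas(4) by (auto simp: cr_scale)
    qed
    have "q = r * (p / r) ^ 3" using e r by (simp add: field_simps power2_eq_square power3_eq_cube)
    hence "rep y = r *s cusp_pt a b c (p / r)" using r by (simp add: pqr cusp_pt_def vector_add_ldistrib)
    thus ?thesis using r by blast
  qed
  then obtain T where T: "\<And>y. y \<in> X - {x7} \<Longrightarrow> \<exists>m. m \<noteq> 0 \<and> rep y = m *s cusp_pt a b c (T y)" by metis
  have inj: "T y \<noteq> T z" if yz: "y \<in> X - {x7}" "z \<in> X - {x7}" "y \<noteq> z" for y z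
  proof
    assume "T y = T z"
    then obtain m m' where "rep y = m *s cusp_pt a b c (T y)" "rep z = m' *s cusp_pt a b c (T y)"
      using T[OF yz(1)] T[OF yz(2)] by metis
    thus False using rep_indep[OF yz(3)] by (simp add: cr_scale)
  qed
  define t1 where "t1 = T x1"
  define t2 where "t2 = T x2"
  have t12: "t1 \<noteq> t2" unfolding t1_def t2_def by (rule inj) (use xs in auto)
  obtain m1 m2 where m: "m1 \<noteq> 0" "rep x1 = m1 *s cusp_pt a b c t1" "m2 \<noteq> 0" "rep x2 = m2 *s cusp_pt a b c t2"
    using T[of x1] T[of x2] xs unfolding t1_def t2_def by auto
  have tan: "ord_ge 2 F (cusp_pt a b c t1) (cusp_pt a b c t2)" if F: "homogeneous n F" "ord_ge 2 F (rep x1) d" for F n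
  proof -
    have "ord_ge 2 F (rep x1) (rep x2)" using ord_ge_other_direction[OF F d(1,2)] .
    from ord_ge_in_span[OF F(1) this, of "1 / m1" 0 "1 / m2"] show ?thesis using m by simp
  qed
  have line: "cusp_pt a b c t1 + r *s cusp_pt a b c t2 = (t1 + r * t2) *s a + (t1 ^ 3 + r * t2 ^ 3) *s b + (1 + r) *s c" for r
    by (simp add: cusp_pt_def vec3_eq_iff algebra_simps)
  have "along g (cusp_pt a b c t1) (cusp_pt a b c t2) =
    [:0, k * (3 * t1\<^sup>2 * t2 - t2 ^ 3 - 2 * t1 ^ 3), k * (3 * t1 * t2\<^sup>2 - 2 * t2 ^ 3 - t1 ^ 3):]"
    by (rule poly_ext) (simp only: poly_along line g, simp add: power2_eq_square power3_eq_cube algebra_simps)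
  hence "k * (3 * t1\<^sup>2 * t2 - t2 ^ 3 - 2 * t1 ^ 3) = 0"
    using tan[OF hg d(4)] by (simp add: ord_ge_iff less_2_cases_iff)
  hence "3 * t1\<^sup>2 * t2 - t2 ^ 3 - 2 * t1 ^ 3 = 0" using bas(2) by (simp only: mult_eq_0_iff) simp
  \<comment> \<open>The tangent at \<open>t1\<close> meets the cubic again at \<open>-2 t1\<close>,
    in accordance with the parameter sum 0.\<close>
  hence "(t2 - t1) * ((t2 - t1) * (t2 + 2 * t1)) = 0"
    by (simp add: power2_eq_square power3_eq_cube algebra_simps)
  hence t2: "t2 = - 2 * t1" using t12 by (simp add: add_eq_0_iff2)
  have t1: "t1 \<noteq> 0" using t2 t12 by auto
  obtain A B C' D E G where es: "\<And>x y z. eval3 s (x *s a + y *s b + z *s c) = A*x^2 + B*y^2 + C'*z^2 + D*y*z + E*x*z + G*x*y"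
    using quad_expandE[OF hs] by metis
  define p where "p = [:C', E, A, D, G, 0, B:]"
  have ps: "eval3 s (cusp_pt a b c t) = poly p t" for t
    unfolding cusp_pt_def es by (simp add: p_def power2_eq_square power3_eq_cube algebra_simps)
  have root: "poly p (T y) = 0" if y: "y \<in> X - {x2, x7}" for y
  proof -
    obtain m where "m \<noteq> 0" "rep y = m *s cusp_pt a b c (T y)" using T[of y] y by auto
    moreover have "eval3 s (rep y) = 0" using Q y by (auto simp: isQ_def)
    ultimately show ?thesis by (simp add: eval3_scale[OF hs] ps)
  qed
  have "along s (cusp_pt a b c t1) (cusp_pt a b c t2) = [:poly p t1,
    2 * A * t1 * t2 + 2 * B * t1 ^ 3 * t2 ^ 3 + 2 * C' + D * (t1 ^ 3 + t2 ^ 3) + E * (t1 + t2) + G * (t1 * t2 ^ 3 + t2 * t1 ^ 3),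
    poly p t2:]"
    by (rule poly_ext) (simp only: poly_along line es, simp add: p_def power2_eq_square power3_eq_cube algebra_simps)
  hence c1: "2 * A * t1 * t2 + 2 * B * t1 ^ 3 * t2 ^ 3 + 2 * C' + D * (t1 ^ 3 + t2 ^ 3) + E * (t1 + t2) + G * (t1 * t2 ^ 3 + t2 * t1 ^ 3) = 0"
    using tan[OF hs d(3)] by (simp add: ord_ge_iff less_2_cases_iff)
  have p1: "poly p t1 = 0" unfolding t1_def by (rule root) (use xs in auto)
  \<comment> \<open>With \<gamma> for \<open>cusp_pt a b c\<close>, the velocity satisfies
    \<open>3 t1 \<gamma>'(t1) = \<gamma>(t1) - \<gamma>(-2 t1)\<close>, so contact along the line to
    \<open>x2\<close> becomes a double root of \<open>p\<close>.\<close>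
  have "3 * t1 * poly (pderiv p) t1 = 2 * poly p t1 - (2 * A * t1 * t2 + 2 * B * t1 ^ 3 * t2 ^ 3 + 2 * C' + D * (t1 ^ 3 + t2 ^ 3) + E * (t1 + t2) + G * (t1 * t2 ^ 3 + t2 * t1 ^ 3))"
    unfolding t2 by (simp add: p_def pderiv_pCons power2_eq_square power3_eq_cube algebra_simps)
  hence dp1: "poly (pderiv p) t1 = 0" using c1 p1 t1 by simp
  have "B \<noteq> 0"
  proof -
    have "eval3 s (rep x7) \<noteq> 0" by (rule isQ_off[OF Q]) simp
    thus ?thesis using es[of 0 1 0] bas(4) by (simp add: eval3_scale[OF hs])
  qed
  have sum0: "2 * t1 + T x3 + T x4 + T x5 + T x6 = 0"
  proof (rule sextic_root_sum[OF p_def _ \<open>B \<noteq> 0\<close> p1 dp1])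
    have "T y \<noteq> T z" if "y \<in> {x1, x3, x4, x5, x6}" "z \<in> {x1, x3, x4, x5, x6}" "y \<noteq> z" for y z
      by (rule inj) (use that xs in auto)
    thus "distinct [t1, T x3, T x4, T x5, T x6]" using xs(1) unfolding t1_def by simp
  qed (rule root; use xs in auto)+
  have "T x3 + T x4 + T x5 + T x6 = (2 * t1 + T x3 + T x4 + T x5 + T x6) - 2 * t1" by simp
  also have "\<dots> = -2 * t1" unfolding sum0 by simp
  finally have sum: "T x3 / t1 + T x4 / t1 + T x5 / t1 + T x6 / t1 = -2"
    using t1 by (simp add: add_divide_distrib[symmetric])
  \<comment> \<open>Scaling \<open>a\<close> by \<open>t1\<close> and \<open>b\<close> by its cube
    divides all parameters by \<open>t1\<close>, which normalises that of \<open>x1\<close> to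
    1.\<close>
  show ?thesis
  proof (rule that[of "t1 *s a" "t1 ^ 3 *s b" c "j / t1 ^ 3" "\<lambda>y. T y / t1"])
    show "\<exists>m. m \<noteq> 0 \<and> rep y = m *s cusp_pt (t1 *s a) (t1 ^ 3 *s b) c (T y / t1)" if "y \<in> X - {x7}" for y
    proof -
      have "cusp_pt (t1 *s a) (t1 ^ 3 *s b) c (T y / t1) = cusp_pt a b c (T y)"
        using t1 by (simp add: cusp_pt_def power_divide)
      thus ?thesis using T[OF that] by simp
    qed
  qed (use bas t1 t2 sum in \<open>auto simp: t1_def[symmetric] t2_def[symmetric]\<close>)
qed

end

section \<open>Curves prescribed by their zeros on the cuspidal cubic\<close>

lemma quad_formE:
  assumes "d3 a b c \<noteq> 0"
  obtains F where "homogeneous 2 F" "\<And>x y z. eval3 F (x *s a + y *s b + z *s c) =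
    A*x^2 + B*y^2 + C*z^2 + D*y*z + E*x*z + G*x*y"
proof -
  define x y z where "x = lco a b c" and "y = lco b c a" and "z = lco c a b"
  define F where "F = cst A * (x * x) + cst B * (y * y) + cst C * (z * z) + cst D * (y * z) + cst E * (x * z) + cst G * (x * y)"
  have "homogeneous (1 + 1) F" unfolding F_def x_def y_def z_def
    by (intro homogeneous_add homogeneous_cst_mult homogeneous_mult homogeneous_lco)
  moreover have "1 + 1 = (2 :: nat)" by simp
  ultimately have "homogeneous 2 F" by (simp only:)
  thus ?thesis
    by (rule that) (simp add: F_def x_def y_def z_def eval3_lco[OF assms] power2_eq_square mult.assoc)
qed

lemma cubic_formE:
  assumes "d3 a b c \<noteq> 0"
  obtains F where "homogeneous 3 F" "\<And>x y z. eval3 F (x *s a + y *s b + z *s c) =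
    A*x^3 + B*y^3 + C*z^3 + D*x^2*y + E*x^2*z + G*x*y^2 + H*y^2*z + I*x*z^2 + J*y*z^2 + K*x*y*z"
proof -
  define x y z where "x = lco a b c" and "y = lco b c a" and "z = lco c a b"
  define F where "F = cst A * (x * x * x) + cst B * (y * y * y) + cst C * (z * z * z) + cst D * (x * x * y) +
    cst E * (x * x * z) + cst G * (x * y * y) + cst H * (y * y * z) + cst I * (x * z * z) + cst J * (y * z * z) +
    cst K * (x * y * z)"
  have "homogeneous (1 + 1 + 1) F" unfolding F_def x_def y_def z_def
    by (intro homogeneous_add homogeneous_cst_mult homogeneous_mult homogeneous_lco)
  moreover have "1 + 1 + 1 = (3 :: nat)" by simp
  ultimately have "homogeneous 3 F" by (simp only:)
  thus ?thesis
    by (rule that) (simp add: F_def x_def y_def z_def eval3_lco[OF assms] power2_eq_square power3_eq_cube mult.assoc)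
qed

context dp2
begin

text \<open>The lines \<open>x1 x3\<close> and \<open>x5 x7\<close> meet in a point
  \<open>q\<close>, where the equations of the conics omitting \<open>{x3, x7}\<close> and
  \<open>{x1, x5}\<close> take values divisible by the difference of the two sides of
  \<open>H\<close>.\<close>

lemma bicuspidal_construction_a:
  assumes xs: "distinct [x1, x2, x3, x4, x5, x6, x7]" "X = {x1, x2, x3, x4, x5, x6, x7}" and dp: "del_pezzo_blowup X"
    and bas: "d3 a b c \<noteq> 0" and x7: "rep x7 = j *s b"
    and pts: "\<And>y. y \<in> X - {x7} \<Longrightarrow> \<exists>m. m \<noteq> 0 \<and> rep y = m *s cusp_pt a b c (T y)"
    and T: "T x1 = 1" "T x2 = -2" "T x3 + T x4 + T x5 + T x6 = -2"
    and H: "(1 - T x3) * (1 - T x5) = (1 - T x4) * (1 - T x6)"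
  shows "construction_a (labelling [x1, x3, x5, x7, x2, x4, x6])"
proof -
  define u v w where "u = T x4" and "v = T x5" and "w = T x6"
  have t3: "T x3 = -2 - u - v - w" using T(3) by (simp add: u_def v_def w_def algebra_simps add_eq_0_iff2 eq_diff_eq)
  define t where "t = T x3"
  have t: "t = -2 - u - v - w" by (simp add: t_def t3)
  have H': "(1 - u) * (1 - w) - (1 - t) * (1 - v) = 0" using H by (simp add: u_def v_def w_def t_def)
  \<comment> \<open>The sextic of the first conic has the roots 1, -2, \<open>u\<close>,
    \<open>v\<close>, \<open>w\<close>; as all six sum to 0, the last is \<open>3 + t\<close>. The
    \<open>a2, a1, a0\<close> and \<open>b2, b1, b0\<close> are the coefficients of two cubic
    factors, \<open>c4\<close> to \<open>c0\<close> those of the product.\<close>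
  define r where "r = 3 + t"
  define a2 a1 a0 b2 b1 b0 where "a2 = 1 - r" and "a1 = - 2 - r" and "a0 = 2 * r"
    and "b2 = - (u + v + w)" and "b1 = u * v + u * w + v * w" and "b0 = - (u * v * w)"
  define c4 c3 c2 c1 c0 where "c4 = a1 + b1 + a2 * b2" and "c3 = a0 + b0 + a1 * b2 + a2 * b1"
    and "c2 = a0 * b2 + a1 * b1 + a2 * b0" and "c1 = a0 * b1 + a1 * b0" and "c0 = a0 * b0"
  note cdefs = c4_def c3_def c2_def c1_def c0_def a2_def a1_def a0_def b2_def b1_def b0_def r_def
  obtain s1 where s1: "homogeneous 2 s1" "\<And>x y z. eval3 s1 (x *s a + y *s b + z *s c) =
      c2*x^2 + 1*y^2 + c0*z^2 + c3*y*z + c1*x*z + c4*x*y"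
    using quad_formE[OF bas, of c2 1 c0 c3 c1 c4] by blast
  \<comment> \<open>The second conic passes through the cusp, so its restriction has degree 4, with
    the roots -2, \<open>t\<close>, \<open>u\<close> and \<open>w\<close>.\<close>
  define e3 e2 e1 e0 where "e3 = 2 - t - u - w" and "e2 = t * u + t * w + u * w - 2 * (t + u + w)"
    and "e1 = 2 * (t * u + t * w + u * w) - t * u * w" and "e0 = - 2 * (t * u * w)"
  note edefs = e3_def e2_def e1_def e0_def
  obtain s2 where s2: "homogeneous 2 s2" "\<And>x y z. eval3 s2 (x *s a + y *s b + z *s c) =
      e2*x^2 + 0*y^2 + e0*z^2 + e3*y*z + e1*x*z + 1*x*y"
    using quad_formE[OF bas, of e2 0 e0 e3 e1 1] by blast
  have p1: "eval3 s1 (cusp_pt a b c y) = (y - 1) * (y + 2) * (y - r) * ((y - u) * (y - v) * (y - w))" for y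
    unfolding cusp_pt_def s1 cdefs t by (simp add: power2_eq_square power3_eq_cube algebra_simps)
  have p2: "eval3 s2 (cusp_pt a b c y) = (y + 2) * (y - t) * ((y - u) * (y - w))" for y
    unfolding cusp_pt_def s2 edefs by (simp add: power2_eq_square power3_eq_cube algebra_simps)
  have van: "eval3 F (rep y) = 0" if F: "homogeneous n F" "y \<in> X - {x7}" "eval3 F (cusp_pt a b c (T y)) = 0" for F n y
    using pts[OF F(2)] F(3) eval3_scale[OF F(1)] by auto
  have Q1: "isQ X s1 {x3, x7}"
  proof -
    have "eval3 s1 b = 1" using s1(2)[of 0 1 0] by simp
    hence "s1 \<noteq> 0" by auto
    moreover have "eval3 s1 (rep y) = 0" if "y \<in> X - {x3, x7}" for y
      by (rule van[OF s1(1)]) (use that xs(2) in \<open>auto simp: p1 T u_def v_def w_def\<close>)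
    ultimately show ?thesis using s1(1) xs by (auto simp: isQ_def)
  qed
  have b0': "eval3 s2 b = 0" using s2(2)[of 0 1 0] by simp
  have Q2: "isQ X s2 {x1, x5}"
  proof -
    have "s2 \<noteq> 0"
    proof
      assume "s2 = 0"
      thus False using s2(2)[of 1 1 0] s2(2)[of 1 0 0] by simp
    qed
    moreover have "eval3 s2 (rep y) = 0" if y: "y \<in> X - {x1, x5}" for y
    proof (cases "y = x7")
      case True thus ?thesis using b0' by (simp add: x7 eval3_scale[OF s2(1)])
    next
      case False
      show ?thesis by (rule van[OF s2(1)]) (use y False xs(2) in \<open>auto simp: p2 T u_def t_def w_def\<close>)
    qed
    ultimately show ?thesis using s2(1) xs by (auto simp: isQ_def)
  qed
  \<comment> \<open>The line from \<open>x5\<close> to the cusp fixes the first coordinate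
    \<open>v\<close>; \<open>dl\<close> moves the point of the cubic onto the line through the
    parameters 1 and \<open>t\<close>, whose third point has parameter
    \<open>-1 - t\<close>.\<close>
  define dl where "dl = - ((v - 1) * (v - t) * (v + 1 + t))"
  define q where "q = v *s a + (v ^ 3 + dl) *s b + 1 *s c"
  have "d3 a b q \<noteq> 0" using bas by (simp add: q_def)
  hence q0: "q \<noteq> 0" by auto
  have E1: "eval3 s1 q = dl * (u + v + w) * ((1 - u) * (1 - w) - (1 - t) * (1 - v))"
    unfolding q_def s1 dl_def cdefs t by (simp add: power2_eq_square power3_eq_cube algebra_simps)
  have E2: "eval3 s2 q = (v + 2) * (v - t) * ((1 - u) * (1 - w) - (1 - t) * (1 - v))"
    unfolding q_def s2 dl_def edefs t by (simp add: power2_eq_square power3_eq_cube algebra_simps)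
  have F1: "d3 (cusp_pt a b c 1) (cusp_pt a b c t) q = 0"
  proof -
    have "d3 (cusp_pt a b c 1) (cusp_pt a b c t) q =
      (1 * (t ^ 3 * 1 - 1 * (v ^ 3 + dl)) - 1 * (t * 1 - 1 * v) + 1 * (t * (v ^ 3 + dl) - t ^ 3 * v)) * d3 a b c"
      by (simp add: cusp_pt_def q_def d3_perm[where a = a and b = b and c = c] algebra_simps)
    thus ?thesis by (simp add: dl_def power3_eq_cube algebra_simps)
  qed
  have F2: "d3 (cusp_pt a b c v) b q = 0"
    by (simp add: cusp_pt_def q_def d3_perm[where a = a and b = b and c = c] algebra_simps)
  obtain k where k: "rep (pt q) = k *s q" using rep_ptE[OF q0] by blast
  obtain m1 m3 m5 where m: "rep x1 = m1 *s cusp_pt a b c 1" "rep x3 = m3 *s cusp_pt a b c t" "rep x5 = m5 *s cusp_pt a b c v"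
    using pts[of x1] pts[of x3] pts[of x5] xs T unfolding t_def v_def by auto
  have L: "isL X (line_form (rep y) (rep z)) {y, z}" if yz: "y \<in> X" "z \<in> X" "y \<noteq> z" for y z
    using yz homogeneous_line_form line_form_nonzero[OF rep_indep[OF yz(3)]] by (auto simp: isL_def)
  show ?thesis
  proof (rule construction_aI[OF _ _ dp _ _ Q1 Q2])
    show "isL X (line_form (rep x1) (rep x3)) {x1, x3}" "isL X (line_form (rep x5) (rep x7)) {x5, x7}"
      by (rule L; use xs in auto)+
    show "eval3 (line_form (rep x1) (rep x3)) (rep (pt q)) = 0" using F1 by (simp add: m k)
    show "eval3 (line_form (rep x5) (rep x7)) (rep (pt q)) = 0" using F2 by (simp add: m x7 k)
    show "eval3 s1 (rep (pt q)) = 0" "eval3 s2 (rep (pt q)) = 0"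
      using H' by (simp_all add: k eval3_scale[OF s1(1)] eval3_scale[OF s2(1)] E1 E2)
  qed (use xs in auto)
qed

text \<open>If the conjugate cubic \<open>h\<close> is cuspidal, too, the surface has further involutions, which account
  for the configuration of type (a).\<close>

lemma cuspidal_case:
  assumes xs: "distinct [x1, x2, x3, x4, x5, x6, x7]" "X = {x1, x2, x3, x4, x5, x6, x7}" and dp: "del_pezzo_blowup X"
    and Q: "isQ X s {x2, x7}" and C: "isC X g x7"
    and d: "cr (rep x1) d \<noteq> 0" "d3 (rep x1) d (rep x2) = 0" "ord_ge 2 s (rep x1) d" "ord_ge 2 g (rep x1) d"
    and cusp: "card (tangent_lines g x7) \<noteq> 2"
  shows "\<exists>x. bij_betw x {1..7} X \<and> (construction_a x \<or> construction_b x \<or> construction_c x)"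
proof -
  obtain a b c j T where bas: "d3 a b c \<noteq> 0" "j \<noteq> 0" "rep x7 = j *s b"
    and pts: "\<And>y. y \<in> X - {x7} \<Longrightarrow> \<exists>m. m \<noteq> 0 \<and> rep y = m *s cusp_pt a b c (T y)"
    and T: "T x1 = 1" "T x2 = -2" "T x3 + T x4 + T x5 + T x6 = -2"
    using cuspidal_parameters[OF xs Q C d cusp] by metis
  define p q r where "p = T x3" and "q = T x4" and "r = T x5"
  define w where "w = T x6"
  have w: "w = -2 - p - q - r" using T(3) by (simp add: p_def q_def r_def w_def algebra_simps eq_diff_eq)
  \<comment> \<open>The conic \<open>F\<close> and the cubic \<open>h\<close> with a double point at \<open>x1\<close> are found from their restrictions to
    the cuspidal cubic, which are determined by their zeros; \<open>x\<^sup>3 = y z\<^sup>2\<close> on that cubic leaves one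
    coefficient of \<open>h\<close> open, fixed by the condition that \<open>h\<close> be singular at \<open>x1\<close>.\<close>
  define e2 e3 e4 where "e2 = p * q + p * r + p * w + q * r + q * w + r * w"
    and "e3 = p * q * r + p * q * w + p * r * w + q * r * w" and "e4 = p * q * r * w"
  define al be ga de ep ze et where "al = e2 - 3" and "be = - e3 - 4" and "ga = 1 - e2 + e3"
    and "de = e4 - 3 * e2 + 4 - (1 - e2 + e3)" and "ep = 3 * e3 + 2 * e2" and "ze = - 3 * e4 - 2 * e3" and "et = 2 * e4"
  note gr = al_def be_def ga_def de_def ep_def ze_def et_def
  have van: "eval3 F (rep y) = 0" if F: "homogeneous n F" "y \<in> X - {x7}" "eval3 F (cusp_pt a b c (T y)) = 0" for F n y
    using pts[OF F(2)] F(3) eval3_scale[OF F(1)] by auto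
  \<comment> \<open>The coefficient 2 is minus the root sum
    \<open>p + q + r + w = -2\<close>.\<close>
  have quartic: "y ^ 4 + 2 * y ^ 3 + e2 * y\<^sup>2 - e3 * y + e4 = (y - p) * (y - q) * ((y - r) * (y - w))" for y
    unfolding e2_def e3_def e4_def w by (simp add: power4_eq_xxxx power3_eq_cube power2_eq_square algebra_simps)
  obtain F where F: "homogeneous 2 F" "\<And>x y z. eval3 F (x *s a + y *s b + z *s c) =
      e2*x^2 + 0*y^2 + e4*z^2 + 2*y*z + (- e3)*x*z + 1*x*y"
    using quad_formE[OF bas(1), of e2 0 e4 2 "- e3" 1] by blast
  have pF: "eval3 F (cusp_pt a b c y) = (y - p) * (y - q) * ((y - r) * (y - w))" for y
    unfolding quartic[symmetric] cusp_pt_def F(2) by (simp add: power4_eq_xxxx power3_eq_cube power2_eq_square algebra_simps)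
  have QF: "isQ X F {x2, x1}"
  proof -
    have "F \<noteq> 0"
    proof
      assume "F = 0"
      thus False using F(2)[of 1 1 0] F(2)[of 1 0 0] by simp
    qed
    moreover have "eval3 F (rep y) = 0" if y: "y \<in> X - {x2, x1}" for y
    proof (cases "y = x7")
      case True thus ?thesis using F(2)[of 0 1 0] by (simp add: bas(3) eval3_scale[OF F(1)])
    next
      case False
      show ?thesis by (rule van[OF F(1)]) (use y False xs(2) in \<open>auto simp: pF p_def q_def r_def w_def\<close>)
    qed
    ultimately show ?thesis using F(1) xs by (auto simp: isQ_def)
  qed
  obtain h where h: "homogeneous 3 h" "\<And>x y z. eval3 h (x *s a + y *s b + z *s c) =
      de*x^3 + 0*y^3 + et*z^3 + al*x^2*y + ep*x^2*z + 1*x*y^2 + 2*y^2*z + ze*x*z^2 + ga*y*z^2 + be*x*y*z"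
    using cubic_formE[OF bas(1), of de 0 et al ep 1 2 ze ga be] by blast
  have "eval3 h (cusp_pt a b c y) = (y - 1)\<^sup>2 * (y + 2) * (y ^ 4 + 2 * y ^ 3 + e2 * y\<^sup>2 - e3 * y + e4)" for y
    unfolding cusp_pt_def h(2) gr by (simp add: power4_eq_xxxx power3_eq_cube power2_eq_square algebra_simps)
  hence ph: "eval3 h (cusp_pt a b c y) = (y - 1)\<^sup>2 * (y + 2) * ((y - p) * (y - q) * ((y - r) * (y - w)))" for y
    unfolding quartic .
  \<comment> \<open>The quadratic polar of \<open>h\<close> at \<open>x1\<close>, i.e. its tangent
    cone there; the linear polar vanishes by the choice of the coefficients.\<close>
  define qh where "qh = (\<lambda>x y z. 3 * y\<^sup>2 + 2 * y * (x + 2 * z) + y * (2 * al * x + be * x + be * z + 2 * ga * z) +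
    (al * x\<^sup>2 + be * x * z + ga * z\<^sup>2) + 3 * de * x\<^sup>2 + ep * (x\<^sup>2 + 2 * x * z) + ze * (z\<^sup>2 + 2 * x * z) + 3 * et * z\<^sup>2)"
  have polar: "eval3 h (u *s cusp_pt a b c 1 + v *s (x *s a + y *s b + z *s c)) =
      u * v\<^sup>2 * qh x y z + v ^ 3 * eval3 h (x *s a + y *s b + z *s c)" for u v x y z
  proof -
    have e1: "u *s cusp_pt a b c 1 + v *s (x *s a + y *s b + z *s c) =
      (u + v * x) *s a + (u + v * y) *s b + (u + v * z) *s c"
      by (simp add: cusp_pt_def vec3_eq_iff algebra_simps)
    show ?thesis unfolding e1 h(2) qh_def gr
      by (simp add: power3_eq_cube power2_eq_square algebra_simps)
  qed
  obtain m where m: "m \<noteq> 0" "rep x1 = m *s cusp_pt a b c 1" using pts[of x1] xs T by auto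
  have Ch: "isC X h x1"
  proof -
    have "ord_ge 2 h (rep x1) v" for v
    proof -
      obtain x y z where v: "v = x *s a + y *s b + z *s c" using basis_coordsE[OF bas(1)] by blast
      have "along h (cusp_pt a b c 1) v = [:0, 0, qh x y z, eval3 h v:]"
        using polar[of 1 _ x y z] unfolding v
        by (intro poly_ext) (simp add: poly_along power2_eq_square power3_eq_cube algebra_simps)
      hence "ord_ge 2 h (cusp_pt a b c 1) v" by (simp add: ord_ge_iff less_2_cases_iff)
      thus ?thesis unfolding m(2) by (rule ord_ge_scale[OF h(1)])
    qed
    moreover have "h \<noteq> 0"
    proof
      assume "h = 0"
      hence "qh 0 1 0 = 0" using polar[of 1 1 0 1 0] by simp
      thus False by (simp add: qh_def)
    qed
    moreover have "eval3 h (rep y) = 0" if y: "y \<in> X - {x1}" for y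
    proof (cases "y = x7")
      case True thus ?thesis using h(2)[of 0 1 0] by (simp add: bas(3) eval3_scale[OF h(1)])
    next
      case False
      show ?thesis by (rule van[OF h(1)]) (use y False xs(2) in \<open>auto simp: ph p_def q_def r_def w_def T\<close>)
    qed
    ultimately show ?thesis using h(1) xs by (auto simp: isC_def)
  qed
  obtain m2 where m2: "m2 \<noteq> 0" "rep x2 = m2 *s cusp_pt a b c (-2)" using pts[of x2] xs T by auto
  \<comment> \<open>On the line from the cusp \<open>x7\<close> to \<open>x2\<close> both
    \<open>F\<close> and \<open>h\<close> have contact two at \<open>x7\<close>, so they form the
    conjugate configuration, with \<open>x7\<close> and \<open>x1\<close> exchanged.\<close>
  have bdir: "b + t *s cusp_pt a b c (-2) = (-2 * t) *s a + (1 - 8 * t) *s b + t *s c" for t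
    by (simp add: cusp_pt_def vec3_eq_iff algebra_simps)
  have "along F b (cusp_pt a b c (-2)) = [:0, 0, 4 * e2 + e4 + 2 * e3:]"
    by (rule poly_ext) (simp only: poly_along bdir F(2), simp add: power2_eq_square algebra_simps)
  hence "ord_ge 2 F b (cusp_pt a b c (-2))" by (simp add: ord_ge_iff less_2_cases_iff)
  from ord_ge_in_span[OF F(1) this, of j 0 m2] have dF: "ord_ge 2 F (rep x7) (rep x2)" by (simp add: bas m2)
  have "along h b (cusp_pt a b c (-2)) = [:0, 0, 4 * al - 2 * be + ga,
      -8 * de + et - 32 * al + 4 * ep - 2 * ze - 8 * ga + 16 * be:]"
    by (rule poly_ext) (simp only: poly_along bdir h(2), simp add: power3_eq_cube power2_eq_square algebra_simps)
  hence "ord_ge 2 h b (cusp_pt a b c (-2))" by (simp add: ord_ge_iff less_2_cases_iff)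
  from ord_ge_in_span[OF h(1) this, of j 0 m2] have dh: "ord_ge 2 h (rep x7) (rep x2)" by (simp add: bas m2)
  show ?thesis
  proof (cases "card (tangent_lines h x1) = 2")
    case True
    have "construction_c (labelling [x7, x2, x3, x4, x5, x6, x1])"
      by (rule construction_cI[OF _ _ dp QF Ch _ _ dF dh True]) (use xs rep_indep[of x7 x2] in auto)
    moreover have "bij_betw (labelling [x7, x2, x3, x4, x5, x6, x1]) {1..7} X" by (rule labelling_bij) (use xs in auto)
    ultimately show ?thesis by blast
  next
    case False
    obtain w0 c0 f where cone: "d3 (rep x1) w0 c0 \<noteq> 0"
      "\<And>u y z. eval3 h (u *s rep x1 + (y *s w0 + z *s c0)) = u * (f * z\<^sup>2) + eval3 h (y *s w0 + z *s c0)"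
      using isC_tangent_cone[OF Ch False] by metis
    \<comment> \<open>A double line as tangent cone makes \<open>qh\<close> a multiple of the square
      of a linear form.\<close>
    have sq: "m * qh x y z = f * (d3 (rep x1) w0 (x *s a + y *s b + z *s c) / d3 (rep x1) w0 c0)\<^sup>2" for x y z
    proof -
      define v where "v = x *s a + y *s b + z *s c"
      obtain u1 u2 u3 where v: "v = u1 *s rep x1 + u2 *s w0 + u3 *s c0" using basis_coordsE[OF cone(1)] by blast
      have "rep x1 + v = (1 + u1) *s rep x1 + (u2 *s w0 + u3 *s c0)" "v = u1 *s rep x1 + (u2 *s w0 + u3 *s c0)"
        by (simp_all add: v vec3_eq_iff algebra_simps)
      hence "eval3 h (rep x1 + v) = (1 + u1) * (f * u3\<^sup>2) + eval3 h (u2 *s w0 + u3 *s c0)"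
        "eval3 h v = u1 * (f * u3\<^sup>2) + eval3 h (u2 *s w0 + u3 *s c0)" by (simp_all only: cone(2))
      hence "eval3 h (rep x1 + v) - eval3 h v = f * u3\<^sup>2" by (simp add: algebra_simps)
      moreover have "eval3 h (rep x1 + v) - eval3 h v = m * qh x y z"
        using polar[of m 1 x y z] by (simp add: m(2) v_def)
      moreover have "u3 = d3 (rep x1) w0 v / d3 (rep x1) w0 c0" using cone(1) by (simp add: v)
      ultimately show ?thesis by (simp add: v_def)
    qed
    \<comment> \<open>Comparing coefficients on the plane \<open>z = 0\<close>, which is
      complementary to the vector of \<open>x1\<close>, turns this into a vanishing
      discriminant.\<close>
    define ra rb where "ra = d3 (rep x1) w0 a / d3 (rep x1) w0 c0" and "rb = d3 (rep x1) w0 b / d3 (rep x1) w0 c0"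
    have qa: "m * (al + 3 * de + ep) = f * ra\<^sup>2" using sq[of 1 0 0] by (simp add: qh_def ra_def)
    have qb: "m * 3 = f * rb\<^sup>2" using sq[of 0 1 0] by (simp add: qh_def rb_def)
    have qab0: "m * (3 + 2 + 2 * al + be + (al + 3 * de + ep)) = f * (ra + rb)\<^sup>2"
      using sq[of 1 1 0] by (simp add: qh_def ra_def rb_def add_divide_distrib algebra_simps)
    have "m * (2 + 2 * al + be) = m * (3 + 2 + 2 * al + be + (al + 3 * de + ep)) - m * 3 - m * (al + 3 * de + ep)"
      by (simp add: algebra_simps)
    also have "\<dots> = f * (ra + rb)\<^sup>2 - f * rb\<^sup>2 - f * ra\<^sup>2" by (simp only: qab0 qa qb)
    also have "\<dots> = 2 * f * ra * rb" by (simp add: power2_eq_square algebra_simps)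
    finally have qab: "m * (2 + 2 * al + be) = 2 * f * ra * rb" .
    have "m\<^sup>2 * ((2 + 2 * al + be)\<^sup>2 - 12 * (al + 3 * de + ep)) =
      (m * (2 + 2 * al + be))\<^sup>2 - 4 * (m * 3) * (m * (al + 3 * de + ep))" by (simp add: power2_eq_square algebra_simps)
    also have "\<dots> = 0" unfolding qa qb qab by (simp add: power2_eq_square algebra_simps)
    finally have disc: "(2 + 2 * al + be)\<^sup>2 - 12 * (al + 3 * de + ep) = 0" using m(1) by simp
    have "(2 + 2 * al + be)\<^sup>2 - 12 * (al + 3 * de + ep) =
      - ((((1 - p) * (1 - q) - (1 - r) * (1 - w)) * ((1 - p) * (1 - r) - (1 - q) * (1 - w))) *
         ((1 - p) * (1 - w) - (1 - q) * (1 - r)))"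
      unfolding gr e2_def e3_def e4_def w by (simp add: power2_eq_square algebra_simps)
    with disc consider "(1 - p) * (1 - q) = (1 - r) * (1 - w)" | "(1 - p) * (1 - r) = (1 - q) * (1 - w)"
      | "(1 - p) * (1 - w) = (1 - q) * (1 - r)" by auto
    hence "\<exists>ys. distinct ys \<and> length ys = 7 \<and> set ys = X \<and> construction_a (labelling ys)"
    proof cases
      case 1
      have "construction_a (labelling [x1, x3, x4, x7, x2, x5, x6])"
        by (rule bicuspidal_construction_a[OF _ _ dp bas(1,3) pts T(1,2)])
          (use xs T(3) 1 in \<open>auto simp: p_def q_def r_def w_def add_ac\<close>)
      thus ?thesis using xs by (intro exI[of _ "[x1, x3, x4, x7, x2, x5, x6]"]) auto
    next
      case 2
      have "construction_a (labelling [x1, x3, x5, x7, x2, x4, x6])"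
        by (rule bicuspidal_construction_a[OF _ _ dp bas(1,3) pts T(1,2)])
          (use xs T(3) 2 in \<open>auto simp: p_def q_def r_def w_def add_ac\<close>)
      thus ?thesis using xs by (intro exI[of _ "[x1, x3, x5, x7, x2, x4, x6]"]) auto
    next
      case 3
      have "construction_a (labelling [x1, x3, x6, x7, x2, x4, x5])"
        by (rule bicuspidal_construction_a[OF _ _ dp bas(1,3) pts T(1,2)])
          (use xs T(3) 3 in \<open>auto simp: p_def q_def r_def w_def add_ac\<close>)
      thus ?thesis using xs by (intro exI[of _ "[x1, x3, x6, x7, x2, x4, x5]"]) auto
    qed
    thus ?thesis using labelling_bij by blast
  qed
qed

section \<open>From curves on the surface to classes\<close>

lemma isL_proportional_eq:
  assumes F: "isL X F S" and G: "isL X G T" and e: "G = cst k * F"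
  shows "S = T" "k \<noteq> 0"
proof -
  show k: "k \<noteq> 0" using G e by (auto simp: isL_def cst_def)
  have "S = {x\<in>X. eval3 F (rep x) = 0}" "T = {x\<in>X. eval3 G (rep x) = 0}"
    using F G isL_off[OF F] isL_off[OF G] by (auto simp: isL_def)
  thus "S = T" using e k by simp
qed

lemma isC_proportional:
  assumes G: "isC X G x" and e: "G = cst k * F"
  shows "k \<noteq> 0"
  using assms by (auto simp: isC_def cst_def)

fun realises :: "ppoint \<Rightarrow> complex^3 \<Rightarrow> bpoint set \<Rightarrow> cls \<Rightarrow> bool" where
  "realises p d C (clE x) \<longleftrightarrow> x \<in> X \<and> p = x \<and> C = exceptional_curve X x"
| "realises p d C (clL S) \<longleftrightarrow> (\<exists>F. isL X F S \<and> passes X F p d \<and> C = strict_transform X F)"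
| "realises p d C (clQ S) \<longleftrightarrow> (\<exists>F. isQ X F S \<and> passes X F p d \<and> C = strict_transform X F)"
| "realises p d C (clC x) \<longleftrightarrow> (\<exists>F. isC X F x \<and> passes X F p d \<and> C = strict_transform X F)"

lemma realises_valid: "realises p d C k \<Longrightarrow> cls_valid X k"
  by (cases k) (auto simp: isL_def isQ_def isC_def)

text \<open>Forms in the same class are proportional here, and proportional forms have the same
  strict transform. Hence distinct curves through the point have distinct classes.\<close>

lemma realises_unique:
  assumes "realises p d C k" "realises p d C' k" shows "C = C'"
proof (cases k)
  case (clE x) thus ?thesis using assms by simp
next
  case (clL S)
  then obtain F G where FG: "isL X F S" "passes X F p d" "C = strict_transform X F"
    "isL X G S" "passes X G p d" "C' = strict_transform X G" using assms by auto
  have "S \<inter> S \<noteq> {}" using FG(1) by (auto simp: isL_def)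
  then obtain k where "G = cst k * F" using isL_isL_proportional[OF FG(1,4,2,5)] by blast
  thus ?thesis using isL_proportional_eq[OF FG(1,4)] strict_transform_scale FG by metis
next
  case (clQ S)
  then obtain F G where FG: "isQ X F S" "passes X F p d" "C = strict_transform X F"
    "isQ X G S" "passes X G p d" "C' = strict_transform X G" using assms by auto
  have "S \<inter> S \<noteq> {}" using FG(1) by (auto simp: isQ_def)
  then obtain k where "G = cst k * F" using isQ_isQ_proportional[OF FG(1,4,2,5)] by blast
  thus ?thesis using isQ_proportional_eq[OF FG(1,4)] strict_transform_scale FG by metis
next
  case (clC x)
  then obtain F G where FG: "isC X F x" "C = strict_transform X F"
    "isC X G x" "C' = strict_transform X G" using assms by auto
  obtain k where "G = cst k * F" using isC_unique[OF FG(1,3)] by blast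
  thus ?thesis using isC_proportional[OF FG(3)] strict_transform_scale FG by metis
qed

lemma realises_meet:
  assumes r: "realises p d C k" "realises p d C' k'" and ne: "k \<noteq> k'"
  shows "cls_meet k k'"
proof (cases k; cases k')
  fix x y assume "k = clE x" "k' = clE y" thus ?thesis using r ne by simp
next
  fix x S assume "k = clE x" "k' = clL S" thus ?thesis using r isL_over(1) by auto
next
  fix x S assume "k = clE x" "k' = clQ S" thus ?thesis using r isQ_over(1) by auto
next
  fix S T assume k: "k = clL S" "k' = clL T"
  then obtain F G where FG: "isL X F S" "passes X F p d" "isL X G T" "passes X G p d" using r by auto
  have "S \<inter> T = {}" using isL_isL_proportional[OF FG(1,3,2,4)] isL_proportional_eq(1)[OF FG(1,3)] k ne by metis
  thus ?thesis using k by simp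
next
  fix S T assume "k = clL S" "k' = clQ T" thus ?thesis using r isL_isQ_meet by fastforce
next
  fix S x assume "k = clL S" "k' = clC x" thus ?thesis using r isL_isC_meet by auto
next
  fix S T assume k: "k = clQ S" "k' = clQ T"
  then obtain F G where FG: "isQ X F S" "passes X F p d" "isQ X G T" "passes X G p d" using r by auto
  have "S \<inter> T = {}" using isQ_isQ_proportional[OF FG(1,3,2,4)] isQ_proportional_eq(1)[OF FG(1,3)] k ne by metis
  thus ?thesis using k by simp
next
  fix S x assume "k = clQ S" "k' = clC x" thus ?thesis using r isQ_isC_meet by auto
next
  fix x y assume "k = clC x" "k' = clC y" thus ?thesis using r isC_isC_eq ne by auto
qed auto

lemma minus_one_curve_realises:
  assumes "minus_one_curve X C" "(p, l) \<in> C" "p \<in> X \<Longrightarrow> d \<in> Rep_pline (l p) \<and> cr (rep p) d \<noteq> 0"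
  shows "\<exists>k. realises p d C k"
proof -
  have passes: "passes X F p d" if "homogeneous n F" "C = strict_transform X F" for F n
    using strict_off[OF that(1)] strict_over[OF that(1)] assms that(2) by (auto simp: passes_def)
  from minus_one_curve_cases[OF assms(1)] consider x where "x \<in> X" "C = exceptional_curve X x"
    | F S where "isL X F S" "C = strict_transform X F" | F S where "isQ X F S" "C = strict_transform X F"
    | F x where "isC X F x" "C = strict_transform X F" by blast
  thus ?thesis
  proof cases
    case (1 x) thus ?thesis using assms(2) by (intro exI[of _ "clE x"]) (simp add: exceptional_curve_def)
  next
    case (2 F S) thus ?thesis using passes[of 1 F] by (intro exI[of _ "clL S"]) (auto simp: isL_def)
  next
    case (3 F S) thus ?thesis using passes[of 2 F] by (intro exI[of _ "clQ S"]) (auto simp: isQ_def)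
  next
    case (4 F x) thus ?thesis using passes[of 3 F] by (intro exI[of _ "clC x"]) (auto simp: isC_def)
  qed
qed

lemma eckardt_classes:
  assumes "generalized_eckardt_point X P"
  obtains p d K where "card K = 4" "\<And>k. k \<in> K \<Longrightarrow> \<exists>C. realises p d C k"
proof -
  obtain A where A: "P \<in> blowup X" "card A = 4" "\<And>C. C \<in> A \<Longrightarrow> minus_one_curve X C \<and> P \<in> C"
    using assms by (auto simp: generalized_eckardt_point_def)
  obtain p l where P: "P = (p, l)" by fastforce
  \<comment> \<open>Over a point of \<open>X\<close> the direction \<open>d\<close> spans, with
    \<open>rep p\<close>, the line of \<open>P\<close>; elsewhere \<open>d\<close> is arbitrary, as
    \<open>passes\<close> ignores it.\<close>
  obtain d where d: "p \<in> X \<Longrightarrow> d \<in> Rep_pline (l p) \<and> cr (rep p) d \<noteq> 0"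
  proof (cases "p \<in> X")
    case True
    hence "rep p \<in> Rep_pline (l p)" using A(1) by (auto simp: P blowup_def on_line_iff)
    thus thesis using pline_direction rep_nonzero that by blast
  qed (use that in blast)
  have "\<forall>C\<in>A. \<exists>k. realises p d C k"
  proof
    fix C assume "C \<in> A"
    thus "\<exists>k. realises p d C k"
      using A(3) d by (intro minus_one_curve_realises[of C p l d]) (simp_all add: P)
  qed
  then obtain f where f: "\<And>C. C \<in> A \<Longrightarrow> realises p d C (f C)" by metis
  have "inj_on f A" by (rule inj_onI) (metis f realises_unique)
  hence "card (f ` A) = 4" using A(2) by (simp add: card_image)
  thus ?thesis using that f by blast
qed

lemma card_4E:
  assumes "card S = 4"
  obtains a b p q where "S = {a, b, p, q}" "distinct [a, b, p, q]"
proof -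
  have "finite S" using assms card.infinite by fastforce
  then obtain xs where xs: "set xs = S" "distinct xs" using finite_distinct_list by blast
  hence "length xs = 4" using assms distinct_card by fastforce
  then obtain a b p q where "xs = [a, b, p, q]"
    by (auto simp: eval_nat_numeral length_Suc_conv)
  thus ?thesis using xs that by auto
qed

lemma point_and_three_pairs:
  assumes x: "x \<in> X - S - T - U" and d: "S \<inter> T = {}" "S \<inter> U = {}" "T \<inter> U = {}"
    and S: "S \<subseteq> X" "card S = 2" and T: "T \<subseteq> X" "card T = 2" and U: "U \<subseteq> X" "card U = 2"
  obtains x1 x2 x3 x4 x5 x6 where "S = {x1, x2}" "T = {x3, x4}" "U = {x5, x6}"
    "distinct [x1, x2, x3, x4, x5, x6, x]" "X = {x1, x2, x3, x4, x5, x6, x}"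
proof -
  obtain x1 x2 x3 x4 x5 x6 where e: "S = {x1, x2}" "x1 \<noteq> x2" "T = {x3, x4}" "x3 \<noteq> x4" "U = {x5, x6}" "x5 \<noteq> x6"
    using S T U by (metis card_2_iff)
  have dis: "distinct [x1, x2, x3, x4, x5, x6, x]" using e x d by auto
  have "card {x1, x2, x3, x4, x5, x6, x} = 7" using distinct_card[OF dis] by simp
  moreover have "{x1, x2, x3, x4, x5, x6, x} \<subseteq> X" using e S T U x by auto
  ultimately have "{x1, x2, x3, x4, x5, x6, x} = X" using card_subset_eq[OF finX] cardX by metis
  thus ?thesis using that e dis by metis
qed

lemma eckardt_construction:
  assumes dp: "del_pezzo_blowup X" and P: "generalized_eckardt_point X P"
  shows "\<exists>x. bij_betw x {1..7} X \<and> (construction_a x \<or> construction_b x \<or> construction_c x)"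
proof -
  obtain p d K where K: "card K = 4" "\<And>k. k \<in> K \<Longrightarrow> \<exists>C. realises p d C k" using eckardt_classes[OF P] by metis
  have bij: "\<exists>x. bij_betw x {1..7} X \<and> (construction_a x \<or> construction_b x \<or> construction_c x)"
    if "distinct ys" "length ys = 7" "set ys = X" "construction_a (labelling ys) \<or> construction_b (labelling ys) \<or> construction_c (labelling ys)" for ys
    using labelling_bij[OF that(1-3)] that(4) by blast
  have valid: "\<forall>k\<in>K. cls_valid X k" using K(2) realises_valid by blast
  have meet: "\<forall>k\<in>K. \<forall>k'\<in>K. k \<noteq> k' \<longrightarrow> cls_meet k k'" using K(2) realises_meet by metis
  from four_classes[OF finX cardX K(1) valid meet] show ?thesis
  proof (elim disjE exE conjE, goal_cases c b d a)
    case (c x y z)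
    have px: "p = x" using c(3) K(2)[of "clE x"] by auto
    obtain F where F: "isL X F {x, y}" "passes X F p d" using c(3) K(2)[of "clL {x, y}"] by auto
    obtain s where s: "isQ X s {y, z}" "passes X s p d" using c(3) K(2)[of "clQ {y, z}"] by auto
    obtain g where g: "isC X g z" "passes X g p d" using c(3) K(2)[of "clC z"] by auto
    have pX: "p \<in> X" using px c(2) by simp
    have "card (X - {x, y, z}) = 4" using c cardX finX by (simp add: card_Diff_subset)
    then obtain x3 x4 x5 x6 where 4: "X - {x, y, z} = {x3, x4, x5, x6}" "distinct [x3, x4, x5, x6]" using card_4E by metis
    have xs: "distinct [x, y, x3, x4, x5, x6, z]" "X = {x, y, x3, x4, x5, x6, z}" using c(1,2) 4 by auto
    note oF = isL_over[OF F pX] and os = isQ_over[OF s pX] and og = isC_over[OF g pX]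
    \<comment> \<open>The line \<open>x y\<close> passes through the common point over
      \<open>x\<close>, so \<open>d\<close> points towards \<open>y\<close>.\<close>
    have dy: "d3 (rep x) d (rep y) = 0"
      using linear_form_eq_0[of "rep x" d "rep y" F] F(1) oF(2) by (auto simp: isL_def)
    have gx: "ord_ge 2 g (rep x) d" using og(1) px c(1) by simp
    note tan = oF(3)[unfolded px] dy os(2)[unfolded px] gx
    show ?thesis
    proof (cases "card (tangent_lines g z) = 2")
      case True
      show ?thesis
        by (rule bij[of "[x, y, x3, x4, x5, x6, z]"])
          (use xs construction_cI[OF xs dp s(1) g(1) tan True] in auto)
    next
      case False
      show ?thesis by (rule cuspidal_case[OF xs dp s(1) g(1) tan False])
    qed
  next
    case (b x S T U)
    have px: "p = x" using b(5) K(2)[of "clE x"] by auto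
    have pX: "p \<in> X" using px b(1) by simp
    obtain s1 where s1: "isQ X s1 S" "passes X s1 p d" using b(5) K(2)[of "clQ S"] by auto
    obtain s2 where s2: "isQ X s2 T" "passes X s2 p d" using b(5) K(2)[of "clQ T"] by auto
    obtain s3 where s3: "isQ X s3 U" "passes X s3 p d" using b(5) K(2)[of "clQ U"] by auto
    obtain x1 x2 x3 x4 x5 x6 where e: "S = {x1, x2}" "T = {x3, x4}" "U = {x5, x6}"
      "distinct [x1, x2, x3, x4, x5, x6, x]" "X = {x1, x2, x3, x4, x5, x6, x}"
      using point_and_three_pairs[OF b(1-4)] s1(1) s2(1) s3(1) unfolding isQ_def by metis
    have "construction_b (labelling [x, x5, x6, x3, x4, x1, x2])"
      by (rule construction_bI[OF _ _ dp s1(1)[unfolded e(1)] s2(1)[unfolded e(2)] s3(1)[unfolded e(3)], of _ d])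
        (use e(4,5) isQ_over(2,3)[OF s1 pX] isQ_over(2)[OF s2 pX] isQ_over(2)[OF s3 pX] px in auto)
    thus ?thesis by (intro bij[of "[x, x5, x6, x3, x4, x1, x2]"]) (use e(4,5) in auto)
  next
    case (d x S T U)
    obtain F1 where F1: "isL X F1 S" "passes X F1 p d" using d(5) K(2)[of "clL S"] by auto
    obtain F2 where F2: "isL X F2 T" "passes X F2 p d" using d(5) K(2)[of "clL T"] by auto
    obtain F3 where F3: "isL X F3 U" "passes X F3 p d" using d(5) K(2)[of "clL U"] by auto
    obtain g where g: "isC X g x" "passes X g p d" using d(5) K(2)[of "clC x"] by auto
    \<comment> \<open>If the common point were over a point of \<open>X\<close>, that point would
      belong to two disjoint pairs.\<close>
    have pX: "p \<notin> X" using isL_over(1)[OF F1] isL_over(1)[OF F2] d(2) by blast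
    obtain x1 x2 x3 x4 x5 x6 where e: "S = {x1, x2}" "T = {x3, x4}" "U = {x5, x6}"
      "distinct [x1, x2, x3, x4, x5, x6, x]" "X = {x1, x2, x3, x4, x5, x6, x}"
      using point_and_three_pairs[OF d(1-4)] F1(1) F2(1) F3(1) unfolding isL_def by metis
    have "construction_b (labelling [x, x5, x6, x3, x4, x1, x2])"
      by (rule three_lines_construction_b[OF e(4,5) dp F1(1)[unfolded e(1)] F2(1)[unfolded e(2)] F3(1)[unfolded e(3)] g(1) pX])
        (use passes_off[OF _ pX] F1 F2 F3 g in auto)
    thus ?thesis by (intro bij[of "[x, x5, x6, x3, x4, x1, x2]"]) (use e(4,5) in auto)
  next
    case (a x y z w)
    obtain F1 where F1: "isL X F1 {x, y}" "passes X F1 p d" using a(3) K(2)[of "clL {x, y}"] by auto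
    obtain F2 where F2: "isL X F2 {z, w}" "passes X F2 p d" using a(3) K(2)[of "clL {z, w}"] by auto
    obtain s1 where s1: "isQ X s1 {y, w}" "passes X s1 p d" using a(3) K(2)[of "clQ {y, w}"] by auto
    obtain s2 where s2: "isQ X s2 {x, z}" "passes X s2 p d" using a(3) K(2)[of "clQ {x, z}"] by auto
    have pX: "p \<notin> X" using isL_over(1)[OF F1] isL_over(1)[OF F2] a(1) by auto
    have "card {x, y, z, w} = 4" using distinct_card[OF a(1)] by simp
    hence "card (X - {x, y, z, w}) = 3" using a(2) cardX by (subst card_Diff_subset) auto
    then obtain x5 x6 x7 where 3: "X - {x, y, z, w} = {x5, x6, x7}" "x5 \<noteq> x6" "x5 \<noteq> x7" "x6 \<noteq> x7" unfolding card_3_iff by blast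
    have xs: "distinct [x, y, z, w, x5, x6, x7]" "X = {x, y, z, w, x5, x6, x7}" using a(1,2) 3 by auto
    have "construction_a (labelling [x, y, z, w, x5, x6, x7])"
      by (rule construction_aI[OF xs dp F1(1) F2(1) s1(1) s2(1), of p])
        (use passes_off[OF _ pX] F1 F2 s1 s2 in auto)
    thus ?thesis by (intro bij[of "[x, y, z, w, x5, x6, x7]"]) (use xs in auto)
  qed
qed

end

theorem proposition4p13:
  fixes X :: "ppoint set"
  assumes "card X = 7"
    and "del_pezzo_blowup X"
    and "surface_degree X = 2"
    and "\<exists>P. generalized_eckardt_point X P"
  shows "\<exists>x. bij_betw x {1..7} X \<and>
    (construction_a x \<or> construction_b x \<or> construction_c x)"
  using assms dp2.eckardt_construction del_pezzo_dp2 by blast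

end
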